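(* Let $\alpha\in(0,2)$, let $(a_n)_{n\ge1}$ be a sequence of positive real numbers that is regularly varying with exponent $1/\alpha$, i.e. $\lim_{n\to\infty}a_{\lfloor rn\rfloor}/a_n=r^{1/\alpha}$ for every $r>0$, and suppose that $$\lim_{n\to\infty}\frac{X_1+\cdots+X_n}{a_n}=Z\qquad\text{in distribution},$$ where $Z$ is some $\alpha$-stable random variable with characteristic exponent $\varphi_\alpha$, i.e. $\mathbb{E}(\exp(\mathrm{i}\theta Z))=\exp(-\varphi_\alpha(\theta))$ for all $\theta\in\mathbb{R}$ (here $\mathrm i$ is the imaginary unit). Then for each $p\in(0,1)$, the random walk with counterbalanced steps $\check S$ with innovation parameter $p$ and steps built from $(X_n)$ satisfies $$\lim_{n\to\infty}\frac{\check S(n)}{a_n}=\check Z\qquad\text{in distribution},$$ where $\check Z$ is an $\alpha$-stable random variable with characteristic exponent $\check\varphi_\alpha$ (i.e. $\mathbb{E}(\exp(\mathrm{i}\theta\check Z))=\exp(-\check\varphi_\alpha(\theta))$) given by $$\check\varphi_\alpha(\theta)=\frac{p}{1-p}\sum_{k=1}^\infty\sum_{\ell=0}^{k-1}\frac{\varphi_\alpha((k-2\ell)\theta)}{(1+1/(1-p))^{(k)}}\left\langle {k-1\atop \ell-1}\right\rangle,\qquad\theta\in\mathbb{R}.$$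
   Context: Counterbalanced steps: let $\mu$ be a probability law on $\mathbb{R}$ and $p\in(0,1)$. Let $(X_n)_{n\ge1}$ be i.i.d. real random variables with law $\mu$; let $(\varepsilon_n)_{n\ge2}$ be i.i.d. Bernoulli variables with $\mathbb{P}(\varepsilon_n=1)=p$, $\mathbb{P}(\varepsilon_n=0)=1-p$, and set $\varepsilon_1=1$; let $(v(n))_{n\ge2}$ be independent random variables with $v(n)$ uniform on $\{1,\dots,n-1\}$. The three sequences $(X_n)$, $(\varepsilon_n)$, $(v(n))$ are independent of each other. Put $\mathrm{i}(n)=\sum_{j=1}^n\varepsilon_j$ for $n\ge1$ (the number of innovations up to step $n$). Define recursively $\check X_n=X_{\mathrm{i}(n)}$ if $\varepsilon_n=1$ (in particular $\check X_1=X_1$), and $\check X_n=-\check X_{v(n)}$ if $\varepsilon_n=0$; set $\check S(n)=\check X_1+\cdots+\check X_n$, $n\ge0$. Stable laws: as there is no centering in the assumed convergence, $\varphi_\alpha$ is homogeneous with exponent $\alpha$, i.e. $\varphi_\alpha(\theta)=|\theta|^\alpha\varphi_\alpha(\mathrm{sgn}(\theta))$ for all $\theta\ne0$ (and $\varphi_\alpha(0)=0$). Eulerian numbers: for $n\ge1$, $\left\langle {n\atop k}\right\rangle$ is the number of permutations $\varsigma$ of $\{1,\dots,n\}$ with exactly $k$ descents, i.e. $\#\{1\le j<n:\varsigma(j)>\varsigma(j+1)\}=k$; it is $0$ unless $0\le k<n$. For $n=0$ the convention is $\left\langle {0\atop -1}\right\rangle=1$. Rising factorial: $(x)^{(k)}=\Gamma(x+k)/\Gamma(x)=\prod_{j=0}^{k-1}(x+j)$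 for $x>0$, $k\in\mathbb{N}=\{1,2,\dots\}$. *)

theory Defs
  imports "HOL-Probability.Probability" "HOL-Combinatorics.Permutations"
begin

definition regularly_varying :: "(nat \<Rightarrow> real) \<Rightarrow> real \<Rightarrow> bool" where
  "regularly_varying a \<rho> \<longleftrightarrow>
     (\<forall>r>0. (\<lambda>n. a (nat \<lfloor>r * real n\<rfloor>) / a n) \<longlonglongrightarrow> r powr \<rho>)"

text \<open>
  A law is stable with index \<open>\<alpha>\<close> if it is not a point mass and, for every \<open>n \<ge> 1\<close>, the sum of
  \<open>n\<close> independent copies of \<open>Z\<close> has the law of \<open>n\<^sup>1\<^sup>/\<^sup>\<alpha> Z + b\<close> for some real \<open>b\<close> depending on \<open>n\<close>.
  Point masses are excluded because they have no well-defined index.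
\<close>

definition stable_law :: "real \<Rightarrow> real measure \<Rightarrow> bool" where
  "stable_law \<alpha> \<nu> \<longleftrightarrow>
     0 < \<alpha> \<and> \<alpha> \<le> 2 \<and> real_distribution \<nu> \<and> (\<forall>c. \<nu> \<noteq> return borel c) \<and>
     (\<forall>n\<ge>1. \<exists>b. distr (PiM {..<n} (\<lambda>_. \<nu>)) borel (\<lambda>x. \<Sum>i<n. x i)
                = distr \<nu> borel (\<lambda>x. real n powr (1 / \<alpha>) * x + b))"

text \<open>
  Continuity and \<open>\<phi> 0 = 0\<close> single out the characteristic exponent among all functions
  satisfying the last equation, which determines \<open>\<phi> \<theta>\<close> only modulo \<open>2\<pi>\<i>\<close>.
\<close>

definition characteristic_exponent :: "real measure \<Rightarrow> (real \<Rightarrow> complex) \<Rightarrow> bool" where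
  "characteristic_exponent \<nu> \<phi> \<longleftrightarrow>
     continuous_on UNIV \<phi> \<and> \<phi> 0 = 0 \<and> (\<forall>\<theta>. char \<nu> \<theta> = exp (- \<phi> \<theta>))"

definition innovations :: "(nat \<Rightarrow> bool) \<Rightarrow> nat \<Rightarrow> nat" where
  "innovations e n = (\<Sum>j=1..n. of_bool (e j))"

text \<open>
  The last branch only makes the recursion total: in the model below it is reached
  at an index \<open>n \<ge> 1\<close> with probability zero.
\<close>

fun counterbalanced_step ::
    "(nat \<Rightarrow> real) \<Rightarrow> (nat \<Rightarrow> bool) \<Rightarrow> (nat \<Rightarrow> nat) \<Rightarrow> nat \<Rightarrow> real" where
  "counterbalanced_step x e u n =
     (if e n then x (innovations e n)
      else if 1 \<le> u n \<and> u n < n then - counterbalanced_step x e u (u n)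
      else 0)"

declare counterbalanced_step.simps [simp del]

definition counterbalanced_walk ::
    "(nat \<Rightarrow> real) \<Rightarrow> (nat \<Rightarrow> bool) \<Rightarrow> (nat \<Rightarrow> nat) \<Rightarrow> nat \<Rightarrow> real" where
  "counterbalanced_walk x e u n = (\<Sum>j=1..n. counterbalanced_step x e u j)"

text \<open>
  The three driving sequences merged into one real-valued family, so that their joint
  independence can be stated with \<^const>\<open>prob_space.indep_vars\<close>, which requires a common value
  type. The embeddings of \<^typ>\<open>bool\<close> and \<^typ>\<open>nat\<close> into \<^typ>\<open>real\<close> are injective and do not
  change the generated sigma-algebras.
\<close>

definition merged_family ::
    "(nat \<Rightarrow> 'a \<Rightarrow> real) \<Rightarrow> (nat \<Rightarrow> 'a \<Rightarrow> bool) \<Rightarrow> (nat \<Rightarrow> 'a \<Rightarrow> nat) \<Rightarrow> nat + nat + nat \<Rightarrow> 'a \<Rightarrow> real" where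
  "merged_family X \<epsilon> v i \<omega> =
     (case i of Inl n \<Rightarrow> X n \<omega>
      | Inr (Inl n) \<Rightarrow> of_bool (\<epsilon> n \<omega>)
      | Inr (Inr n) \<Rightarrow> real (v n \<omega>))"

text \<open>
  Joint independence of the merged family says that each of the three sequences consists of
  independent variables and that the three sequences are independent of each other.
  The Bernoulli variables \<open>\<epsilon> n\<close> are truth values, \<^const>\<open>True\<close> standing for 1.
\<close>

definition counterbalanced_model ::
    "'a measure \<Rightarrow> real measure \<Rightarrow> real \<Rightarrow> (nat \<Rightarrow> 'a \<Rightarrow> real) \<Rightarrow> (nat \<Rightarrow> 'a \<Rightarrow> bool)
      \<Rightarrow> (nat \<Rightarrow> 'a \<Rightarrow> nat) \<Rightarrow> bool" where
  "counterbalanced_model M \<mu> p X \<epsilon> v \<longleftrightarrow>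
     prob_space M \<and>
     (\<forall>n\<ge>1. X n \<in> borel_measurable M \<and> distr M borel (X n) = \<mu>) \<and>
     (\<forall>\<omega>\<in>space M. \<epsilon> 1 \<omega>) \<and>
     (\<forall>n\<ge>2. \<epsilon> n \<in> measurable M (count_space UNIV) \<and>
        distr M (count_space UNIV) (\<epsilon> n) = measure_pmf (bernoulli_pmf p)) \<and>
     (\<forall>n\<ge>2. v n \<in> measurable M (count_space UNIV) \<and>
        distr M (count_space UNIV) (v n) = measure_pmf (pmf_of_set {1..n - 1})) \<and>
     prob_space.indep_vars M (\<lambda>_. borel) (merged_family X \<epsilon> v) ({1..} <+> ({2..} <+> {2..}))"

definition eulerian :: "nat \<Rightarrow> int \<Rightarrow> nat" where
  "eulerian n k =
     (if n = 0 then (if k = -1 then 1 else 0)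
      else card {\<sigma>. \<sigma> permutes {1..n} \<and> int (card {j. 1 \<le> j \<and> j < n \<and> \<sigma> j > \<sigma> (j + 1)}) = k})"

text \<open>For \<open>k = 0\<close> the sum is empty, so summing over all \<open>k\<close> is summing over \<open>k \<ge> 1\<close>.\<close>

definition counterbalanced_term :: "real \<Rightarrow> (real \<Rightarrow> complex) \<Rightarrow> real \<Rightarrow> nat \<Rightarrow> complex" where
  "counterbalanced_term p \<phi> \<theta> k =
     (\<Sum>l<k. \<phi> (real_of_int (int k - 2 * int l) * \<theta>)
              / of_real (pochhammer (1 + 1 / (1 - p)) k)
              * of_nat (eulerian (k - 1) (int l - 1)))"

definition counterbalanced_exponent :: "real \<Rightarrow> (real \<Rightarrow> complex) \<Rightarrow> real \<Rightarrow> complex" where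
  "counterbalanced_exponent p \<phi> \<theta> =
     of_real (p / (1 - p)) * (\<Sum>k. counterbalanced_term p \<phi> \<theta> k)"

end

theory Submission
  imports Defs "HOL-Combinatorics.Multiset_Permutations"
begin

text \<open>
  The steps split into clusters, one for each innovation; the \<open>j\<close>-th cluster contributes
  \<open>(a - b) X j\<close> to the walk, where \<open>a\<close> and \<open>b\<close> count its members of even and odd generation. The
  clusters depend only on \<open>\<epsilon>\<close> and \<open>v\<close>, so the characteristic function of \<open>S n / a n\<close> is the mean of
  \<open>\<Prod>j. \<Psi> ((a - b) \<theta> / a n)\<close>, with \<open>\<Psi>\<close> the characteristic function of \<open>\<mu>\<close>. By assumption
  \<open>n (1 - \<Psi> (\<theta> / a n))\<close> tends to \<open>\<phi> \<theta>\<close>, so the product is close to \<open>exp (- \<Sum> \<phi> ((a - b) \<theta>) / n)\<close>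
  with the sum taken over the clusters.

  The number of clusters of type \<open>(a, b)\<close> satisfies a linear recursion in conditional mean. Its
  stationary solution is given by the Eulerian numbers, whose recurrence is the same, and the
  variances grow at most linearly, whence a law of large numbers for each type. Large clusters are
  negligible because the mean of the sum of the \<open>(a - b)\<^sup>2\<close> is at most \<open>n\<close>, while
  \<open>n \<bar>1 - \<Psi> (d \<theta> / a n)\<bar> \<le> \<delta> d\<^sup>2 + C\<close> for every \<open>\<delta> > 0\<close>, as \<open>\<alpha> < 2\<close>. The limit exponent has the
  form \<open>P \<phi> \<theta> + N \<phi> (- \<theta>)\<close> by homogeneity, so it belongs to the law of a difference of
  two independent multiples of \<open>Z\<close>.
\<close>

subsection \<open>Eulerian numbers\<close>

text \<open>Convergence in law only says that \<open>\<Psi> (\<theta> / a n) ^ n\<close> tends to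
  \<open>exp (- \<phi> \<theta>)\<close>, which fixes \<open>n\<close> times a logarithm of
  \<open>\<Psi>\<close> only modulo \<open>2\<pi>\<i>\<close>. The right branch is the one continued
  from \<open>0\<close>, so the convergence must hold uniformly on whole segments and not just
  pointwise. Infinitely many cluster types occur and \<open>\<phi> (d \<theta>)\<close> is unbounded
  in \<open>d\<close>, so a law of large numbers for each fixed type does not control the sum. The
  second moment of \<open>a - b\<close> does: a repetition has the opposite sign of its parent,
  which pulls the imbalance of a cluster back to zero and keeps the sum of squares linear in
  \<open>n\<close> for every \<open>p\<close>. The same moment bound, passed to the limit, makes the
  series summable, so no estimate of Eulerian numbers is required; only their recurrence enters.
  Homogeneity is derived rather than read off from stability, whose definition allows shifts: the
  limit along \<open>n\<close> is compared with the limit along the integer part of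
  \<open>r n\<close>.\<close>

fun descents :: "'a::linorder list \<Rightarrow> nat" where
  "descents [] = 0"
| "descents [x] = 0"
| "descents (x # y # zs) = of_bool (y < x) + descents (y # zs)"

lemma descents_Cons: "descents (x # ys) = of_bool (ys \<noteq> [] \<and> hd ys < x) + descents ys"
  by (cases ys) auto

lemma descents_append:
  "descents (xs @ ys) = descents xs + descents ys + of_bool (xs \<noteq> [] \<and> ys \<noteq> [] \<and> hd ys < last xs)"
  by (induction xs) (auto simp: descents_Cons hd_append)

lemma descents_conv_sum: "descents xs = (\<Sum>i<length xs - 1. of_bool (xs ! Suc i < xs ! i))"
proof (induction xs rule: descents.induct)
  case (3 x y zs)
  have "(\<Sum>i<length (x # y # zs) - 1. of_bool ((x # y # zs) ! Suc i < (x # y # zs) ! i))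
      = of_bool (y < x) + (\<Sum>i<length zs. of_bool ((y # zs) ! Suc i < (y # zs) ! i) :: nat)"
    by (simp add: sum.lessThan_Suc_shift del: sum.lessThan_Suc)
  then show ?case using 3 by simp
qed auto

text \<open>A new maximum makes a descent with its right neighbour, if there is one, and an ascent
  with its left neighbour, while the pair it separates is lost. The count therefore stays the same
  exactly at the right end and inside an existing descent.\<close>

lemma descents_insert_maximum:
  assumes "\<And>x. x \<in> set xs \<Longrightarrow> x < m" and i: "i \<le> length xs"
  shows "descents (take i xs @ m # drop i xs)
           = descents xs + of_bool (i < length xs \<and> \<not> (0 < i \<and> xs ! i < xs ! (i - 1)))"
proof -
  have "descents (take i xs @ m # drop i xs)
      = descents (take i xs) + descents (drop i xs) + of_bool (i < length xs)"
  proof -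
    have "\<not> m < last (take i xs)" if "take i xs \<noteq> []"
      using assms(1)[OF in_set_takeD[OF last_in_set[OF that]]] by simp
    moreover have "hd (drop i xs) < m" if "i < length xs"
      using assms(1)[of "xs ! i"] that by (simp add: hd_drop_conv_nth)
    ultimately show ?thesis by (auto simp: descents_append descents_Cons)
  qed
  moreover have "descents xs = descents (take i xs) + descents (drop i xs)
      + of_bool (0 < i \<and> i < length xs \<and> xs ! i < xs ! (i - 1))"
  proof -
    have "last (take i xs) = xs ! (i - 1)" if "0 < i"
      using that i by (subst last_conv_nth) (auto simp: min_def)
    then show ?thesis
      using descents_append[of "take i xs" "drop i xs"] by (auto simp: hd_drop_conv_nth)
  qed
  ultimately show ?thesis using i by auto
qed

text \<open>Of the \<open>length xs + 1\<close> gaps, the \<open>d\<close> descents and the right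
  end keep the count and the other \<open>length xs - d\<close> raise it by one. The function
  \<open>g\<close> is later the indicator of a single value.\<close>

lemma sum_descents_insert_maximum:
  fixes g :: "nat \<Rightarrow> real"
  assumes "\<And>x. x \<in> set xs \<Longrightarrow> x < m"
  defines "d \<equiv> descents xs"
  shows "(\<Sum>i\<le>length xs. g (descents (take i xs @ m # drop i xs)))
           = (real d + 1) * g d + (real (length xs) - real d) * g (Suc d)"
proof -
  define P where "P i \<longleftrightarrow> i < length xs \<and> \<not> (0 < i \<and> xs ! i < xs ! (i - 1))" for i
  have "(\<Sum>i\<le>length xs. of_bool (P i)) = (\<Sum>i<length xs. 1 - of_bool (0 < i \<and> xs ! i < xs ! (i - 1)) :: real)"
  proof -
    have "(\<Sum>i\<le>length xs. of_bool (P i)) = (\<Sum>i<length xs. of_bool (P i) :: real)"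
      by (rule sum.mono_neutral_right) (auto simp: P_def)
    also have "\<dots> = (\<Sum>i<length xs. 1 - of_bool (0 < i \<and> xs ! i < xs ! (i - 1)))"
      by (rule sum.cong) (auto simp: P_def intro!: gr0I)
    finally show ?thesis .
  qed
  also have "\<dots> = real (length xs) - (\<Sum>i<length xs. of_bool (0 < i \<and> xs ! i < xs ! (i - 1)))"
    by (simp add: sum_subtractf)
  also have "(\<Sum>i<length xs. of_bool (0 < i \<and> xs ! i < xs ! (i - 1))) = real d"
  proof (cases "length xs")
    case (Suc l)
    have "(\<Sum>i<Suc l. of_bool (0 < i \<and> xs ! i < xs ! (i - 1))) = (\<Sum>i<l. of_bool (xs ! Suc i < xs ! i) :: real)"
      unfolding sum.lessThan_Suc_shift by (simp del: sum_of_bool_eq)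
    then show ?thesis unfolding d_def descents_conv_sum Suc by (simp del: sum_of_bool_eq sum.lessThan_Suc)
  qed (simp add: d_def)
  finally have P: "(\<Sum>i\<le>length xs. of_bool (P i)) = real (length xs) - real d" .
  have "(\<Sum>i\<le>length xs. g (descents (take i xs @ m # drop i xs)))
      = (\<Sum>i\<le>length xs. g d + of_bool (P i) * (g (Suc d) - g d))"
    using descents_insert_maximum[OF assms(1)] by (intro sum.cong) (auto simp: d_def P_def)
  also have "\<dots> = (real (length xs) + 1) * g d + (real (length xs) - real d) * (g (Suc d) - g d)"
    by (simp add: sum.distrib P flip: sum_distrib_right)
  finally show ?thesis by (simp add: algebra_simps)
qed

lemma sum_permutations_of_set_insert:
  assumes A: "finite A" "m \<notin> A"
  shows "(\<Sum>ys\<in>permutations_of_set (insert m A). f ys)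
           = (\<Sum>xs\<in>permutations_of_set A. \<Sum>i\<le>card A. f (take i xs @ m # drop i xs))"
proof -
  have bij: "bij_betw (\<lambda>(xs, i). take i xs @ m # drop i xs)
      (permutations_of_set A \<times> {..card A}) (permutations_of_set (insert m A))"
    unfolding bij_betw_def
  proof
    show "inj_on (\<lambda>(xs, i). take i xs @ m # drop i xs) (permutations_of_set A \<times> {..card A})"
    proof (rule inj_onI, clarify)
      fix xs i ys j
      assume *: "xs \<in> permutations_of_set A" "i \<le> card A" "ys \<in> permutations_of_set A" "j \<le> card A"
        and eq: "take i xs @ m # drop i xs = take j ys @ m # drop j ys"
      have "m \<notin> set xs" "m \<notin> set ys" using A * by (auto simp: permutations_of_set_def)
      then have "m \<notin> set (take i xs)" "m \<notin> set (drop i xs)" "m \<notin> set (take j ys)" "m \<notin> set (drop j ys)"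
        by (auto dest!: in_set_takeD in_set_dropD)
      then have e: "take i xs = take j ys" "drop i xs = drop j ys"
        using eq append_Cons_eq_iff[of m "take i xs" "drop i xs" "take j ys" "drop j ys"] by auto
      then have "xs = ys" by (metis append_take_drop_id)
      moreover have "length (take i xs) = i" "length (take j ys) = j"
        using * by (auto simp: length_finite_permutations_of_set)
      ultimately show "xs = ys \<and> i = j" using e by metis
    qed
    show "(\<lambda>(xs, i). take i xs @ m # drop i xs) ` (permutations_of_set A \<times> {..card A})
        = permutations_of_set (insert m A)"
    proof (intro equalityI subsetI)
      fix ys assume "ys \<in> (\<lambda>(xs, i). take i xs @ m # drop i xs) ` (permutations_of_set A \<times> {..card A})"
      then obtain xs i where xs: "xs \<in> permutations_of_set A" and ys: "ys = take i xs @ m # drop i xs" by auto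
      define us vs where "us = take i xs" and "vs = drop i xs"
      have "us @ vs \<in> permutations_of_set A" using xs by (simp add: us_def vs_def)
      then have "us @ m # vs \<in> permutations_of_set (insert m A)"
        using A by (auto simp: permutations_of_set_def)
      then show "ys \<in> permutations_of_set (insert m A)" by (simp add: ys us_def vs_def)
    next
      fix ys assume ys: "ys \<in> permutations_of_set (insert m A)"
      then have "m \<in> set ys" by (auto dest: permutations_of_setD)
      then obtain us vs where uv: "ys = us @ m # vs" by (meson split_list)
      have "us @ vs \<in> permutations_of_set A" using ys A uv
        by (auto simp: permutations_of_set_def)
      moreover from this have "length us \<le> card A"
        using length_finite_permutations_of_set by fastforce
      ultimately show "ys \<in> (\<lambda>(xs, i). take i xs @ m # drop i xs) ` (permutations_of_set A \<times> {..card A})"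
        by (intro image_eqI[of _ _ "(us @ vs, length us)"]) (auto simp: uv)
    qed
  qed
  show ?thesis
    by (subst sum.reindex_bij_betw[OF bij, symmetric]) (simp add: sum.cartesian_product case_prod_unfold)
qed

text \<open>Lists replace permuting functions because inserting a new maximum into a list is a
  splice, whereas on functions it shifts all later arguments.\<close>

lemma bij_betw_permutes_permutations_of_set:
  "bij_betw (\<lambda>\<sigma>. map \<sigma> [1..<Suc n]) {\<sigma>. \<sigma> permutes {1..n}} (permutations_of_set {1..n})"
proof -
  have inj: "inj_on (\<lambda>\<sigma>. map \<sigma> [1..<Suc n]) {\<sigma>. \<sigma> permutes {1..n}}"
  proof (rule inj_onI, clarify)
    fix \<sigma> \<tau> assume *: "\<sigma> permutes {1..n}" "\<tau> permutes {1..n}" and eq: "map \<sigma> [1..<Suc n] = map \<tau> [1..<Suc n]"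
    show "\<sigma> = \<tau>"
    proof
      fix x show "\<sigma> x = \<tau> x"
      proof (cases "x \<in> {1..n}")
        case True
        then have "x \<in> set [1..<Suc n]" by (simp del: upt_Suc)
        then show ?thesis using eq by (simp only: map_eq_conv)
      qed (simp add: * [THEN permutes_not_in])
    qed
  qed
  have sub: "(\<lambda>\<sigma>. map \<sigma> [1..<Suc n]) ` {\<sigma>. \<sigma> permutes {1..n}} \<subseteq> permutations_of_set {1..n}"
  proof clarify
    fix \<sigma> assume *: "\<sigma> permutes {1..n}"
    have s: "set [1..<Suc n] = {1..n}" by auto
    show "map \<sigma> [1..<Suc n] \<in> permutations_of_set {1..n}"
      unfolding permutations_of_set_def mem_Collect_eq distinct_map set_map s
      using permutes_image[OF *] permutes_inj_on[OF *] by auto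
  qed
  have "card ((\<lambda>\<sigma>. map \<sigma> [1..<Suc n]) ` {\<sigma>. \<sigma> permutes {1..n}}) = card (permutations_of_set {1..n})"
    using inj by (simp add: card_image card_permutations)
  with sub have "(\<lambda>\<sigma>. map \<sigma> [1..<Suc n]) ` {\<sigma>. \<sigma> permutes {1..n}} = permutations_of_set {1..n}"
    by (intro card_subset_eq) auto
  with inj show ?thesis by (simp add: bij_betw_def)
qed

lemma eulerian_conv_descents:
  assumes "n \<ge> 1"
  shows "eulerian n k = (\<Sum>xs\<in>permutations_of_set {1..n}. of_bool (int (descents xs) = k))"
proof -
  have d: "card {j. 1 \<le> j \<and> j < n \<and> \<sigma> j > \<sigma> (j + 1)} = descents (map \<sigma> [1..<Suc n])" for \<sigma> :: "nat \<Rightarrow> nat"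
  proof -
    have "descents (map \<sigma> [1..<Suc n]) = (\<Sum>i<n - 1. of_bool (\<sigma> (Suc (Suc i)) < \<sigma> (Suc i)))"
      unfolding descents_conv_sum by (intro sum.cong) (auto simp del: upt_Suc)
    also have "\<dots> = card {i. i < n - 1 \<and> \<sigma> (Suc (Suc i)) < \<sigma> (Suc i)}"
      by (simp add: sum.If_cases of_bool_def Int_def)
    also have "\<dots> = card (Suc ` {i. i < n - 1 \<and> \<sigma> (Suc (Suc i)) < \<sigma> (Suc i)})"
      by (simp add: card_image)
    also have "Suc ` {i. i < n - 1 \<and> \<sigma> (Suc (Suc i)) < \<sigma> (Suc i)} = {j. 1 \<le> j \<and> j < n \<and> \<sigma> j > \<sigma> (j + 1)}"
    proof (intro equalityI subsetI)
      fix j assume "j \<in> {j. 1 \<le> j \<and> j < n \<and> \<sigma> j > \<sigma> (j + 1)}"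
      then show "j \<in> Suc ` {i. i < n - 1 \<and> \<sigma> (Suc (Suc i)) < \<sigma> (Suc i)}"
        by (intro image_eqI[of _ _ "j - 1"]) auto
    qed auto
    finally show ?thesis ..
  qed
  have fin: "finite {\<sigma>. \<sigma> permutes {1..n}}" by (simp add: finite_permutations)
  have "eulerian n k = card ({\<sigma>. \<sigma> permutes {1..n}} \<inter> {\<sigma>. int (descents (map \<sigma> [1..<Suc n])) = k})"
    using assms unfolding eulerian_def d by (simp add: Int_def)
  also have "\<dots> = (\<Sum>\<sigma> | \<sigma> permutes {1..n}. of_bool (int (descents (map \<sigma> [1..<Suc n])) = k))"
    using fin by (simp add: sum.If_cases of_bool_def)
  also have "\<dots> = (\<Sum>xs\<in>permutations_of_set {1..n}. of_bool (int (descents xs) = k))"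
    by (rule sum.reindex_bij_betw[OF bij_betw_permutes_permutations_of_set])
  finally show ?thesis .
qed

lemma eulerian_one: "eulerian (Suc 0) k = of_bool (k = 0)"
proof -
  have "permutations_of_set {1..Suc 0} = {[Suc 0]}"
    by (simp add: permutations_of_set_singleton)
  then show ?thesis by (subst eulerian_conv_descents) auto
qed

text \<open>Each permutation of \<open>{1..Suc n}\<close> arises once by inserting
  \<open>Suc n\<close> into a permutation of \<open>{1..n}\<close>. Integer \<open>k\<close> and
  real coefficients avoid truncated subtraction and let the recurrence hold from
  \<open>n = 0\<close>, where the convention at \<open>k = -1\<close> produces the one permutation
  of a single element.\<close>

lemma eulerian_Suc:
  "real (eulerian (Suc n) k)
     = (of_int k + 1) * real (eulerian n k) + (real n + 1 - of_int k) * real (eulerian n (k - 1))"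
proof (cases "n = 0")
  case True
  then show ?thesis by (auto simp: eulerian_one eulerian_def)
next
  case False
  then have n: "n \<ge> 1" by simp
  have "real (eulerian (Suc n) k)
      = (\<Sum>ys\<in>permutations_of_set (insert (Suc n) {1..n}). of_bool (int (descents ys) = k))"
    by (simp add: eulerian_conv_descents atLeastAtMostSuc_conv)
  also have "\<dots> = (\<Sum>xs\<in>permutations_of_set {1..n}. \<Sum>i\<le>n.
      of_bool (int (descents (take i xs @ Suc n # drop i xs)) = k))"
    by (subst sum_permutations_of_set_insert) auto
  also have "\<dots> = (\<Sum>xs\<in>permutations_of_set {1..n}.
      (of_int k + 1) * of_bool (int (descents xs) = k)
      + (real n + 1 - of_int k) * of_bool (int (descents xs) = k - 1))"
  proof (rule sum.cong[OF refl])
    fix xs assume xs: "xs \<in> permutations_of_set {1..n}"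
    then have l: "length xs = n" using length_finite_permutations_of_set by force
    have "x < Suc n" if "x \<in> set xs" for x
      using xs that by (auto simp: permutations_of_set_def)
    then have "(\<Sum>i\<le>n. of_bool (int (descents (take i xs @ Suc n # drop i xs)) = k))
        = (real (descents xs) + 1) * of_bool (int (descents xs) = k)
          + (real n - real (descents xs)) * of_bool (int (Suc (descents xs)) = k)"
      using sum_descents_insert_maximum[of xs "Suc n" "\<lambda>d. of_bool (int d = k)"] unfolding l by blast
    also have "\<dots> = (of_int k + 1) * of_bool (int (descents xs) = k)
      + (real n + 1 - of_int k) * of_bool (int (descents xs) = k - 1)"
      by (auto simp: algebra_simps)
    finally show "(\<Sum>i\<le>n. of_bool (int (descents (take i xs @ Suc n # drop i xs)) = k)) =
      (of_int k + 1) * of_bool (int (descents xs) = k)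
      + (real n + 1 - of_int k) * of_bool (int (descents xs) = k - 1)" .
  qed
  also have "\<dots> = (of_int k + 1) * real (eulerian n k) + (real n + 1 - of_int k) * real (eulerian n (k - 1))"
    unfolding eulerian_conv_descents[OF n] by (simp add: sum.distrib sum_distrib_left)
  finally show ?thesis .
qed

lemma eulerian_eq_0: "k \<ge> int n \<Longrightarrow> eulerian n k = 0"
proof (induction n arbitrary: k)
  case (Suc n)
  then have "eulerian n k = 0" "eulerian n (k - 1) = 0" by simp_all
  then have "real (eulerian (Suc n) k) = 0" unfolding eulerian_Suc by simp
  then show ?case by simp
qed (simp add: eulerian_def)

lemma eulerian_neg: "k < 0 \<Longrightarrow> n \<ge> 1 \<Longrightarrow> eulerian n k = 0"
  by (simp add: eulerian_def)

text \<open>The limiting number per step of clusters in which \<open>a\<close> steps repeat the innovation and \<open>b\<close> steps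
  repeat its opposite.\<close>

definition cluster_density :: "real \<Rightarrow> nat \<Rightarrow> nat \<Rightarrow> real" where
  "cluster_density p a b =
     p / (1 - p) / pochhammer (1 + 1 / (1 - p)) (a + b) * real (eulerian (a + b - 1) (int b - 1))"

lemma cluster_density_nonneg:
  assumes "0 < p" "p < 1"
  shows "cluster_density p a b \<ge> 0"
  unfolding cluster_density_def using assms by (intro mult_nonneg_nonneg divide_nonneg_nonneg pochhammer_nonneg add_pos_pos) auto

text \<open>An innovation is itself an even member of its cluster, so no cluster has only odd
  members. Hence the series may stop at \<open>l < k\<close>: the type \<open>(0, k)\<close> carries
  no mass.\<close>

lemma cluster_density_0_left: "b \<ge> 1 \<Longrightarrow> cluster_density p 0 b = 0"
  by (simp add: cluster_density_def eulerian_eq_0)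

text \<open>The balance equation for the number of clusters of type \<open>(a, b)\<close> gained per
  step. The type is created by an innovation if it is \<open>(1, 0)\<close>, by choosing one of the
  \<open>a\<close> even members of a cluster \<open>(a, b - 1)\<close>, or one of the
  \<open>b\<close> odd members of a cluster \<open>(a - 1, b)\<close>; it is left when one of its
  own \<open>a + b\<close> members is chosen. The indicators mask truncated subtraction.\<close>

lemma cluster_density_rec:
  assumes p: "0 < p" "p < 1" and ab: "a + b \<ge> 1"
  shows "(1 + (1 - p) * real (a + b)) * cluster_density p a b
     = p * of_bool (a = 1 \<and> b = 0)
       + (1 - p) * (real a * of_bool (b > 0) * cluster_density p a (b - 1)
                    + real b * of_bool (a > 0) * cluster_density p (a - 1) b)"
proof (cases "a + b = 1")
  case True
  then consider "a = 1" "b = 0" | "a = 0" "b = 1" by linarith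
  then show ?thesis
  proof cases
    case 1
    have "1 + 1 / (1 - p) = (2 - p) / (1 - p)" using p by (simp add: field_simps)
    then have "cluster_density p a b = p / (2 - p)"
      using p 1 by (simp add: cluster_density_def eulerian_def)
    then show ?thesis using p 1 by simp
  next
    case 2
    then show ?thesis by (simp add: cluster_density_0_left)
  qed
next
  case False
  define n where "n = a + b - 2"
  have n: "a + b = Suc (Suc n)" using False ab by (simp add: n_def)
  define K where "K = p / (1 - p) / pochhammer (1 + 1 / (1 - p)) (Suc n)"
  have poch: "pochhammer (1 + 1 / (1 - p)) (Suc n) > 0"
    using p by (intro pochhammer_pos) (auto intro!: add_pos_pos)
  \<comment> \<open>Up to \<open>1 - p\<close>, this is the factor that the rising factorial gains
    from size \<open>Suc n\<close> to \<open>Suc (Suc n)\<close>; hence its base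
    \<open>1 + 1 / (1 - p)\<close>.\<close>
  have f: "1 + (1 - p) * real (a + b) = (1 - p) * (1 + 1 / (1 - p) + real (Suc n))"
    using p by (simp add: n field_simps)
  have ne: "1 + 1 / (1 - p) + real (Suc n) \<noteq> 0"
    using p by (simp add: add_pos_nonneg add_nonneg_pos order.strict_implies_not_eq[symmetric])
  have "cluster_density p a b * (1 + 1 / (1 - p) + real (Suc n)) = K * real (eulerian (Suc n) (int b - 1))"
    using poch ne unfolding cluster_density_def n K_def pochhammer_Suc[of _ "Suc n"] by simp
  then have "(1 + (1 - p) * real (a + b)) * cluster_density p a b
      = (1 - p) * (K * real (eulerian (Suc n) (int b - 1)))"
    unfolding f by (simp only: mult_ac)
  \<comment> \<open>At \<open>int b - 1\<close> the coefficients of the Eulerian recurrence become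
    \<open>b\<close> and \<open>a\<close>, the numbers of eligible parents in the two preceding
    types.\<close>
  also have "real (eulerian (Suc n) (int b - 1))
      = real b * real (eulerian n (int b - 1)) + real a * real (eulerian n (int b - 1 - 1))"
  proof -
    have "real n + 1 - of_int (int b - 1) = real a" using n by simp
    then show ?thesis unfolding eulerian_Suc by simp
  qed
  also have "K * (real b * real (eulerian n (int b - 1)) + real a * real (eulerian n (int b - 1 - 1)))
      = real a * of_bool (b > 0) * cluster_density p a (b - 1) + real b * of_bool (a > 0) * cluster_density p (a - 1) b"
  proof -
    have "K * real a * real (eulerian n (int b - 1 - 1)) = real a * of_bool (b > 0) * cluster_density p a (b - 1)"
    proof (cases "b = 0")
      case True
      then have "eulerian n (int b - 1 - 1) = 0"
        using eulerian_neg[of "-2" n] by (cases n) (auto simp: eulerian_def)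
      then show ?thesis using True by simp
    next
      case False
      then have "a + (b - 1) = Suc n" "int (b - 1) = int b - 1" using n by auto
      then show ?thesis using False by (simp add: cluster_density_def K_def)
    qed
    moreover have "K * real b * real (eulerian n (int b - 1)) = real b * of_bool (a > 0) * cluster_density p (a - 1) b"
    proof (cases "a = 0")
      case True
      then have "eulerian n (int b - 1) = 0" using n by (intro eulerian_eq_0) simp
      then show ?thesis using True by simp
    next
      case False
      then have "(a - 1) + b = Suc n" using n by auto
      then show ?thesis using False by (simp add: cluster_density_def K_def)
    qed
    ultimately show ?thesis by (simp only: distrib_left mult.assoc[symmetric] add.commute)
  qed
  finally show ?thesis using n by auto
qed

subsection \<open>Histories and clusters\<close>

text \<open>\<open>h i\<close> is the pair of the innovation flag and the parent of step
  \<open>i\<close>. Parents are constrained at innovations too, since \<open>v i\<close> is drawn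
  there as well; step \<open>1\<close> has none.\<close>

definition valid_history :: "nat \<Rightarrow> (nat \<Rightarrow> bool \<times> nat) \<Rightarrow> bool" where
  "valid_history n h \<longleftrightarrow> fst (h 1) \<and> (\<forall>i\<in>{2..n}. snd (h i) \<in> {1..<i})"

abbreviation innov :: "(nat \<Rightarrow> bool \<times> nat) \<Rightarrow> nat \<Rightarrow> nat" where
  "innov h \<equiv> innovations (\<lambda>i. fst (h i))"

text \<open>The sign with which the innovation \<open>X j\<close> is repeated at step \<open>i\<close>, and \<open>0\<close> if step \<open>i\<close> descends
  from another innovation.\<close>

definition cluster_sign :: "(nat \<Rightarrow> bool \<times> nat) \<Rightarrow> nat \<Rightarrow> nat \<Rightarrow> real" where
  "cluster_sign h j i = counterbalanced_step (\<lambda>k. of_bool (k = j)) (\<lambda>k. fst (h k)) (\<lambda>k. snd (h k)) i"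

definition even_count :: "(nat \<Rightarrow> bool \<times> nat) \<Rightarrow> nat \<Rightarrow> nat \<Rightarrow> nat" where
  "even_count h n j = card {i \<in> {1..n}. cluster_sign h j i = 1}"

definition odd_count :: "(nat \<Rightarrow> bool \<times> nat) \<Rightarrow> nat \<Rightarrow> nat \<Rightarrow> nat" where
  "odd_count h n j = card {i \<in> {1..n}. cluster_sign h j i = - 1}"

text \<open>Summing up to \<open>n\<close> instead of the number of innovations keeps the range
  independent of the history. The surplus indices are empty clusters and contribute
  \<open>f 0 0\<close>.\<close>

definition cluster_sum :: "(nat \<Rightarrow> bool \<times> nat) \<Rightarrow> nat \<Rightarrow> (nat \<Rightarrow> nat \<Rightarrow> 'b::comm_monoid_add) \<Rightarrow> 'b" where
  "cluster_sum h n f = (\<Sum>j=1..n. f (even_count h n j) (odd_count h n j))"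

lemma innovations_le: "innovations e n \<le> n"
proof -
  have "innovations e n \<le> (\<Sum>j=1..n. 1)"
    unfolding innovations_def by (rule sum_mono) simp
  then show ?thesis by simp
qed

lemma innovations_mono: "m \<le> n \<Longrightarrow> innovations e m \<le> innovations e n"
  unfolding innovations_def by (rule sum_mono2) auto

lemma innovations_pos: "e 1 \<Longrightarrow> n \<ge> 1 \<Longrightarrow> innovations e n \<ge> 1"
  using innovations_mono[of 1 n e] by (simp add: innovations_def)

lemma innovations_Suc: "innovations e (Suc n) = innovations e n + of_bool (e (Suc n))"
  by (simp add: innovations_def)

lemma innovations_cong: "(\<And>i. i \<in> {1..n} \<Longrightarrow> e i = e' i) \<Longrightarrow> innovations e n = innovations e' n"
  unfolding innovations_def by (rule sum.cong) auto

text \<open>Parents have to agree only at repetitions: at step \<open>1\<close> the model leaves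
  \<open>v 1\<close> arbitrary while a history stores a default, and there the flag is set.\<close>

lemma counterbalanced_step_cong:
  assumes "\<And>i. i \<in> {1..n} \<Longrightarrow> e i = e' i" "\<And>i. i \<in> {1..n} \<Longrightarrow> \<not> e i \<Longrightarrow> u i = u' i" "n \<ge> 1"
  shows "counterbalanced_step x e u n = counterbalanced_step x e' u' n"
  using assms
proof (induction n rule: less_induct)
  case (less n)
  have "innovations e n = innovations e' n" using less.prems by (intro innovations_cong) auto
  moreover have "counterbalanced_step x e u (u' n) = counterbalanced_step x e' u' (u' n)"
    if "1 \<le> u' n" "u' n < n"
    using that less.prems by (intro less.IH) auto
  moreover have "u n = u' n" if "\<not> e n" using that less.prems by auto
  ultimately show ?case
    using less.prems by (subst (1 2) counterbalanced_step.simps) auto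
qed

text \<open>Following parents from step \<open>i\<close> leads to a single innovation
  \<open>J\<close>, and every link flips the sign. The bound on \<open>J\<close> by the number of
  innovations so far is what later identifies the empty clusters.\<close>

lemma cluster_sign_cases:
  assumes h: "valid_history n h" and i: "i \<in> {1..n}"
  shows "\<exists>J s. 1 \<le> J \<and> J \<le> innov h i \<and> (s = 1 \<or> s = - 1)
           \<and> (\<forall>j. cluster_sign h j i = s * of_bool (j = J))"
  using i
proof (induction i rule: less_induct)
  case (less i)
  show ?case
  proof (cases "fst (h i)")
    case True
    then have "cluster_sign h j i = 1 * of_bool (j = innov h i)" for j
      unfolding cluster_sign_def by (subst counterbalanced_step.simps) auto
    moreover have "innov h i \<ge> 1"
      using h less.prems by (intro innovations_pos) (auto simp: valid_history_def)
    ultimately show ?thesis by blast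
  next
    case False
    then have "i \<noteq> 1" using h by (auto simp: valid_history_def)
    then have u: "snd (h i) \<in> {1..<i}" using h less.prems by (auto simp: valid_history_def)
    then obtain J s where J: "1 \<le> J" "J \<le> innov h (snd (h i))" "s = 1 \<or> s = - 1"
      "\<And>j. cluster_sign h j (snd (h i)) = s * of_bool (j = J)"
      using less.IH[of "snd (h i)"] less.prems by auto
    have "cluster_sign h j i = - s * of_bool (j = J)" for j
    proof -
      have "cluster_sign h j i = - cluster_sign h j (snd (h i))"
        using False u unfolding cluster_sign_def by (subst counterbalanced_step.simps) auto
      then show ?thesis using J(4) by simp
    qed
    moreover have "J \<le> innov h i"
      using J(2) innovations_mono[of "snd (h i)" i] u by (meson atLeastLessThan_iff le_trans less_imp_le_nat)
    moreover have "- s = 1 \<or> - s = - 1" using J(3) by auto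
    ultimately show ?thesis using J(1) by blast
  qed
qed

lemma obtain_cluster:
  assumes "valid_history n h" "i \<in> {1..n}"
  obtains J s where "J \<in> {1..n}" "s = 1 \<or> s = - 1" "\<And>j. cluster_sign h j i = s * of_bool (j = J)"
proof -
  obtain J s where J: "1 \<le> J" "J \<le> innov h i" "s = 1 \<or> s = - 1"
      "\<forall>j. cluster_sign h j i = s * of_bool (j = J)"
    using cluster_sign_cases[OF assms] by blast
  have "J \<le> n" using J(2) innovations_le[of "\<lambda>i. fst (h i)" i] assms(2) by auto
  then show ?thesis using that J by auto
qed

lemma cluster_sign_eq_0:
  assumes "valid_history n h" "i \<in> {1..n}" "j > innov h n"
  shows "cluster_sign h j i = 0"
proof -
  obtain J s where J: "J \<le> innov h i" "\<forall>j. cluster_sign h j i = s * of_bool (j = J)"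
    using cluster_sign_cases[OF assms(1,2)] by blast
  have "j \<noteq> J" using J(1) innovations_mono[of i n "\<lambda>i. fst (h i)"] assms by auto
  then show ?thesis using J(2) by simp
qed

text \<open>The recursion is linear in the innovations, and \<open>cluster_sign\<close> is its value
  on the unit vectors.\<close>

lemma counterbalanced_step_conv_cluster_sign:
  assumes h: "valid_history n h" and i: "i \<in> {1..n}"
  shows "counterbalanced_step x (\<lambda>k. fst (h k)) (\<lambda>k. snd (h k)) i = (\<Sum>j=1..n. cluster_sign h j i * x j)"
  using i
proof (induction i rule: less_induct)
  case (less i)
  show ?case
  proof (cases "fst (h i)")
    case True
    then have "cluster_sign h j i = of_bool (j = innov h i)" for j
      unfolding cluster_sign_def by (subst counterbalanced_step.simps) auto
    moreover have "innov h i \<ge> 1"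
      using h less.prems by (intro innovations_pos) (auto simp: valid_history_def)
    moreover have "innov h i \<le> n" using innovations_le[of "\<lambda>i. fst (h i)" i] less.prems by auto
    moreover have "(\<Sum>j=1..n. cluster_sign h j i * x j) = (\<Sum>j=1..n. if j = innov h i then x j else 0)"
      using calculation(1) by (intro sum.cong) auto
    ultimately show ?thesis using True
      by (subst counterbalanced_step.simps) simp
  next
    case False
    then have "i \<noteq> 1" using h by (auto simp: valid_history_def)
    then have u: "snd (h i) \<in> {1..<i}" using h less.prems by (auto simp: valid_history_def)
    have "cluster_sign h j i = - cluster_sign h j (snd (h i))" for j
      using False u unfolding cluster_sign_def by (subst counterbalanced_step.simps) auto
    moreover have "counterbalanced_step x (\<lambda>k. fst (h k)) (\<lambda>k. snd (h k)) i
        = - counterbalanced_step x (\<lambda>k. fst (h k)) (\<lambda>k. snd (h k)) (snd (h i))"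
      using False u by (subst counterbalanced_step.simps) auto
    ultimately show ?thesis using less.IH[of "snd (h i)"] u less.prems by (simp add: sum_negf)
  qed
qed

lemma even_count_conv_sum: "even_count h n j = (\<Sum>i=1..n. of_bool (cluster_sign h j i = 1))"
  by (simp add: even_count_def Int_def)

lemma odd_count_conv_sum: "odd_count h n j = (\<Sum>i=1..n. of_bool (cluster_sign h j i = - 1))"
  by (simp add: odd_count_def Int_def)

lemma sum_cluster_sign:
  assumes h: "valid_history n h"
  shows "(\<Sum>i=1..n. cluster_sign h j i) = real (even_count h n j) - real (odd_count h n j)"
proof -
  have "(\<Sum>i=1..n. cluster_sign h j i)
      = (\<Sum>i=1..n. of_bool (cluster_sign h j i = 1) - of_bool (cluster_sign h j i = - 1))"
  proof (rule sum.cong[OF refl])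
    fix i assume "i \<in> {1..n}"
    from obtain_cluster[OF h this] obtain J s where "s = 1 \<or> s = - 1" "\<And>j. cluster_sign h j i = s * of_bool (j = J)"
      by metis
    then show "cluster_sign h j i = of_bool (cluster_sign h j i = 1) - of_bool (cluster_sign h j i = - 1)"
      by auto
  qed
  then show ?thesis
    unfolding even_count_conv_sum odd_count_conv_sum of_nat_sum of_nat_of_bool sum_subtractf .
qed

lemma counterbalanced_walk_conv_counts:
  assumes h: "valid_history n h"
  shows "counterbalanced_walk x (\<lambda>k. fst (h k)) (\<lambda>k. snd (h k)) n
           = (\<Sum>j=1..n. (real (even_count h n j) - real (odd_count h n j)) * x j)"
proof -
  have "counterbalanced_walk x (\<lambda>k. fst (h k)) (\<lambda>k. snd (h k)) n
      = (\<Sum>i=1..n. \<Sum>j=1..n. cluster_sign h j i * x j)"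
    unfolding counterbalanced_walk_def
    by (rule sum.cong) (auto simp: counterbalanced_step_conv_cluster_sign[OF h])
  also have "\<dots> = (\<Sum>j=1..n. (\<Sum>i=1..n. cluster_sign h j i) * x j)"
    by (subst sum.swap) (simp add: sum_distrib_right)
  finally show ?thesis by (simp only: sum_cluster_sign[OF h])
qed

text \<open>Every step lies in exactly one cluster, so counting incidences by steps instead of
  clusters gives \<open>n\<close>.\<close>

lemma cluster_sum_size:
  assumes h: "valid_history n h"
  shows "cluster_sum h n (\<lambda>a b. real (a + b)) = real n"
proof -
  have "cluster_sum h n (\<lambda>a b. real (a + b))
      = (\<Sum>j=1..n. \<Sum>i=1..n. of_bool (cluster_sign h j i = 1) + of_bool (cluster_sign h j i = - 1))"
    unfolding cluster_sum_def even_count_conv_sum odd_count_conv_sum of_nat_add of_nat_sum of_nat_of_bool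
      sum.distrib ..
  also have "\<dots> = (\<Sum>i=1..n. \<Sum>j=1..n. of_bool (cluster_sign h j i = 1) + of_bool (cluster_sign h j i = - 1))"
    by (rule sum.swap)
  also have "\<dots> = (\<Sum>i=1..n. 1)"
  proof (rule sum.cong[OF refl])
    fix i assume "i \<in> {1..n}"
    from obtain_cluster[OF h this] obtain J s where
      J: "J \<in> {1..n}" "s = 1 \<or> s = - 1" "\<And>j. cluster_sign h j i = s * of_bool (j = J)"
      by metis
    then have "of_bool (cluster_sign h j i = 1) + of_bool (cluster_sign h j i = - 1) = (if j = J then 1 else 0 :: real)" for j
      by auto
    then show "(\<Sum>j=1..n. of_bool (cluster_sign h j i = 1) + of_bool (cluster_sign h j i = - 1)) = (1::real)"
      using J(1) by (simp only: sum.delta finite_atLeastAtMost) simp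
  qed
  finally show ?thesis by simp
qed

section \<open>Effect of one further step on sums over clusters\<close>

definition cluster_increment :: "(nat \<Rightarrow> bool \<times> nat) \<Rightarrow> nat \<Rightarrow> nat \<Rightarrow> (nat \<Rightarrow> nat \<Rightarrow> real) \<Rightarrow> real" where
  "cluster_increment h n w f = (\<Sum>j=1..n.
     of_bool (cluster_sign h j w = 1) * (f (even_count h n j) (Suc (odd_count h n j)) - f (even_count h n j) (odd_count h n j))
     + of_bool (cluster_sign h j w = - 1) * (f (Suc (even_count h n j)) (odd_count h n j) - f (even_count h n j) (odd_count h n j)))"

text \<open>This is the generator of the two-type branching process in which each member gives
  birth, at rate one, to a member of opposite parity. It arises from
  \<open>cluster_increment\<close>, a sum over all clusters although only that of the parent
  \<open>w\<close> changes, because averaging over \<open>w\<close> is then an exchange of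
  sums.\<close>

definition cluster_generator :: "(nat \<Rightarrow> nat \<Rightarrow> real) \<Rightarrow> nat \<Rightarrow> nat \<Rightarrow> real" where
  "cluster_generator f a b = real a * (f a (Suc b) - f a b) + real b * (f (Suc a) b - f a b)"

lemma sum_cluster_increment:
  "(\<Sum>w=1..n. cluster_increment h n w f) = cluster_sum h n (cluster_generator f)"
proof -
  have "(\<Sum>w=1..n. cluster_increment h n w f) = (\<Sum>j=1..n. \<Sum>w=1..n.
     of_bool (cluster_sign h j w = 1) * (f (even_count h n j) (Suc (odd_count h n j)) - f (even_count h n j) (odd_count h n j))
     + of_bool (cluster_sign h j w = - 1) * (f (Suc (even_count h n j)) (odd_count h n j) - f (even_count h n j) (odd_count h n j)))"
    unfolding cluster_increment_def by (rule sum.swap)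
  also have "\<dots> = cluster_sum h n (cluster_generator f)"
    unfolding cluster_sum_def cluster_generator_def
  proof (rule sum.cong[OF refl])
    fix j
    have e: "real (even_count h n j) = (\<Sum>w=1..n. of_bool (cluster_sign h j w = 1))"
      "real (odd_count h n j) = (\<Sum>w=1..n. of_bool (cluster_sign h j w = - 1))"
      by (simp_all only: even_count_conv_sum odd_count_conv_sum of_nat_sum of_nat_of_bool)
    show "(\<Sum>w=1..n.
     of_bool (cluster_sign h j w = 1) * (f (even_count h n j) (Suc (odd_count h n j)) - f (even_count h n j) (odd_count h n j))
     + of_bool (cluster_sign h j w = - 1) * (f (Suc (even_count h n j)) (odd_count h n j) - f (even_count h n j) (odd_count h n j)))
     = real (even_count h n j) * (f (even_count h n j) (Suc (odd_count h n j)) - f (even_count h n j) (odd_count h n j)) +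
       real (odd_count h n j) * (f (Suc (even_count h n j)) (odd_count h n j) - f (even_count h n j) (odd_count h n j))"
      unfolding e by (simp only: sum.distrib sum_distrib_right)
  qed
  finally show ?thesis .
qed

text \<open>Only the cluster of the parent \<open>w\<close> changes, so a single difference of
  \<open>f\<close> survives. This supplies the bounded jumps of the variance estimate.\<close>

lemma abs_cluster_increment_le:
  assumes h: "valid_history n h" and w: "w \<in> {1..n}"
    and f: "\<And>a b. \<bar>f a (Suc b) - f a b\<bar> \<le> B" "\<And>a b. \<bar>f (Suc a) b - f a b\<bar> \<le> B"
  shows "\<bar>cluster_increment h n w f\<bar> \<le> B"
proof -
  from obtain_cluster[OF h w] obtain J s where
      J: "J \<in> {1..n}" "s = 1 \<or> s = - 1" "\<And>j. cluster_sign h j w = s * of_bool (j = J)"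
    by metis
  define T where "T = (if s = 1 then f (even_count h n J) (Suc (odd_count h n J)) - f (even_count h n J) (odd_count h n J)
    else f (Suc (even_count h n J)) (odd_count h n J) - f (even_count h n J) (odd_count h n J))"
  have "cluster_increment h n w f = (\<Sum>j=1..n. if j = J then T else 0)"
    unfolding cluster_increment_def using J(2,3) by (intro sum.cong) (auto simp: T_def)
  also have "\<dots> = T" using J(1) by (simp only: sum.delta finite_atLeastAtMost) simp
  finally show ?thesis using f by (simp add: T_def)
qed

lemma cluster_sign_upd:
  assumes "i \<in> {1..n}"
  shows "cluster_sign (h(Suc n := y)) j i = cluster_sign h j i"
  unfolding cluster_sign_def using assms by (intro counterbalanced_step_cong) auto

lemma cluster_sign_upd_Suc:
  assumes w: "w \<in> {1..n}"
  shows "cluster_sign (h(Suc n := (b, w))) j (Suc n)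
           = (if b then of_bool (j = Suc (innov h n)) else - cluster_sign h j w)"
proof (cases b)
  case True
  have "innov (h(Suc n := (b, w))) (Suc n) = innov h n + 1"
    using True innovations_cong[of n "\<lambda>i. fst ((h(Suc n := (b, w))) i)" "\<lambda>i. fst (h i)"]
    by (simp add: innovations_Suc)
  then show ?thesis
    using True unfolding cluster_sign_def by (subst counterbalanced_step.simps) auto
next
  case False
  have "cluster_sign (h(Suc n := (b, w))) j (Suc n) = - cluster_sign (h(Suc n := (b, w))) j w"
    using False w unfolding cluster_sign_def
    by (subst counterbalanced_step.simps) auto
  then show ?thesis using cluster_sign_upd[OF w] False by simp
qed

lemma even_count_upd:
  assumes "w \<in> {1..n}"
  shows "even_count (h(Suc n := (b, w))) (Suc n) j
    = even_count h n j + of_bool (if b then j = Suc (innov h n) else cluster_sign h j w = - 1)"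
proof -
  have "(\<Sum>i=1..n. of_bool (cluster_sign (h(Suc n := (b, w))) j i = 1)) = even_count h n j"
    unfolding even_count_conv_sum by (intro sum.cong) (auto simp: cluster_sign_upd)
  moreover have "(- x = 1) = (x = - 1)" for x :: real by auto
  ultimately show ?thesis
    unfolding even_count_conv_sum[of "h(Suc n := (b, w))"] using assms
    by (simp add: cluster_sign_upd_Suc del: sum_of_bool_eq)
qed

lemma odd_count_upd:
  assumes "w \<in> {1..n}"
  shows "odd_count (h(Suc n := (b, w))) (Suc n) j
    = odd_count h n j + of_bool (\<not> b \<and> cluster_sign h j w = 1)"
proof -
  have "(\<Sum>i=1..n. of_bool (cluster_sign (h(Suc n := (b, w))) j i = - 1)) = odd_count h n j"
    unfolding odd_count_conv_sum by (intro sum.cong) (auto simp: cluster_sign_upd)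
  then show ?thesis
    unfolding odd_count_conv_sum[of "h(Suc n := (b, w))"] using assms
    by (simp add: cluster_sign_upd_Suc del: sum_of_bool_eq)
qed

lemma counts_eq_0:
  assumes "valid_history n h" "j > innov h n"
  shows "even_count h n j = 0" "odd_count h n j = 0"
  unfolding even_count_conv_sum odd_count_conv_sum
  using cluster_sign_eq_0[OF assms(1) _ assms(2)] by (simp_all add: atLeastAtMost_iff)

text \<open>The innovation occupies the first empty cluster, whose contribution rises from
  \<open>f 0 0 = 0\<close> to \<open>f 1 0\<close>.\<close>

lemma cluster_sum_innovation:
  fixes f :: "nat \<Rightarrow> nat \<Rightarrow> real"
  assumes h: "valid_history n h" and w: "w \<in> {1..n}" and f: "f 0 0 = 0"
  shows "cluster_sum (h(Suc n := (True, w))) (Suc n) f = cluster_sum h n f + f 1 0"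
proof -
  define J where "J = Suc (innov h n)"
  have J: "J \<in> {1..Suc n}" using innovations_le by (auto simp: J_def)
  have J0: "even_count h n J = 0" "odd_count h n J = 0"
    using counts_eq_0[OF h] by (auto simp: J_def)
  have "innov h n < Suc n" using innovations_le[of "\<lambda>i. fst (h i)" n] by simp
  note n0 = counts_eq_0[OF h this]
  have "cluster_sum (h(Suc n := (True, w))) (Suc n) f
      = (\<Sum>j=1..Suc n. f (even_count h n j) (odd_count h n j) + (if j = J then f 1 0 else 0))"
    unfolding cluster_sum_def even_count_upd[OF w] odd_count_upd[OF w]
    using J0 f by (intro sum.cong) (auto simp: J_def)
  also have "\<dots> = (\<Sum>j=1..Suc n. f (even_count h n j) (odd_count h n j)) + f 1 0"
    using J by (simp only: sum.distrib sum.delta finite_atLeastAtMost) simp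
  finally show ?thesis using n0 f by (simp add: cluster_sum_def)
qed

lemma cluster_sum_repetition:
  fixes f :: "nat \<Rightarrow> nat \<Rightarrow> real"
  assumes h: "valid_history n h" and w: "w \<in> {1..n}" and f: "f 0 0 = 0"
  shows "cluster_sum (h(Suc n := (False, w))) (Suc n) f = cluster_sum h n f + cluster_increment h n w f"
proof -
  have "innov h n < Suc n" using innovations_le[of "\<lambda>i. fst (h i)" n] by simp
  note n0 = counts_eq_0[OF h this] cluster_sign_eq_0[OF h w this]
  have "cluster_sum (h(Suc n := (False, w))) (Suc n) f
      = (\<Sum>j=1..n. f (even_count h n j + of_bool (cluster_sign h j w = - 1)) (odd_count h n j + of_bool (cluster_sign h j w = 1)))"
    unfolding cluster_sum_def even_count_upd[OF w] odd_count_upd[OF w]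
    using n0 f by simp
  also have "\<dots> = cluster_sum h n f + cluster_increment h n w f"
    unfolding cluster_sum_def cluster_increment_def sum.distrib[symmetric]
    by (intro sum.cong) auto
  finally show ?thesis .
qed

subsection \<open>Moments of cluster counts\<close>

text \<open>The default value records that step \<open>1\<close> is always an innovation; elsewhere it is irrelevant.\<close>

definition history_pmf :: "real \<Rightarrow> nat \<Rightarrow> (nat \<Rightarrow> bool \<times> nat) pmf" where
  "history_pmf p n =
     Pi_pmf {2..n} (True, 0) (\<lambda>i. pair_pmf (bernoulli_pmf p) (pmf_of_set {1..i - 1}))"

definition cluster_type_count :: "(nat \<Rightarrow> bool \<times> nat) \<Rightarrow> nat \<Rightarrow> nat \<Rightarrow> nat \<Rightarrow> real" where
  "cluster_type_count h n a b = cluster_sum h n (\<lambda>a' b'. of_bool (a' = a \<and> b' = b))"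

context
  fixes p :: real
  assumes p: "0 < p" "p < 1"
begin

lemma set_history_pmf:
  "set_pmf (history_pmf p n) = PiE_dflt {2..n} (True, 0) (\<lambda>i. UNIV \<times> {1..i - 1})"
proof -
  have "set_pmf (pair_pmf (bernoulli_pmf p) (pmf_of_set {1..i - 1})) = UNIV \<times> {1..i - 1}"
    if "i \<in> {2..n}" for i
    using that p by (auto simp: set_pmf_bernoulli)
  then show ?thesis
    unfolding history_pmf_def by (subst set_Pi_pmf) (auto simp: PiE_dflt_def)
qed

lemma finite_set_history_pmf [simp]: "finite (set_pmf (history_pmf p n))"
  unfolding set_history_pmf by (intro finite_PiE_dflt) auto

lemma integrable_history_pmf [simp]:
  fixes F :: "_ \<Rightarrow> 'b::{banach, second_countable_topology}"
  shows "integrable (measure_pmf (history_pmf p n)) F"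
  by (rule integrable_measure_pmf_finite) simp

lemma valid_history_pmf:
  assumes "h \<in> set_pmf (history_pmf p n)"
  shows "valid_history n h"
  unfolding valid_history_def
proof
  show "fst (h 1)" using assms by (auto simp: set_history_pmf PiE_dflt_def)
  show "\<forall>i\<in>{2..n}. snd (h i) \<in> {1..<i}"
  proof
    fix i assume i: "i \<in> {2..n}"
    then have "h i \<in> UNIV \<times> {1..i - 1}" using assms by (auto simp: set_history_pmf PiE_dflt_def)
    then show "snd (h i) \<in> {1..<i}" using i by (cases "h i") auto
  qed
qed

abbreviation hexp :: "nat \<Rightarrow> ((nat \<Rightarrow> bool \<times> nat) \<Rightarrow> real) \<Rightarrow> real" where
  "hexp n \<equiv> measure_pmf.expectation (history_pmf p n)"

lemma hexp_mono:
  assumes "\<And>h. valid_history n h \<Longrightarrow> F h \<le> G h"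
  shows "hexp n F \<le> hexp n G"
  by (rule integral_mono_AE) (auto intro!: assms valid_history_pmf AE_pmfI)

text \<open>Under the product law the coordinate of step \<open>Suc n\<close> is independent of the
  earlier ones, so it can be averaged out first. The moment bounds are inductions through this
  one-step formula.\<close>

lemma hexp_Suc:
  assumes n: "n \<ge> 1"
  shows "hexp (Suc n) F = hexp n (\<lambda>h. (\<Sum>w=1..n. p * F (h(Suc n := (True, w)))
           + (1 - p) * F (h(Suc n := (False, w)))) / real n)"
proof -
  define q where "q = pair_pmf (bernoulli_pmf p) (pmf_of_set {1..n})"
  have ins: "{2..Suc n} = insert (Suc n) {2..n}" using n by auto
  have "history_pmf p (Suc n) = map_pmf (\<lambda>(y, h). h(Suc n := y)) (pair_pmf q (history_pmf p n))"
    unfolding history_pmf_def ins q_def by (subst Pi_pmf_insert) auto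
  also have "\<dots> = bind_pmf (history_pmf p n) (\<lambda>h. map_pmf (\<lambda>y. h(Suc n := y)) q)"
    unfolding pair_pmf_def by (subst bind_commute_pmf) (simp add: map_bind_pmf map_pmf_def bind_assoc_pmf bind_return_pmf)
  finally have eq: "history_pmf p (Suc n) = bind_pmf (history_pmf p n) (\<lambda>h. map_pmf (\<lambda>y. h(Suc n := y)) q)" .
  have setq: "set_pmf q = UNIV \<times> {1..n}" unfolding q_def using p n by (auto simp: set_pmf_bernoulli)
  have inner: "measure_pmf.expectation (map_pmf (\<lambda>y. h(Suc n := y)) q) F
     = (\<Sum>w=1..n. p * F (h(Suc n := (True, w))) + (1 - p) * F (h(Suc n := (False, w)))) / real n" for h
  proof -
    have "measure_pmf.expectation (map_pmf (\<lambda>y. h(Suc n := y)) q) F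
        = (\<Sum>y\<in>UNIV \<times> {1..n}. pmf q y *\<^sub>R F (h(Suc n := y)))"
      unfolding integral_map_pmf using setq by (intro integral_measure_pmf) auto
    also have "\<dots> = (\<Sum>b\<in>UNIV. \<Sum>w=1..n. pmf q (b, w) *\<^sub>R F (h(Suc n := (b, w))))"
      by (simp add: sum.cartesian_product case_prod_unfold)
    also have "\<dots> = (\<Sum>w=1..n. p * F (h(Suc n := (True, w))) / real n)
        + (\<Sum>w=1..n. (1 - p) * F (h(Suc n := (False, w))) / real n)"
      using p n by (simp add: UNIV_bool q_def pmf_pair add.commute)
    finally show ?thesis by (simp add: sum.distrib sum_divide_distrib add_divide_distrib)
  qed
  have "hexp (Suc n) F = (\<Sum>h\<in>set_pmf (history_pmf p n). pmf (history_pmf p n) h *\<^sub>R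
      measure_pmf.expectation (map_pmf (\<lambda>y. h(Suc n := y)) q) F)"
    unfolding eq by (rule pmf_expectation_bind) (auto simp: setq)
  also have "\<dots> = hexp n (\<lambda>h. (\<Sum>w=1..n. p * F (h(Suc n := (True, w)))
           + (1 - p) * F (h(Suc n := (False, w)))) / real n)"
    unfolding inner by (rule integral_measure_pmf[symmetric]) auto
  finally show ?thesis .
qed

lemma hexp_one: "hexp 1 F = F (\<lambda>_. (True, 0))"
  by (simp add: history_pmf_def)

text \<open>The generator maps \<open>(a - b)\<^sup>2\<close> to \<open>a + b - 2 (a - b)\<^sup>2\<close>, so the drift of the sum of squares is at most one.\<close>

lemma hexp_sum_squares_le:
  assumes "n \<ge> 1"
  shows "hexp n (\<lambda>h. cluster_sum h n (\<lambda>a b. (real a - real b)\<^sup>2)) \<le> real n"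
  using assms
proof (induction n rule: nat_induct_at_least)
  case base
  have "cluster_sign (\<lambda>_. (True, 0)) 1 1 = 1"
    unfolding cluster_sign_def by (subst counterbalanced_step.simps) (simp add: innovations_def)
  then have "even_count (\<lambda>_. (True, 0)) 1 1 = 1" "odd_count (\<lambda>_. (True, 0)) 1 1 = 0"
    unfolding even_count_conv_sum odd_count_conv_sum by simp_all
  then show ?case unfolding hexp_one by (simp add: cluster_sum_def)
next
  case (Suc n)
  define f :: "nat \<Rightarrow> nat \<Rightarrow> real" where "f a b = (real a - real b)\<^sup>2" for a b
  have gen: "cluster_generator f a b = real (a + b) - 2 * f a b" for a b
    by (simp add: cluster_generator_def f_def power2_eq_square algebra_simps)
  have "hexp (Suc n) (\<lambda>h. cluster_sum h (Suc n) f)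
      = hexp n (\<lambda>h. (\<Sum>w=1..n. p * cluster_sum (h(Suc n := (True, w))) (Suc n) f
           + (1 - p) * cluster_sum (h(Suc n := (False, w))) (Suc n) f) / real n)"
    by (rule hexp_Suc[OF Suc.hyps])
  also have "\<dots> \<le> hexp n (\<lambda>h. cluster_sum h n f + 1)"
  proof (rule hexp_mono)
    fix h assume h: "valid_history n h"
    have f0: "f 0 0 = 0" "f 1 0 = 1" by (simp_all add: f_def)
    have "(\<Sum>w=1..n. p * cluster_sum (h(Suc n := (True, w))) (Suc n) f
           + (1 - p) * cluster_sum (h(Suc n := (False, w))) (Suc n) f)
        = (\<Sum>w=1..n. p * (cluster_sum h n f + 1) + (1 - p) * (cluster_sum h n f + cluster_increment h n w f))"
      using cluster_sum_innovation[where f = f, OF h _ f0(1)] cluster_sum_repetition[where f = f, OF h _ f0(1)]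
      by (intro sum.cong) (auto simp: f0(2)[unfolded One_nat_def])
    also have "\<dots> = (\<Sum>w=1..n. (p * (cluster_sum h n f + 1) + (1 - p) * cluster_sum h n f)
        + (1 - p) * cluster_increment h n w f)"
      by (simp add: algebra_simps)
    also have "\<dots> = real n * (p * (cluster_sum h n f + 1) + (1 - p) * cluster_sum h n f)
        + (1 - p) * cluster_sum h n (cluster_generator f)"
      unfolding sum_cluster_increment[symmetric] sum.distrib sum_distrib_left by (simp add: distrib_left)
    also have "cluster_sum h n (cluster_generator f) = real n - 2 * cluster_sum h n f"
      using cluster_sum_size[OF h] unfolding gen
      by (simp add: cluster_sum_def sum_subtractf sum_distrib_left)
    also have "real n * (p * (cluster_sum h n f + 1) + (1 - p) * cluster_sum h n f)
        + (1 - p) * (real n - 2 * cluster_sum h n f)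
        = real n * (cluster_sum h n f + 1) - 2 * (1 - p) * cluster_sum h n f"
      by (simp add: algebra_simps)
    finally have e: "(\<Sum>w=1..n. p * cluster_sum (h(Suc n := (True, w))) (Suc n) f
           + (1 - p) * cluster_sum (h(Suc n := (False, w))) (Suc n) f)
        = real n * (cluster_sum h n f + 1) - 2 * (1 - p) * cluster_sum h n f" .
    have "cluster_sum h n f \<ge> 0" unfolding cluster_sum_def f_def by (intro sum_nonneg) auto
    then have "2 * (1 - p) * cluster_sum h n f \<ge> 0" using p by simp
    with e show "(\<Sum>w=1..n. p * cluster_sum (h(Suc n := (True, w))) (Suc n) f
           + (1 - p) * cluster_sum (h(Suc n := (False, w))) (Suc n) f) / real n \<le> cluster_sum h n f + 1"
      using Suc.hyps by (subst pos_divide_le_eq) (auto simp: mult.commute)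
  qed
  also have "\<dots> = hexp n (\<lambda>h. cluster_sum h n f) + 1" by simp
  also have "\<dots> \<le> real (Suc n)" using Suc.IH by (simp add: f_def[abs_def])
  finally show ?case by (simp add: f_def[abs_def])
qed

text \<open>The drift of the count of \<open>(a, b)\<close> involves, besides this count itself,
  only types with one member less, so the system is triangular and induction on \<open>a + b\<close>
  closes it. For centred counts the drift is \<open>(1 - p) / n\<close> times
  \<open>k1 * Y1 + k2 * Y2 - (a + b) * Y\<close>; its own part is damping, the others have variance
  linear in \<open>n\<close> by induction, and the jumps are bounded. The second moment thus grows
  by at most a constant per step.\<close>

lemma cluster_type_count_variance:
  assumes "a + b \<ge> 1"
  shows "\<exists>C\<ge>0. \<forall>n\<ge>1. hexp n (\<lambda>h. (cluster_type_count h n a b - real n * cluster_density p a b)\<^sup>2) \<le> C * real n"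
  using assms
proof (induction "a + b" arbitrary: a b rule: less_induct)
  case less
  define f :: "nat \<Rightarrow> nat \<Rightarrow> real" where "f a' b' = of_bool (a' = a \<and> b' = b)" for a' b'
  define c where "c = cluster_density p a b"
  define c1 where "c1 = cluster_density p a (b - 1)"
  define c2 where "c2 = cluster_density p (a - 1) b"
  define k1 where "k1 = real a * of_bool (b > 0)"
  define k2 where "k2 = real b * of_bool (a > 0)"
  define Y where "Y n h = cluster_type_count h n a b - real n * c" for n h
  define Y1 where "Y1 n h = cluster_type_count h n a (b - 1) - real n * c1" for n h
  define Y2 where "Y2 n h = cluster_type_count h n (a - 1) b - real n * c2" for n h
  have k: "k1 \<ge> 0" "k2 \<ge> 0" "k1 \<le> real a" "k2 \<le> real b" by (auto simp: k1_def k2_def)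
  \<comment> \<open>A vanishing weight is treated apart because the neighbouring type may then be
    \<open>(0, 0)\<close> or an artefact of truncated subtraction, to which the induction hypothesis
    does not apply.\<close>
  have "\<exists>C1\<ge>0. \<forall>n\<ge>1. k1 * hexp n (\<lambda>h. (Y1 n h)\<^sup>2) \<le> C1 * real n"
  proof (cases "k1 = 0")
    case False
    then have "a > 0" "b > 0" by (auto simp: k1_def)
    then have "a + (b - 1) < a + b" "1 \<le> a + (b - 1)" by auto
    from less.hyps[OF this] obtain C where "C \<ge> 0" "\<forall>n\<ge>1. hexp n (\<lambda>h. (Y1 n h)\<^sup>2) \<le> C * real n"
      unfolding Y1_def c1_def by blast
    then show ?thesis using k(1) by (intro exI[of _ "k1 * C"]) (auto simp: mult.assoc intro!: mult_left_mono)
  qed (auto intro!: exI[of _ 0])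
  then obtain C1 where C1: "C1 \<ge> 0" "\<And>n. n \<ge> 1 \<Longrightarrow> k1 * hexp n (\<lambda>h. (Y1 n h)\<^sup>2) \<le> C1 * real n" by blast
  have "\<exists>C2\<ge>0. \<forall>n\<ge>1. k2 * hexp n (\<lambda>h. (Y2 n h)\<^sup>2) \<le> C2 * real n"
  proof (cases "k2 = 0")
    case False
    then have "a > 0" "b > 0" by (auto simp: k2_def)
    then have "(a - 1) + b < a + b" "1 \<le> (a - 1) + b" by auto
    from less.hyps[OF this] obtain C where "C \<ge> 0" "\<forall>n\<ge>1. hexp n (\<lambda>h. (Y2 n h)\<^sup>2) \<le> C * real n"
      unfolding Y2_def c2_def by blast
    then show ?thesis using k(2) by (intro exI[of _ "k2 * C"]) (auto simp: mult.assoc intro!: mult_left_mono)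
  qed (auto intro!: exI[of _ 0])
  then obtain C2 where C2: "C2 \<ge> 0" "\<And>n. n \<ge> 1 \<Longrightarrow> k2 * hexp n (\<lambda>h. (Y2 n h)\<^sup>2) \<le> C2 * real n" by blast
  \<comment> \<open>Bounds the square of every centred jump \<open>x - c\<close>, as the uncentred
    jumps satisfy \<open>\<bar>x\<bar> \<le> 1\<close>.\<close>
  define K where "K = (1 + c)\<^sup>2"
  have c0: "c \<ge> 0" unfolding c_def by (rule cluster_density_nonneg[OF p])
  have Kb: "(x - c)\<^sup>2 \<le> K" if "\<bar>x\<bar> \<le> 1" for x
    unfolding K_def using that c0 by (intro power2_le_iff_abs_le[THEN iffD2]) auto
  have f0: "f 0 0 = 0" "f 1 0 = of_bool (a = 1 \<and> b = 0)" "\<bar>f 1 0\<bar> \<le> 1"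
    using less.prems by (auto simp: f_def)
  have fd: "\<bar>f a' (Suc b') - f a' b'\<bar> \<le> 1" "\<bar>f (Suc a') b' - f a' b'\<bar> \<le> 1" for a' b'
    by (auto simp: f_def)
  have rec: "c = p * f 1 0 + (1 - p) * (k1 * c1 + k2 * c2 - real (a + b) * c)"
    using cluster_density_rec[OF p less.prems] unfolding c_def c1_def c2_def k1_def k2_def f0
    by (simp add: algebra_simps)
  have gen: "cluster_generator f a' b' = k1 * of_bool (a' = a \<and> b' = b - 1)
      + k2 * of_bool (a' = a - 1 \<and> b' = b) - real (a + b) * f a' b'" for a' b'
    by (auto simp: cluster_generator_def f_def k1_def k2_def)
  have Gf: "cluster_sum h n (cluster_generator f) = k1 * cluster_type_count h n a (b - 1)
      + k2 * cluster_type_count h n (a - 1) b - real (a + b) * cluster_sum h n f" for h n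
    unfolding gen cluster_type_count_def cluster_sum_def
    by (simp only: sum.distrib sum_subtractf sum_distrib_left)
  have YG: "Y n h = cluster_sum h n f - real n * c" for n h
    by (simp add: Y_def cluster_type_count_def f_def[abs_def])
  have step: "hexp (Suc n) (\<lambda>h. (Y (Suc n) h)\<^sup>2)
      \<le> hexp n (\<lambda>h. (Y n h)\<^sup>2) + (C1 + C2) + K" if n: "n \<ge> 1" for n
  proof -
    have "hexp (Suc n) (\<lambda>h. (Y (Suc n) h)\<^sup>2)
      = hexp n (\<lambda>h. (\<Sum>w=1..n. p * (Y (Suc n) (h(Suc n := (True, w))))\<^sup>2
           + (1 - p) * (Y (Suc n) (h(Suc n := (False, w))))\<^sup>2) / real n)"
      by (rule hexp_Suc[OF n])
    also have "\<dots> \<le> hexp n (\<lambda>h. (Y n h)\<^sup>2 + (k1 * (Y1 n h)\<^sup>2 + k2 * (Y2 n h)\<^sup>2) / real n + K)"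
    proof (rule hexp_mono)
      fix h assume h: "valid_history n h"
      define y where "y = Y n h"
      have T: "Y (Suc n) (h(Suc n := (True, w))) = y + (f 1 0 - c)" if "w \<in> {1..n}" for w
        using cluster_sum_innovation[where f = f, OF h that f0(1)] unfolding YG y_def by (simp add: algebra_simps)
      have F: "Y (Suc n) (h(Suc n := (False, w))) = y + (cluster_increment h n w f - c)" if "w \<in> {1..n}" for w
        using cluster_sum_repetition[where f = f, OF h that f0(1)] unfolding YG y_def by (simp add: algebra_simps)
      have "(\<Sum>w=1..n. p * (Y (Suc n) (h(Suc n := (True, w))))\<^sup>2
           + (1 - p) * (Y (Suc n) (h(Suc n := (False, w))))\<^sup>2)
         = (\<Sum>w=1..n. p * (y + (f 1 0 - c))\<^sup>2 + (1 - p) * (y + (cluster_increment h n w f - c))\<^sup>2)"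
        by (intro sum.cong) (auto simp: T F)
      also have "\<dots> \<le> (\<Sum>w=1..n. (y\<^sup>2 + 2 * y * (p * f 1 0 - c) + K) + 2 * y * (1 - p) * cluster_increment h n w f)"
      proof (rule sum_mono)
        fix w assume w: "w \<in> {1..n}"
        define x where "x = cluster_increment h n w f"
        have "\<bar>x\<bar> \<le> 1" unfolding x_def by (rule abs_cluster_increment_le[where f = f, OF h w]) (rule fd)+
        then have "p * (f 1 0 - c)\<^sup>2 + (1 - p) * (x - c)\<^sup>2 \<le> p * K + (1 - p) * K"
          using p Kb f0(3) by (intro add_mono mult_left_mono) auto
        then show "p * (y + (f 1 0 - c))\<^sup>2 + (1 - p) * (y + (x - c))\<^sup>2
            \<le> (y\<^sup>2 + 2 * y * (p * f 1 0 - c) + K) + 2 * y * (1 - p) * x"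
          by (simp add: power2_eq_square algebra_simps)
      qed
      also have "\<dots> = real n * (y\<^sup>2 + 2 * y * (p * f 1 0 - c) + K) + 2 * y * (1 - p) * cluster_sum h n (cluster_generator f)"
        unfolding sum_cluster_increment[symmetric] by (simp add: sum.distrib flip: sum_distrib_left)
      \<comment> \<open>The balance equation \<open>rec\<close> cancels the deterministic drift,
        leaving only the deviations \<open>y\<close>, \<open>Y1\<close> and
        \<open>Y2\<close>.\<close>
      also have "\<dots> = real n * (y\<^sup>2 + K) + (1 - p) * (2 * y * (k1 * Y1 n h + k2 * Y2 n h - real (a + b) * y))"
      proof -
        have r: "p * f 1 0 - c = - ((1 - p) * (k1 * c1 + k2 * c2 - real (a + b) * c))" using rec by simp
        show ?thesis unfolding r Gf Y1_def Y2_def y_def YG by (simp add: algebra_simps)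
      qed
      also have "\<dots> \<le> real n * (y\<^sup>2 + K) + 1 * (k1 * (Y1 n h)\<^sup>2 + k2 * (Y2 n h)\<^sup>2)"
      proof -
        have q: "2 * y * z \<le> y\<^sup>2 + z\<^sup>2" for z by (rule sum_squares_bound)
        have "2 * y * (k1 * Y1 n h + k2 * Y2 n h - real (a + b) * y)
            = k1 * (2 * y * Y1 n h) + k2 * (2 * y * Y2 n h) - 2 * real (a + b) * y\<^sup>2"
          by (simp add: algebra_simps power2_eq_square)
        also have "\<dots> \<le> k1 * (y\<^sup>2 + (Y1 n h)\<^sup>2) + k2 * (y\<^sup>2 + (Y2 n h)\<^sup>2) - 2 * real (a + b) * y\<^sup>2"
          using k by (intro diff_right_mono add_mono mult_left_mono q)
        also have "\<dots> = k1 * (Y1 n h)\<^sup>2 + k2 * (Y2 n h)\<^sup>2 + (k1 + k2 - 2 * real (a + b)) * y\<^sup>2"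
          by (simp add: algebra_simps)
        also have "\<dots> \<le> k1 * (Y1 n h)\<^sup>2 + k2 * (Y2 n h)\<^sup>2"
        proof -
          \<comment> \<open>Splitting the cross terms costs \<open>k1 + k2\<close>, at most
            \<open>a + b\<close>, in front of the square of \<open>y\<close>, which the damping
            outweighs. Without this sign the recursion could grow faster than linearly.\<close>
          have "(k1 + k2 - 2 * real (a + b)) * y\<^sup>2 \<le> 0" using k by (intro mult_nonpos_nonneg) auto
          then show ?thesis by simp
        qed
        finally have "(1 - p) * (2 * y * (k1 * Y1 n h + k2 * Y2 n h - real (a + b) * y))
            \<le> (1 - p) * (k1 * (Y1 n h)\<^sup>2 + k2 * (Y2 n h)\<^sup>2)"
          using p by (intro mult_left_mono) auto
        also have "\<dots> \<le> 1 * (k1 * (Y1 n h)\<^sup>2 + k2 * (Y2 n h)\<^sup>2)"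
          using p k by (intro mult_right_mono) auto
        finally show ?thesis by simp
      qed
      finally show "(\<Sum>w=1..n. p * (Y (Suc n) (h(Suc n := (True, w))))\<^sup>2
           + (1 - p) * (Y (Suc n) (h(Suc n := (False, w))))\<^sup>2) / real n
          \<le> (Y n h)\<^sup>2 + (k1 * (Y1 n h)\<^sup>2 + k2 * (Y2 n h)\<^sup>2) / real n + K"
        using n by (simp add: y_def field_simps)
    qed
    also have "\<dots> = hexp n (\<lambda>h. (Y n h)\<^sup>2)
        + (k1 * hexp n (\<lambda>h. (Y1 n h)\<^sup>2) + k2 * hexp n (\<lambda>h. (Y2 n h)\<^sup>2)) / real n + K"
      by simp
    also have "(k1 * hexp n (\<lambda>h. (Y1 n h)\<^sup>2) + k2 * hexp n (\<lambda>h. (Y2 n h)\<^sup>2)) / real n \<le> C1 + C2"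
      using C1(2)[OF n] C2(2)[OF n] n by (subst pos_divide_le_eq) (auto simp: distrib_right)
    finally show ?thesis by simp
  qed
  have "hexp n (\<lambda>h. (Y n h)\<^sup>2) \<le> (C1 + C2 + K) * real n" if "n \<ge> 1" for n
    using that
  proof (induction n rule: nat_induct_at_least)
    case base
    have "cluster_sign (\<lambda>_. (True, 0)) 1 1 = 1"
      unfolding cluster_sign_def by (subst counterbalanced_step.simps) (simp add: innovations_def)
    then have "even_count (\<lambda>_. (True, 0)) 1 1 = 1" "odd_count (\<lambda>_. (True, 0)) 1 1 = 0"
      unfolding even_count_conv_sum odd_count_conv_sum by simp_all
    then have "Y 1 (\<lambda>_. (True, 0)) = f 1 0 - c" unfolding YG by (simp add: cluster_sum_def)
    then have "hexp 1 (\<lambda>h. (Y 1 h)\<^sup>2) \<le> K" unfolding hexp_one using Kb[OF f0(3)] by simp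
    then show ?case using C1(1) C2(1) by simp
  next
    case (Suc n)
    then show ?case using step[OF Suc.hyps] by (simp add: algebra_simps)
  qed
  moreover have "C1 + C2 + K \<ge> 0" using C1(1) C2(1) by (simp add: K_def)
  ultimately show ?case unfolding Y_def c_def by blast
qed

end

subsection \<open>Convergence of exponents\<close>

lemma norm_iexp_diff_le: "cmod (iexp x - iexp y) \<le> \<bar>x - y\<bar>"
proof -
  have "iexp x - iexp y = iexp y * (iexp (x - y) - 1)"
    by (simp add: exp_diff right_diff_distrib)
  then have "cmod (iexp x - iexp y) = cmod (iexp (x - y) - 1)"
    by (simp add: norm_mult)
  also have "\<dots> \<le> \<bar>x - y\<bar>"
    using iexp_approx1[of "x - y" 0] by simp
  finally show ?thesis .
qed

text \<open>In a Skorohod coupling the integrands differ by at most the minimum of \<open>2\<close>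
  and \<open>\<bar>S\<bar> * \<bar>Ys n x - Y x\<bar>\<close>, a bound free of the argument in
  \<open>{-S..S}\<close> whose integral vanishes by dominated convergence.\<close>

lemma weak_conv_imp_char_uniform_limit:
  fixes N :: "nat \<Rightarrow> real measure" and L :: "real measure"
  assumes N: "\<And>n. real_distribution (N n)" and L: "real_distribution L" and w: "weak_conv_m N L"
  shows "uniform_limit {-S..S} (\<lambda>n. char (N n)) (char L) sequentially"
proof -
  obtain \<Omega> :: "real measure" and Ys :: "nat \<Rightarrow> real \<Rightarrow> real" and Y :: "real \<Rightarrow> real" where
    ps: "prob_space \<Omega>" and [measurable]: "\<And>n. Ys n \<in> borel_measurable \<Omega>" and
    dY: "\<And>n. distr \<Omega> borel (Ys n) = N n" and [measurable]: "Y \<in> borel_measurable \<Omega>" and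
    dL: "distr \<Omega> borel Y = L" and lim: "\<And>x. x \<in> space \<Omega> \<Longrightarrow> (\<lambda>n. Ys n x) \<longlonglongrightarrow> Y x"
    using Skorohod[OF N L w] by force
  interpret prob_space \<Omega> by fact
  define B where "B n = (\<integral>x. min 2 (\<bar>S\<bar> * \<bar>Ys n x - Y x\<bar>) \<partial>\<Omega>)" for n
  have "B \<longlonglongrightarrow> (\<integral>x. 0 \<partial>\<Omega>)"
    unfolding B_def
  proof (rule integral_dominated_convergence[where w="\<lambda>_. 2"])
    show "AE x in \<Omega>. (\<lambda>n. min 2 (\<bar>S\<bar> * \<bar>Ys n x - Y x\<bar>)) \<longlonglongrightarrow> 0"
    proof (rule AE_I2)
      fix x assume "x \<in> space \<Omega>"
      then have "(\<lambda>n. min 2 (\<bar>S\<bar> * \<bar>Ys n x - Y x\<bar>)) \<longlonglongrightarrow> min 2 (\<bar>S\<bar> * \<bar>Y x - Y x\<bar>)"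
        by (intro tendsto_intros lim)
      then show "(\<lambda>n. min 2 (\<bar>S\<bar> * \<bar>Ys n x - Y x\<bar>)) \<longlonglongrightarrow> 0" by simp
    qed
  qed auto
  then have B0: "B \<longlonglongrightarrow> 0" by simp
  have bd: "dist (char (N n) s) (char L s) \<le> B n" if s: "s \<in> {-S..S}" for n s
  proof -
    have I: "integrable \<Omega> (\<lambda>x. iexp (s * Ys n x))" "integrable \<Omega> (\<lambda>x. iexp (s * Y x))"
      by (auto intro!: integrable_iexp)
    have I2: "integrable \<Omega> (\<lambda>x. min 2 (\<bar>S\<bar> * \<bar>Ys n x - Y x\<bar>))"
      by (rule integrable_const_bound[where B=2]) auto
    have "char (N n) s - char L s = (\<integral>x. iexp (s * Ys n x) \<partial>\<Omega>) - (\<integral>x. iexp (s * Y x) \<partial>\<Omega>)"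
      unfolding char_def dY[symmetric] dL[symmetric] by (simp add: integral_distr)
    also have "\<dots> = (\<integral>x. iexp (s * Ys n x) - iexp (s * Y x) \<partial>\<Omega>)"
      using I by simp
    also have "norm \<dots> \<le> (\<integral>x. min 2 (\<bar>S\<bar> * \<bar>Ys n x - Y x\<bar>) \<partial>\<Omega>)"
    proof (rule Bochner_Integration.integral_norm_bound_integral)
      show "integrable \<Omega> (\<lambda>x. iexp (s * Ys n x) - iexp (s * Y x))" using I by simp
      fix x assume "x \<in> space \<Omega>"
      have "cmod (iexp (s * Ys n x) - iexp (s * Y x)) \<le> \<bar>s * Ys n x - s * Y x\<bar>"
        by (rule norm_iexp_diff_le)
      also have "\<dots> = \<bar>s\<bar> * \<bar>Ys n x - Y x\<bar>"
        by (simp add: abs_mult flip: right_diff_distrib)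
      also have "\<dots> \<le> \<bar>S\<bar> * \<bar>Ys n x - Y x\<bar>"
        using s by (intro mult_right_mono) auto
      finally have 1: "cmod (iexp (s * Ys n x) - iexp (s * Y x)) \<le> \<bar>S\<bar> * \<bar>Ys n x - Y x\<bar>" .
      have "cmod (iexp (s * Ys n x) - iexp (s * Y x)) \<le> cmod (iexp (s * Ys n x)) + cmod (iexp (s * Y x))"
        by (rule norm_triangle_ineq4)
      also have "\<dots> = 2" by (simp only: norm_exp_i_times)
      finally show "cmod (iexp (s * Ys n x) - iexp (s * Y x)) \<le> min 2 (\<bar>S\<bar> * \<bar>Ys n x - Y x\<bar>)"
        using 1 by simp
    qed (use I2 in auto)
    finally show ?thesis by (simp add: dist_norm B_def)
  qed
  show ?thesis
    unfolding uniform_limit_iff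
  proof (intro allI impI)
    fix e :: real assume "e > 0"
    then have "eventually (\<lambda>n. B n < e) sequentially"
      using B0 by (rule order_tendstoD(2)[rotated])
    then show "eventually (\<lambda>n. \<forall>x\<in>{-S..S}. dist (char (N n) x) (char L x) < e) sequentially"
      by eventually_elim (use bd le_less_trans in blast)
  qed
qed

text \<open>A logarithm that is continuous on the segment differs from the principal one by a constant multiple of
  \<open>2\<pi>\<i>\<close>, which vanishes at \<open>0\<close>.\<close>

lemma continuous_exponent_of_power:
  fixes f \<phi> :: "real \<Rightarrow> complex"
  assumes f: "continuous_on {-S..S} f" "f 0 = 1"
    and \<phi>: "continuous_on {-S..S} \<phi>" "\<phi> 0 = 0" and n: "n \<ge> 1"
    and close: "\<And>s. s \<in> {-S..S} \<Longrightarrow> cmod (f s ^ n * exp (\<phi> s) - 1) < 1"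
    and t: "t \<in> {-S..S}"
  shows "\<exists>z. f t = exp z \<and> of_nat n * z + \<phi> t = Ln (f t ^ n * exp (\<phi> t))"
proof -
  have nz: "f s \<noteq> 0" if "s \<in> {-S..S}" for s
    using close[OF that] n by (intro notI) (simp add: zero_power)
  obtain g where g: "continuous_on {-S..S} g" "\<And>s. s \<in> {-S..S} \<Longrightarrow> f s = exp (g s)"
    using continuous_logarithm_on_contractible[OF f(1) convex_imp_contractible nz]
    by (metis convex_real_interval(5))
  have S: "0 \<in> {-S..S}" using t by auto
  define D where "D s = of_nat n * (g s - g 0) + \<phi> s - Ln (f s ^ n * exp (\<phi> s))" for s
  have g0: "exp (g 0) = 1" using g(2)[OF S] f(2) by simp
  \<comment> \<open>Being within distance \<open>1\<close> of \<open>1\<close> puts the product into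
    the open right half-plane, where the principal logarithm is continuous.\<close>
  have pos: "f s ^ n * exp (\<phi> s) \<notin> \<real>\<^sub>\<le>\<^sub>0" "f s ^ n * exp (\<phi> s) \<noteq> 0" if "s \<in> {-S..S}" for s
  proof -
    have "Re (1 - f s ^ n * exp (\<phi> s)) \<le> cmod (1 - f s ^ n * exp (\<phi> s))" by (rule complex_Re_le_cmod)
    also have "\<dots> < 1" using close[OF that] by (simp add: norm_minus_commute)
    finally have "Re (f s ^ n * exp (\<phi> s)) > 0" by simp
    then show "f s ^ n * exp (\<phi> s) \<notin> \<real>\<^sub>\<le>\<^sub>0" "f s ^ n * exp (\<phi> s) \<noteq> 0"
      using nz[OF that] by (auto simp: complex_nonpos_Reals_iff)
  qed
  have cD: "continuous_on {-S..S} D"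
    unfolding D_def using pos by (intro continuous_intros g f \<phi>) auto
  have expD: "exp (D s) = 1" if "s \<in> {-S..S}" for s
  proof -
    have "exp (D s) = (exp (g s) / exp (g 0)) ^ n * exp (\<phi> s) / (f s ^ n * exp (\<phi> s))"
      unfolding D_def exp_diff exp_add exp_Ln[OF pos(2)[OF that]]
      by (simp add: exp_of_nat_mult exp_diff)
    then show ?thesis using g0 g(2)[OF that] pos(2)[OF that] by simp
  qed
  have D0: "D 0 = 0" by (simp add: D_def f \<phi>)
  have "D t = 0"
  proof -
    have dis: "\<exists>e>0. \<forall>y. y \<in> {-S..S} \<and> D y \<noteq> D x \<longrightarrow> e \<le> cmod (D y - D x)"
      if x: "x \<in> {-S..S}" for x
    proof (intro exI conjI allI impI)
      show "(2 * pi :: real) > 0" by simp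
      fix y assume y: "y \<in> {-S..S} \<and> D y \<noteq> D x"
      then have "exp (D y) = exp (D x)" using expD x by simp
      then have "\<not> \<bar>Im (D y) - Im (D x)\<bar> < 2 * pi"
        using y exp_complex_eqI by blast
      then show "2 * pi \<le> cmod (D y - D x)"
        using abs_Im_le_cmod[of "D y - D x"] by simp
    qed
    have "D constant_on {-S..S}"
      by (rule continuous_discrete_range_constant) (use cD dis in auto)
    then show ?thesis using D0 S t by (auto simp: constant_on_def)
  qed
  then have "of_nat n * (g t - g 0) + \<phi> t = Ln (f t ^ n * exp (\<phi> t))" by (simp add: D_def)
  moreover have "f t = exp (g t - g 0)" using g(2)[OF t] g0 by (simp add: exp_diff)
  ultimately show ?thesis by blast
qed

lemma norm_exp_minus_one_minus_le:
  fixes z :: complex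
  shows "cmod (exp z - 1 - z) \<le> exp (cmod z) * (cmod z)\<^sup>2"
proof -
  have "cmod (exp z - 1 - z) \<le> exp (cmod z) * (cmod z ^ 2)"
    using Taylor_exp_field[of z 1] by (simp add: algebra_simps power2_eq_square)
  then show ?thesis .
qed

text \<open>Since \<open>n * z n\<close> converges, \<open>z n\<close> tends to \<open>0\<close>,
  and the quadratic error of the exponential, multiplied by \<open>n\<close>, is of order
  \<open>(n * z n) * z n\<close>.\<close>

lemma tendsto_times_one_minus_exp:
  fixes z :: "nat \<Rightarrow> complex"
  assumes "(\<lambda>n. of_nat n * z n) \<longlonglongrightarrow> - l"
  shows "(\<lambda>n. of_nat n * (1 - exp (z n))) \<longlonglongrightarrow> l"
proof -
  have "(\<lambda>n. of_nat n * z n * (1 / of_nat n)) \<longlonglongrightarrow> - l * 0"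
    by (intro tendsto_mult assms lim_1_over_n)
  then have z0: "z \<longlonglongrightarrow> 0"
    by (simp only: mult_zero_right, elim Lim_transform_eventually)
       (rule eventually_sequentiallyI[of 1], simp)
  have "(\<lambda>n. of_nat n * (exp (z n) - 1 - z n)) \<longlonglongrightarrow> 0"
  proof (rule Lim_null_comparison)
    have "norm (of_nat n * (exp (z n) - 1 - z n)) \<le> exp (cmod (z n)) * cmod (of_nat n * z n) * cmod (z n)" for n
    proof -
      have "norm (of_nat n * (exp (z n) - 1 - z n)) = real n * cmod (exp (z n) - 1 - z n)"
        by (simp only: norm_mult norm_of_nat)
      also have "\<dots> \<le> real n * (exp (cmod (z n)) * (cmod (z n))\<^sup>2)"
        by (intro mult_left_mono norm_exp_minus_one_minus_le) simp
      finally show ?thesis by (simp only: norm_mult norm_of_nat power2_eq_square mult_ac)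
    qed
    then show "\<forall>\<^sub>F n in sequentially. norm (of_nat n * (exp (z n) - 1 - z n))
        \<le> exp (cmod (z n)) * cmod (of_nat n * z n) * cmod (z n)" by simp
    have "(\<lambda>n. exp (cmod (z n)) * cmod (of_nat n * z n) * cmod (z n))
        \<longlonglongrightarrow> exp (cmod 0) * cmod (- l) * cmod 0"
      by (intro tendsto_intros z0 assms)
    then show "(\<lambda>n. exp (cmod (z n)) * cmod (of_nat n * z n) * cmod (z n)) \<longlonglongrightarrow> 0" by simp
  qed
  then have "(\<lambda>n. - (of_nat n * (exp (z n) - 1 - z n)) - of_nat n * z n) \<longlonglongrightarrow> - 0 - (- l)"
    by (intro tendsto_intros assms)
  then show ?thesis by (simp add: algebra_simps)
qed

text \<open>For large \<open>n\<close> the function \<open>\<Psi> (t / a n)\<close> has a logarithm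
  on the whole segment whose \<open>n\<close>-fold is close to \<open>- \<phi>\<close>, with no
  multiple of \<open>2\<pi>\<i>\<close> left over. The argument \<open>s n\<close> may move with
  \<open>n\<close> because the proof of homogeneity replaces \<open>a n\<close> by another
  normalisation.\<close>

lemma domain_of_attraction_exponent_tendsto:
  fixes \<Psi> \<phi> :: "real \<Rightarrow> complex" and a s :: "nat \<Rightarrow> real"
  assumes \<Psi>: "continuous_on UNIV \<Psi>" "\<Psi> 0 = 1"
    and \<phi>: "continuous_on UNIV \<phi>" "\<phi> 0 = 0"
    and unif: "\<And>S. uniform_limit {-S..S} (\<lambda>n t. \<Psi> (t / a n) ^ n) (\<lambda>t. exp (- \<phi> t)) sequentially"
    and s: "s \<longlonglongrightarrow> s0"
  shows "(\<lambda>n. of_nat n * (1 - \<Psi> (s n / a n))) \<longlonglongrightarrow> \<phi> s0"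
proof -
  obtain S where S: "\<And>n. \<bar>s n\<bar> \<le> S"
    using convergent_imp_Bseq[OF convergentI[OF s]] by (auto simp: Bseq_def)
  have sS: "s n \<in> {-S..S}" for n using S[of n] by (simp add: abs_le_iff)
  have c\<phi>: "continuous_on {-S..S} \<phi>" using \<phi>(1) continuous_on_subset by blast
  have "bounded ((\<lambda>t. exp (\<phi> t)) ` {-S..S})"
    by (intro compact_imp_bounded compact_continuous_image continuous_intros c\<phi>) auto
  moreover have "bounded ((\<lambda>t. exp (- \<phi> t)) ` {-S..S})"
    by (intro compact_imp_bounded compact_continuous_image continuous_intros c\<phi>) auto
  ultimately have u: "uniform_limit {-S..S} (\<lambda>n t. \<Psi> (t / a n) ^ n * exp (\<phi> t))
      (\<lambda>t. exp (- \<phi> t) * exp (\<phi> t)) sequentially"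
    by (intro bounded_bilinear.bounded_uniform_limit[OF bounded_bilinear_mult] unif
        uniform_limit_const) auto
  define F where "F n = \<Psi> (s n / a n) ^ n * exp (\<phi> (s n))" for n
  have u': "uniform_limit {-S..S} (\<lambda>n t. \<Psi> (t / a n) ^ n * exp (\<phi> t)) (\<lambda>_. 1) sequentially"
    using u by (simp flip: exp_add)
  have F1: "F \<longlonglongrightarrow> 1"
    unfolding tendsto_iff
  proof (intro allI impI)
    fix e :: real assume "e > 0"
    with u' have "\<forall>\<^sub>F n in sequentially. \<forall>t\<in>{-S..S}. dist (\<Psi> (t / a n) ^ n * exp (\<phi> t)) 1 < e"
      by (simp add: uniform_limit_iff)
    then show "\<forall>\<^sub>F n in sequentially. dist (F n) 1 < e"
      by eventually_elim (use sS in \<open>auto simp: F_def\<close>)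
  qed
  have ev: "\<forall>\<^sub>F n in sequentially. \<exists>z. \<Psi> (s n / a n) = exp z \<and> of_nat n * z + \<phi> (s n) = Ln (F n)"
  proof -
    have "\<forall>\<^sub>F n in sequentially. \<forall>t\<in>{-S..S}. dist (\<Psi> (t / a n) ^ n * exp (\<phi> t)) 1 < 1"
      using u' by (simp add: uniform_limit_iff)
    then show ?thesis using eventually_ge_at_top[of 1]
    proof eventually_elim
      case (elim n)
      have "continuous_on {-S..S} (\<lambda>t. \<Psi> (t / a n))"
        by (rule continuous_on_compose2[OF \<Psi>(1)])
           (auto simp: divide_inverse intro!: continuous_intros)
      from continuous_exponent_of_power[OF this _ c\<phi> \<phi>(2) elim(2) _ sS[of n]] elim(1) \<Psi>(2)
      show ?case by (auto simp: F_def dist_norm)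
    qed
  qed
  define z where "z n = (SOME z. \<Psi> (s n / a n) = exp z \<and> of_nat n * z + \<phi> (s n) = Ln (F n))" for n
  have z: "\<forall>\<^sub>F n in sequentially. \<Psi> (s n / a n) = exp (z n) \<and> of_nat n * z n + \<phi> (s n) = Ln (F n)"
    using ev by eventually_elim (unfold z_def, rule someI_ex)
  have "(\<lambda>n. \<phi> (s n)) \<longlonglongrightarrow> \<phi> s0"
    using \<phi>(1) s by (auto simp: continuous_on_eq_continuous_at intro: isCont_tendsto_compose)
  moreover have "(\<lambda>n. Ln (F n)) \<longlonglongrightarrow> Ln 1"
    using F1 by (intro tendsto_Ln) auto
  ultimately have "(\<lambda>n. Ln (F n) - \<phi> (s n)) \<longlonglongrightarrow> Ln 1 - \<phi> s0"
    by (intro tendsto_diff)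
  then have "(\<lambda>n. Ln (F n) - \<phi> (s n)) \<longlonglongrightarrow> - \<phi> s0" by simp
  then have "(\<lambda>n. of_nat n * z n) \<longlonglongrightarrow> - \<phi> s0"
    by (rule Lim_transform_eventually) (use z in eventually_elim, auto simp: algebra_simps)
  then have "(\<lambda>n. of_nat n * (1 - exp (z n))) \<longlonglongrightarrow> \<phi> s0"
    by (rule tendsto_times_one_minus_exp)
  then show ?thesis
    by (rule Lim_transform_eventually) (use z in eventually_elim, auto)
qed

subsection \<open>Law of large numbers for clusters\<close>

lemma norm_exp_diff_le:
  fixes x y :: complex
  assumes "Re x \<le> 0" "Re y \<le> 0"
  shows "cmod (exp x - exp y) \<le> cmod (x - y)"
proof -
  have "cmod (exp x - exp y) \<le> 1 * cmod (x - y)"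
  proof (rule field_differentiable_bound[where S = "{z. Re z \<le> 0}" and f' = exp])
    show "convex {z. Re z \<le> 0}" by (rule convex_halfspace_Re_le)
    show "\<And>z. z \<in> {z. Re z \<le> 0} \<Longrightarrow> (exp has_field_derivative exp z) (at z within {z. Re z \<le> 0})"
      by (auto intro: DERIV_subset[OF DERIV_exp])
  qed (use assms in auto)
  then show ?thesis by simp
qed

text \<open>Both \<open>w j\<close> and \<open>exp (w j - 1)\<close> lie in the unit disc, so the
  products differ by at most the sum of the factorwise differences, which are of second order in
  \<open>1 - w j\<close>. The constant \<open>exp 2\<close> comes from
  \<open>cmod (1 - w j) \<le> 2\<close>.\<close>

lemma norm_prod_minus_exp_sum_le:
  fixes w :: "'i \<Rightarrow> complex"
  assumes fin: "finite J" and w: "\<And>j. j \<in> J \<Longrightarrow> cmod (w j) \<le> 1"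
  shows "cmod ((\<Prod>j\<in>J. w j) - exp (- (\<Sum>j\<in>J. 1 - w j))) \<le> exp 2 * (\<Sum>j\<in>J. (cmod (1 - w j))\<^sup>2)"
proof -
  have "exp (- (\<Sum>j\<in>J. 1 - w j)) = (\<Prod>j\<in>J. exp (- (1 - w j)))"
    using fin by (simp add: exp_sum flip: sum_negf)
  then have "cmod ((\<Prod>j\<in>J. w j) - exp (- (\<Sum>j\<in>J. 1 - w j))) \<le> (\<Sum>j\<in>J. cmod (w j - exp (- (1 - w j))))"
    using w complex_Re_le_cmod[of "w _"] by (simp only:) (intro norm_prod_diff, auto intro: order_trans)
  also have "\<dots> \<le> (\<Sum>j\<in>J. exp 2 * (cmod (1 - w j))\<^sup>2)"
  proof (rule sum_mono)
    fix j assume j: "j \<in> J"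
    have "cmod (w j - exp (- (1 - w j))) = cmod (exp (- (1 - w j)) - 1 - (- (1 - w j)))"
      by (simp add: norm_minus_commute)
    also have "\<dots> \<le> exp (cmod (- (1 - w j))) * (cmod (- (1 - w j)))\<^sup>2"
      by (rule norm_exp_minus_one_minus_le)
    also have "\<dots> \<le> exp 2 * (cmod (1 - w j))\<^sup>2"
      unfolding norm_minus_cancel using w[OF j] norm_triangle_ineq4[of 1 "w j"]
      by (intro mult_right_mono) auto
    finally show "cmod (w j - exp (- (1 - w j))) \<le> exp 2 * (cmod (1 - w j))\<^sup>2" .
  qed
  finally show ?thesis by (simp add: sum_distrib_left)
qed

text \<open>Clusters of bounded positive size are regrouped by their finitely many types, to which
  the law of large numbers can be applied one at a time.\<close>

lemma cluster_sum_truncated: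
  fixes g :: "nat \<Rightarrow> nat \<Rightarrow> 'b::real_normed_field"
  shows "cluster_sum h n (\<lambda>a b. of_bool (a + b \<in> {1..K}) * g a b)
    = (\<Sum>k=1..K. \<Sum>l\<le>k. of_real (cluster_type_count h n (k - l) l) * g (k - l) l)"
proof -
  have pt: "of_bool (a + b \<in> {1..K}) * g a b
      = (\<Sum>k=1..K. \<Sum>l\<le>k. of_bool (a = k - l \<and> b = l) * g (k - l) l)" for a b
  proof -
    have "(\<Sum>l\<le>k. of_bool (a = k - l \<and> b = l) * g (k - l) l) = (if k = a + b then g a b else 0)" for k
    proof -
      have "(\<Sum>l\<le>k. of_bool (a = k - l \<and> b = l) * g (k - l) l)
          = (\<Sum>l\<le>k. if l = b then of_bool (k = a + b) * g a b else 0)"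
        by (intro sum.cong) auto
      then show ?thesis by simp
    qed
    then show ?thesis by simp
  qed
  have "cluster_sum h n (\<lambda>a b. of_bool (a + b \<in> {1..K}) * g a b)
     = (\<Sum>k=1..K. \<Sum>l\<le>k. \<Sum>j=1..n. of_bool (even_count h n j = k - l \<and> odd_count h n j = l) * g (k - l) l)"
    unfolding cluster_sum_def pt
    by (rule trans[OF sum.swap], rule sum.cong[OF refl], rule sum.swap)
  then show ?thesis
    unfolding cluster_type_count_def cluster_sum_def of_real_sum sum_distrib_right
    by (simp only: of_bool_def if_distrib[of of_real] of_real_0 of_real_1)
qed

context
  fixes p :: real
  assumes p: "0 < p" "p < 1"
begin

lemma hexp_nonneg: "(\<And>h. valid_history n h \<Longrightarrow> F h \<ge> 0) \<Longrightarrow> hexp p n F \<ge> 0"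
  using hexp_mono[OF p, of n "\<lambda>_. 0" F] by simp

lemma cluster_type_count_L1:
  assumes "a + b \<ge> 1"
  shows "(\<lambda>n. hexp p n (\<lambda>h. \<bar>cluster_type_count h n a b / real n - cluster_density p a b\<bar>)) \<longlonglongrightarrow> 0"
proof -
  define c where "c = cluster_density p a b"
  obtain C where C: "C \<ge> 0" "\<And>n. n \<ge> 1 \<Longrightarrow>
      hexp p n (\<lambda>h. (cluster_type_count h n a b - real n * c)\<^sup>2) \<le> C * real n"
    using cluster_type_count_variance[OF p assms] unfolding c_def by blast
  have bd: "hexp p n (\<lambda>h. \<bar>cluster_type_count h n a b / real n - c\<bar>) \<le> (C + 1) / sqrt (real n)" if n: "n \<ge> 1" for n
  proof -
    have "hexp p n (\<lambda>h. \<bar>cluster_type_count h n a b / real n - c\<bar>)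
        \<le> hexp p n (\<lambda>h. (cluster_type_count h n a b - real n * c)\<^sup>2 * (sqrt (real n) / (real n)\<^sup>2) + 1 / sqrt (real n))"
    proof (rule hexp_mono[OF p])
      fix h
      define x where "x = \<bar>cluster_type_count h n a b / real n - c\<bar>"
      \<comment> \<open>The inequality \<open>x \<le> s * x * x + 1 / s\<close> turns the second
        moment into a first moment; \<open>s = sqrt n\<close> makes both terms of order
        \<open>1 / sqrt n\<close>.\<close>
      define s where "s = sqrt (real n)"
      have s: "s > 0" using n by (simp add: s_def)
      have "2 * (s * x) \<le> (s * x)\<^sup>2 + 1" using sum_squares_bound[of "s * x" 1] by simp
      moreover have "0 \<le> s * x" using s by (simp add: x_def)
      ultimately have "s * x \<le> s * (s * x\<^sup>2) + 1" by (simp add: power2_eq_square mult_ac)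
      then have "x \<le> s * x\<^sup>2 + 1 / s" using s by (simp add: field_simps)
      moreover have "x\<^sup>2 = (cluster_type_count h n a b - real n * c)\<^sup>2 / (real n)\<^sup>2"
        using n by (simp add: x_def diff_divide_distrib power_divide[symmetric])
      ultimately show "\<bar>cluster_type_count h n a b / real n - c\<bar>
        \<le> (cluster_type_count h n a b - real n * c)\<^sup>2 * (sqrt (real n) / (real n)\<^sup>2) + 1 / sqrt (real n)"
        by (simp add: x_def s_def mult.commute)
    qed
    also have "\<dots> = hexp p n (\<lambda>h. (cluster_type_count h n a b - real n * c)\<^sup>2) * (sqrt (real n) / (real n)\<^sup>2) + 1 / sqrt (real n)"
      using p by simp
    also have "\<dots> \<le> C * real n * (sqrt (real n) / (real n)\<^sup>2) + 1 / sqrt (real n)"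
      by (intro add_right_mono mult_right_mono C n) auto
    also have "C * real n * (sqrt (real n) / (real n)\<^sup>2) = C / sqrt (real n)"
      using n by (simp add: power2_eq_square real_div_sqrt field_simps)
    finally show ?thesis by (simp add: add_divide_distrib)
  qed
  show ?thesis unfolding c_def[symmetric]
  proof (rule real_tendsto_sandwich[where f = "\<lambda>_. 0", OF always_eventually eventually_sequentiallyI[of 1]])
    show "(\<lambda>n. (C + 1) / sqrt (real n)) \<longlonglongrightarrow> 0" by real_asymp
  qed (use bd hexp_nonneg in auto)
qed

text \<open>The mean of the sum of squares divided by \<open>n\<close> is at most \<open>1\<close>;
  keeping finitely many types preserves the bound, and their mean frequencies converge to the
  densities.\<close>

lemma cluster_density_sum_squares_le:
  "(\<Sum>k=1..K. \<Sum>l\<le>k. cluster_density p (k - l) l * (real (k - l) - real l)\<^sup>2) \<le> 1"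
proof -
  have lim: "(\<lambda>n. hexp p n (\<lambda>h. cluster_type_count h n (k - l) l / real n)) \<longlonglongrightarrow> cluster_density p (k - l) l"
    if "k \<in> {1..K}" "l \<in> {..k}" for k l
  proof -
    define c where "c = cluster_density p (k - l) l"
    have "(\<lambda>n. hexp p n (\<lambda>h. cluster_type_count h n (k - l) l / real n) - c) \<longlonglongrightarrow> 0"
    proof (rule Lim_null_comparison[OF always_eventually])
      show "(\<lambda>n. hexp p n (\<lambda>h. \<bar>cluster_type_count h n (k - l) l / real n - c\<bar>)) \<longlonglongrightarrow> 0"
        unfolding c_def using that by (intro cluster_type_count_L1) auto
      show "\<forall>n. norm (hexp p n (\<lambda>h. cluster_type_count h n (k - l) l / real n) - c)
          \<le> hexp p n (\<lambda>h. \<bar>cluster_type_count h n (k - l) l / real n - c\<bar>)"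
      proof
        fix n
        have "hexp p n (\<lambda>h. cluster_type_count h n (k - l) l / real n) - c
            = hexp p n (\<lambda>h. cluster_type_count h n (k - l) l / real n - c)"
          using p by (subst Bochner_Integration.integral_diff) auto
        then show "norm (hexp p n (\<lambda>h. cluster_type_count h n (k - l) l / real n) - c)
          \<le> hexp p n (\<lambda>h. \<bar>cluster_type_count h n (k - l) l / real n - c\<bar>)"
          using integral_norm_bound[of "measure_pmf (history_pmf p n)"
            "\<lambda>h. cluster_type_count h n (k - l) l / real n - c"] by simp
      qed
    qed
    then show ?thesis unfolding c_def by (simp add: LIM_zero_iff)
  qed
  have "(\<lambda>n. \<Sum>k=1..K. \<Sum>l\<le>k. hexp p n (\<lambda>h. cluster_type_count h n (k - l) l / real n) * (real (k - l) - real l)\<^sup>2)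
      \<longlonglongrightarrow> (\<Sum>k=1..K. \<Sum>l\<le>k. cluster_density p (k - l) l * (real (k - l) - real l)\<^sup>2)"
    by (intro tendsto_sum tendsto_mult lim tendsto_const)
  then show ?thesis
  proof (rule tendsto_upperbound[OF _ eventually_sequentiallyI[of 1]])
    fix n :: nat assume n: "1 \<le> n"
    have "(\<Sum>k=1..K. \<Sum>l\<le>k. hexp p n (\<lambda>h. cluster_type_count h n (k - l) l / real n) * (real (k - l) - real l)\<^sup>2)
        = hexp p n (\<lambda>h. (\<Sum>k=1..K. \<Sum>l\<le>k. cluster_type_count h n (k - l) l * (real (k - l) - real l)\<^sup>2) / real n)"
      using p by (simp add: sum_divide_distrib)
    also have "\<dots> = hexp p n (\<lambda>h. cluster_sum h n (\<lambda>a b. of_bool (a + b \<in> {1..K}) * (real a - real b)\<^sup>2)) / real n"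
      using p unfolding cluster_sum_truncated by simp
    also have "\<dots> \<le> hexp p n (\<lambda>h. cluster_sum h n (\<lambda>a b. (real a - real b)\<^sup>2)) / real n"
      by (intro divide_right_mono hexp_mono[OF p], unfold cluster_sum_def, rule sum_mono)
        (simp_all add: of_bool_def)
    also have "\<dots> \<le> 1" using hexp_sum_squares_le[OF p n] n by simp
    finally show "(\<Sum>k=1..K. \<Sum>l\<le>k. hexp p n (\<lambda>h. cluster_type_count h n (k - l) l / real n) * (real (k - l) - real l)\<^sup>2) \<le> 1" .
  qed simp
qed

lemma summable_cluster_density_squares:
  "summable (\<lambda>k. \<Sum>l<k. cluster_density p (k - l) l * (real_of_int (int k - 2 * int l))\<^sup>2)"
proof (rule summableI_nonneg_bounded)
  have nn: "0 \<le> cluster_density p a b" for a b by (rule cluster_density_nonneg[OF p])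
  show "0 \<le> (\<Sum>l<k. cluster_density p (k - l) l * (real_of_int (int k - 2 * int l))\<^sup>2)" for k
    by (intro sum_nonneg mult_nonneg_nonneg nn) auto
  fix N
  have "(\<Sum>k<N. \<Sum>l<k. cluster_density p (k - l) l * (real_of_int (int k - 2 * int l))\<^sup>2)
      = (\<Sum>k<N. \<Sum>l<k. cluster_density p (k - l) l * (real (k - l) - real l)\<^sup>2)"
    by (intro sum.cong) (auto simp: of_nat_diff)
  also have "\<dots> = (\<Sum>k\<in>{..<N} - {0}. \<Sum>l<k. cluster_density p (k - l) l * (real (k - l) - real l)\<^sup>2)"
    by (rule sum.mono_neutral_right) auto
  also have "\<dots> \<le> (\<Sum>k=1..N. \<Sum>l<k. cluster_density p (k - l) l * (real (k - l) - real l)\<^sup>2)"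
    by (rule sum_mono2) (auto intro!: sum_nonneg mult_nonneg_nonneg nn)
  also have "\<dots> \<le> (\<Sum>k=1..N. \<Sum>l\<le>k. cluster_density p (k - l) l * (real (k - l) - real l)\<^sup>2)"
    by (intro sum_mono sum_mono2) (auto intro!: mult_nonneg_nonneg nn)
  also have "\<dots> \<le> 1" by (rule cluster_density_sum_squares_le)
  finally show "(\<Sum>k<N. \<Sum>l<k. cluster_density p (k - l) l * (real_of_int (int k - 2 * int l))\<^sup>2) \<le> 1" .
qed

end

text \<open>\<open>W n d\<close> stands for the characteristic function of a step at
  \<open>d * \<theta> / a n\<close>. The mean distance to the limit is split so that the unbounded
  clusters are charged to the sum of squares and to the total size, both at most \<open>n\<close> in
  mean, while finitely many types are left to the law of large numbers.\<close>

lemma cluster_product_tendsto: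
  fixes W :: "nat \<Rightarrow> int \<Rightarrow> complex" and \<Phi> :: "int \<Rightarrow> complex"
  assumes p: "0 < p" "p < 1"
    and W: "\<And>n d. cmod (W n d) \<le> 1" "\<And>n. W n 0 = 1"
    and lim: "\<And>d. (\<lambda>n. of_nat n * (1 - W n d)) \<longlonglongrightarrow> \<Phi> d"
    and qb: "\<And>\<delta>. \<delta> > 0 \<Longrightarrow> \<exists>C\<ge>0. \<forall>\<^sub>F n in sequentially. \<forall>d::int.
           real n * cmod (1 - W n d) \<le> \<delta> * (real_of_int d)\<^sup>2 + C"
  defines "T \<equiv> \<lambda>k. \<Sum>l<k. of_real (cluster_density p (k - l) l) * \<Phi> (int k - 2 * int l)"
  shows "summable T"
    and "(\<lambda>n. measure_pmf.expectation (history_pmf p n)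
             (\<lambda>h. \<Prod>j=1..n. W n (int (even_count h n j) - int (odd_count h n j))))
          \<longlonglongrightarrow> exp (- suminf T)"
proof -
  have \<Phi>0: "\<Phi> 0 = 0"
    using LIMSEQ_unique[OF lim[of 0]] W(2) by simp
  have ReW: "Re (1 - W n d) \<ge> 0" for n d
    using complex_Re_le_cmod[of "W n d"] W(1)[of n d] by simp
  have Re\<Phi>: "Re (\<Phi> d) \<ge> 0" for d
  proof (rule tendsto_lowerbound[OF tendsto_Re[OF lim]])
    show "\<forall>\<^sub>F n in sequentially. 0 \<le> Re (of_nat n * (1 - W n d))"
      using ReW[of _ d] by (auto intro!: always_eventually)
  qed simp
  have c0: "cluster_density p a b \<ge> 0" for a b by (rule cluster_density_nonneg[OF p])
  obtain C1 where C1: "C1 \<ge> 0" "\<forall>\<^sub>F n in sequentially. \<forall>d::int.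
      real n * cmod (1 - W n d) \<le> 1 * (real_of_int d)\<^sup>2 + C1"
    using qb[of 1] by auto
  \<comment> \<open>The bound with \<open>\<delta> = 1\<close> survives the limit, and its constant
    is absorbed because a nonzero integer has square at least \<open>1\<close>. This dominates
    \<open>T\<close> by the summable series of squares.\<close>
  have \<Phi>b: "cmod (\<Phi> d) \<le> (1 + C1) * (real_of_int d)\<^sup>2" for d
  proof (cases "d = 0")
    case False
    have "cmod (\<Phi> d) \<le> 1 * (real_of_int d)\<^sup>2 + C1"
    proof (rule tendsto_upperbound[OF tendsto_norm[OF lim]])
      show "\<forall>\<^sub>F n in sequentially. cmod (of_nat n * (1 - W n d)) \<le> 1 * (real_of_int d)\<^sup>2 + C1"
        using C1(2) by eventually_elim (auto simp: norm_mult)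
    qed simp
    also have "\<dots> \<le> 1 * (real_of_int d)\<^sup>2 + C1 * (real_of_int d)\<^sup>2"
    proof -
      have "1 \<le> d\<^sup>2" using False by (metis int_one_le_iff_zero_less zero_less_power2)
      then have "1 \<le> (real_of_int d)\<^sup>2" by (metis of_int_1_le_iff of_int_power)
      then show ?thesis using C1(1) mult_left_mono[of 1 "(real_of_int d)\<^sup>2" C1] by simp
    qed
    finally show ?thesis by (simp add: algebra_simps)
  qed (simp add: \<Phi>0)
  show sT: "summable T"
  proof (rule summable_comparison_test')
    show "summable (\<lambda>k. (1 + C1) * (\<Sum>l<k. cluster_density p (k - l) l * (real_of_int (int k - 2 * int l))\<^sup>2))"
      by (intro summable_mult summable_cluster_density_squares p)
    fix k
    have "norm (T k) \<le> (\<Sum>l<k. norm (of_real (cluster_density p (k - l) l) * \<Phi> (int k - 2 * int l)))"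
      unfolding T_def by (rule norm_sum)
    also have "\<dots> \<le> (\<Sum>l<k. cluster_density p (k - l) l * ((1 + C1) * (real_of_int (int k - 2 * int l))\<^sup>2))"
      unfolding norm_mult norm_of_real abs_of_nonneg[OF c0] by (intro sum_mono mult_left_mono \<Phi>b c0)
    also have "\<dots> = (1 + C1) * (\<Sum>l<k. cluster_density p (k - l) l * (real_of_int (int k - 2 * int l))\<^sup>2)"
      by (simp add: sum_distrib_left mult_ac)
    finally show "norm (T k) \<le> (1 + C1) * (\<Sum>l<k. cluster_density p (k - l) l * (real_of_int (int k - 2 * int l))\<^sup>2)" .
  qed
  define S where "S = suminf T"
  \<comment> \<open>With this, \<open>- S\<close> and all \<open>- Z n h\<close> lie in the
    half-plane where the exponential is a contraction.\<close>
  have "Re S \<ge> 0"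
  proof -
    have "Re S = (\<Sum>k. Re (T k))" unfolding S_def by (rule Re_suminf[OF sT])
    also have "\<dots> \<ge> 0"
    proof (rule suminf_nonneg)
      show "summable (\<lambda>k. Re (T k))" by (rule summable_Re[OF sT])
      show "0 \<le> Re (T k)" for k
        unfolding T_def Re_sum by (auto intro!: sum_nonneg mult_nonneg_nonneg c0 Re\<Phi>)
    qed
    finally show ?thesis .
  qed
  define dl :: "nat \<Rightarrow> (nat \<Rightarrow> bool \<times> nat) \<Rightarrow> nat \<Rightarrow> int" where
    "dl n h j = int (even_count h n j) - int (odd_count h n j)" for n h j
  define Z where "Z n h = (\<Sum>j=1..n. 1 - W n (dl n h j))" for n h
  define Q where "Q h n = cluster_sum h n (\<lambda>a b. (real a - real b)\<^sup>2)" for h n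
  have Qdl: "Q h n = (\<Sum>j=1..n. (real_of_int (dl n h j))\<^sup>2)" for h n
    by (simp add: Q_def cluster_sum_def dl_def)
  have EQ: "hexp p n (\<lambda>h. Q h n) \<le> real n" if "n \<ge> 1" for n
    unfolding Q_def by (rule hexp_sum_squares_le[OF p that])
  define P where "P n h = (\<Prod>j=1..n. W n (dl n h j))" for n h
  define c' where "c' k l = cluster_density p (k - l) l" for k l
  define \<Phi>' where "\<Phi>' k l = \<Phi> (int (k - l) - int l)" for k l
  define W' where "W' n k l = W n (int (k - l) - int l)" for n k l
  \<comment> \<open>The mean error from types of size at most \<open>K\<close>: fluctuation of their
    frequencies, and distance of \<open>n * (1 - W)\<close> from its limit.\<close>
  define M where "M K n = (\<Sum>k=1..K. \<Sum>l\<le>k. cmod (of_nat n * (1 - W' n k l))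
      * hexp p n (\<lambda>h. \<bar>cluster_type_count h n (k - l) l / real n - c' k l\<bar>)
      + c' k l * cmod (of_nat n * (1 - W' n k l) - \<Phi>' k l))" for K n
  have M0: "M K \<longlonglongrightarrow> 0" for K
  proof -
    have "M K \<longlonglongrightarrow> (\<Sum>k=1..K. \<Sum>l\<le>k. cmod (\<Phi>' k l) * 0 + c' k l * cmod (\<Phi>' k l - \<Phi>' k l))"
      unfolding M_def
    proof (intro tendsto_sum tendsto_add tendsto_mult tendsto_norm tendsto_diff tendsto_const)
      fix k l assume "k \<in> {1..K}" "l \<in> {..k}"
      then show "(\<lambda>n. hexp p n (\<lambda>h. \<bar>cluster_type_count h n (k - l) l / real n - c' k l\<bar>)) \<longlonglongrightarrow> 0"
        unfolding c'_def by (intro cluster_type_count_L1[OF p]) auto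
      show "(\<lambda>n. of_nat n * (1 - W' n k l)) \<longlonglongrightarrow> \<Phi>' k l" unfolding W'_def \<Phi>'_def by (rule lim)
      show "(\<lambda>n. of_nat n * (1 - W' n k l)) \<longlonglongrightarrow> \<Phi>' k l" unfolding W'_def \<Phi>'_def by (rule lim)
    qed
    then show ?thesis by simp
  qed
  have T': "T k = (\<Sum>l\<le>k. of_real (c' k l) * \<Phi>' k l)" if "k \<ge> 1" for k
  proof -
    have "(\<Sum>l\<le>k. of_real (c' k l) * \<Phi>' k l) = (\<Sum>l<k. of_real (c' k l) * \<Phi>' k l)"
      using that by (intro sum.mono_neutral_right) (auto simp: c'_def cluster_density_0_left not_less le_antisym)
    also have "\<dots> = T k"
      unfolding T_def by (intro sum.cong) (auto simp: c'_def \<Phi>'_def of_nat_diff algebra_simps)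
    finally show ?thesis ..
  qed
  have bound: "hexp p n (\<lambda>h. cmod (P n h - exp (- S)))
      \<le> exp 2 * ((2 + C / real n) * \<delta> + C\<^sup>2 / real n) + (\<delta> + C / real K) + M K n + cmod ((\<Sum>k=1..K. T k) - S)"
    if \<delta>: "\<delta> > 0" and C: "C \<ge> 0" and n: "n \<ge> 1" and K: "K \<ge> 1"
      and q: "\<forall>d::int. real n * cmod (1 - W n d) \<le> \<delta> * (real_of_int d)\<^sup>2 + C"
    for \<delta> C n K
  proof -
    have q': "cmod (1 - W n d) \<le> \<delta> / n * (real_of_int d)\<^sup>2 + C / n" for d
      using q n by (simp add: field_simps)
    define main where "main h = (\<Sum>k=1..K. \<Sum>l\<le>k. of_real (cluster_type_count h n (k - l) l) * (1 - W' n k l))" for h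
    \<comment> \<open>The errors are, in this order: product against exponential, clusters larger
      than \<open>K\<close>, types of size at most \<open>K\<close>, and the tail of the
      series.\<close>
    have "cmod (P n h - exp (- S)) \<le> exp 2 * (((2 + C / n) * \<delta>) / n * Q h n + C\<^sup>2 / n)
        + (\<delta> / n * Q h n + C / K)
        + (\<Sum>k=1..K. \<Sum>l\<le>k. cmod (of_nat n * (1 - W' n k l)) * \<bar>cluster_type_count h n (k - l) l / real n - c' k l\<bar>
            + c' k l * cmod (of_nat n * (1 - W' n k l) - \<Phi>' k l))
        + cmod ((\<Sum>k=1..K. T k) - S)" if h: "valid_history n h" for h
    proof -
      have "(\<Sum>j=1..n. (cmod (1 - W n (dl n h j)))\<^sup>2)
          \<le> (\<Sum>j=1..n. ((2 + C / n) * \<delta>) / n * (real_of_int (dl n h j))\<^sup>2 + (C / n)\<^sup>2)"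
      proof (rule sum_mono)
        fix j
        \<comment> \<open>In the square of \<open>y\<close>, the factor \<open>y\<close> is bounded
          by \<open>2\<close> against \<open>u\<close> and by \<open>u + v\<close> against
          \<open>v\<close>. The result is linear in \<open>u\<close>, hence in the squared
          imbalance; squaring \<open>u\<close> itself would require fourth moments.\<close>
        define y u v where "y = cmod (1 - W n (dl n h j))"
          and "u = \<delta> / n * (real_of_int (dl n h j))\<^sup>2" and "v = C / n"
        have y: "0 \<le> y" "y \<le> 2" "y \<le> u + v"
          using q' norm_triangle_ineq4[of 1 "W n (dl n h j)"] W(1)[of n "dl n h j"]
          by (auto simp: y_def u_def v_def)
        have uv: "u \<ge> 0" "v \<ge> 0" using \<delta> C by (simp_all add: u_def v_def)
        have "y\<^sup>2 \<le> y * (u + v)" using y by (simp add: power2_eq_square mult_left_mono)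
        also have "\<dots> = y * u + y * v" by (simp add: distrib_left)
        also have "\<dots> \<le> 2 * u + (u + v) * v" using y uv by (intro add_mono mult_right_mono)
        also have "\<dots> = (2 + v) * u + v\<^sup>2" by (simp add: power2_eq_square algebra_simps)
        finally show "(cmod (1 - W n (dl n h j)))\<^sup>2 \<le> ((2 + C / n) * \<delta>) / n * (real_of_int (dl n h j))\<^sup>2 + (C / n)\<^sup>2"
          by (simp add: y_def u_def v_def)
      qed
      also have "\<dots> = ((2 + C / n) * \<delta>) / n * Q h n + C\<^sup>2 / n"
        using n unfolding Qdl sum.distrib sum_distrib_left by (simp add: power2_eq_square)
      finally have sq: "(\<Sum>j=1..n. (cmod (1 - W n (dl n h j)))\<^sup>2) \<le> ((2 + C / n) * \<delta>) / n * Q h n + C\<^sup>2 / n" .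
      have 1: "cmod (P n h - exp (- Z n h)) \<le> exp 2 * (((2 + C / n) * \<delta>) / n * Q h n + C\<^sup>2 / n)"
        unfolding P_def Z_def using norm_prod_minus_exp_sum_le[of "{1..n}" "\<lambda>j. W n (dl n h j)"] W(1) sq
        by (meson exp_ge_zero finite_atLeastAtMost mult_left_mono order_trans)
      have "Re (Z n h) \<ge> 0" unfolding Z_def Re_sum by (intro sum_nonneg ReW)
      then have 2: "cmod (exp (- Z n h) - exp (- S)) \<le> cmod (Z n h - S)"
        using norm_exp_diff_le[of "- Z n h" "- S"] \<open>Re S \<ge> 0\<close> by (simp add: norm_minus_commute)
      have Zsplit: "Z n h = main h + (\<Sum>j=1..n. of_bool (even_count h n j + odd_count h n j \<notin> {1..K}) * (1 - W n (dl n h j)))"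
      proof -
        have "main h = cluster_sum h n (\<lambda>a b. of_bool (a + b \<in> {1..K}) * (1 - W n (int a - int b)))"
          unfolding main_def W'_def by (rule cluster_sum_truncated[symmetric])
        then have mainS: "main h = (\<Sum>j=1..n. of_bool (even_count h n j + odd_count h n j \<in> {1..K}) * (1 - W n (dl n h j)))"
          unfolding cluster_sum_def dl_def .
        show ?thesis
          unfolding Z_def mainS sum.distrib[symmetric] by (intro sum.cong) (auto simp: of_bool_def)
      qed
      have "cmod (Z n h - main h)
          \<le> (\<Sum>j=1..n. cmod (of_bool (even_count h n j + odd_count h n j \<notin> {1..K}) * (1 - W n (dl n h j))))"
        unfolding Zsplit add_diff_cancel_left' by (rule norm_sum)
      also have "\<dots> \<le> (\<Sum>j=1..n. \<delta> / n * (real_of_int (dl n h j))\<^sup>2 + C / (n * K) * real (even_count h n j + odd_count h n j))"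
      proof (rule sum_mono)
        fix j
        define s where "s = even_count h n j + odd_count h n j"
        have nn: "0 \<le> \<delta> / n * (real_of_int (dl n h j))\<^sup>2 + C / (n * K) * real s"
          using \<delta> C by simp
        consider "s = 0" | "s \<in> {1..K}" | "s > K" by fastforce
        then show "cmod (of_bool (even_count h n j + odd_count h n j \<notin> {1..K}) * (1 - W n (dl n h j)))
          \<le> \<delta> / n * (real_of_int (dl n h j))\<^sup>2 + C / (n * K) * real (even_count h n j + odd_count h n j)"
          unfolding s_def[symmetric]
        proof cases
          case 1
          then have "dl n h j = 0" by (simp add: s_def dl_def)
          then show "cmod (of_bool (s \<notin> {1..K}) * (1 - W n (dl n h j)))
            \<le> \<delta> / n * (real_of_int (dl n h j))\<^sup>2 + C / (n * K) * real s" using nn W(2) by simp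
        next
          case 3
          \<comment> \<open>A cluster larger than \<open>K\<close> charges its constant
            \<open>C / n\<close> to its size \<open>s\<close>; as the sizes add up to
            \<open>n\<close>, all of them together cost at most \<open>C / K\<close>.\<close>
          then have "1 \<le> real s / K" using K by simp
          then have "C / n * 1 \<le> C / n * (real s / K)" using C by (intro mult_left_mono) auto
          then show "cmod (of_bool (s \<notin> {1..K}) * (1 - W n (dl n h j)))
            \<le> \<delta> / n * (real_of_int (dl n h j))\<^sup>2 + C / (n * K) * real s"
            using q'[of "dl n h j"] nn by (auto simp: of_bool_def)
        qed (use nn in simp)
      qed
      also have "\<dots> = \<delta> / n * Q h n + C / (n * K) * cluster_sum h n (\<lambda>a b. real (a + b))"
        unfolding Qdl cluster_sum_def sum.distrib sum_distrib_left ..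
      also have "\<dots> = \<delta> / n * Q h n + C / K"
        using n unfolding cluster_sum_size[OF h] by simp
      finally have 3: "cmod (Z n h - main h) \<le> \<delta> / n * Q h n + C / K" .
      have 4: "cmod (main h - (\<Sum>k=1..K. T k)) \<le> (\<Sum>k=1..K. \<Sum>l\<le>k.
          cmod (of_nat n * (1 - W' n k l)) * \<bar>cluster_type_count h n (k - l) l / real n - c' k l\<bar>
            + c' k l * cmod (of_nat n * (1 - W' n k l) - \<Phi>' k l))"
      proof -
        have "main h - (\<Sum>k=1..K. T k) = (\<Sum>k=1..K. \<Sum>l\<le>k.
            of_real (cluster_type_count h n (k - l) l) * (1 - W' n k l) - of_real (c' k l) * \<Phi>' k l)"
          unfolding main_def by (simp add: T' sum_subtractf)
        also have "cmod \<dots> \<le> (\<Sum>k=1..K. \<Sum>l\<le>k. cmod (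
            of_real (cluster_type_count h n (k - l) l) * (1 - W' n k l) - of_real (c' k l) * \<Phi>' k l))"
          by (intro order_trans[OF norm_sum] sum_mono norm_sum)
        also have "\<dots> \<le> (\<Sum>k=1..K. \<Sum>l\<le>k.
          cmod (of_nat n * (1 - W' n k l)) * \<bar>cluster_type_count h n (k - l) l / real n - c' k l\<bar>
            + c' k l * cmod (of_nat n * (1 - W' n k l) - \<Phi>' k l))"
        proof (intro sum_mono)
          fix k l
          define t where "t = cluster_type_count h n (k - l) l"
          have e: "of_real t * (1 - W' n k l) - of_real (c' k l) * \<Phi>' k l
             = of_real (t / n - c' k l) * (of_nat n * (1 - W' n k l)) + of_real (c' k l) * (of_nat n * (1 - W' n k l) - \<Phi>' k l)"
            using n by (simp add: field_simps)
          show "cmod (of_real t * (1 - W' n k l) - of_real (c' k l) * \<Phi>' k l)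
            \<le> cmod (of_nat n * (1 - W' n k l)) * \<bar>t / n - c' k l\<bar> + c' k l * cmod (of_nat n * (1 - W' n k l) - \<Phi>' k l)"
            unfolding e using c0 by (intro order_trans[OF norm_triangle_ineq]) (simp only: norm_mult norm_of_real abs_of_nonneg c'_def, simp)
        qed
        finally show ?thesis .
      qed
      have "cmod (P n h - exp (- S)) \<le> cmod (P n h - exp (- Z n h)) + (cmod (Z n h - main h)
          + cmod (main h - (\<Sum>k=1..K. T k)) + cmod ((\<Sum>k=1..K. T k) - S))"
        using norm_triangle_ineq[of "P n h - exp (- Z n h)" "exp (- Z n h) - exp (- S)"] 2
          norm_triangle_ineq[of "Z n h - main h" "main h - S"]
          norm_triangle_ineq[of "main h - (\<Sum>k=1..K. T k)" "(\<Sum>k=1..K. T k) - S"]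
        by simp
      then show ?thesis using 1 3 4 by linarith
    qed
    then have "hexp p n (\<lambda>h. cmod (P n h - exp (- S))) \<le> hexp p n (\<lambda>h. exp 2 * (((2 + C / n) * \<delta>) / n * Q h n + C\<^sup>2 / n)
        + (\<delta> / n * Q h n + C / K)
        + (\<Sum>k=1..K. \<Sum>l\<le>k. cmod (of_nat n * (1 - W' n k l)) * \<bar>cluster_type_count h n (k - l) l / real n - c' k l\<bar>
            + c' k l * cmod (of_nat n * (1 - W' n k l) - \<Phi>' k l))
        + cmod ((\<Sum>k=1..K. T k) - S))"
      by (rule hexp_mono[OF p])
    also have "\<dots> = exp 2 * (((2 + C / n) * \<delta>) / n * hexp p n (\<lambda>h. Q h n) + C\<^sup>2 / n)
        + (\<delta> / n * hexp p n (\<lambda>h. Q h n) + C / K) + M K n + cmod ((\<Sum>k=1..K. T k) - S)"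
      unfolding M_def using p by simp
    also have "\<dots> \<le> exp 2 * (((2 + C / n) * \<delta>) / n * real n + C\<^sup>2 / n)
        + (\<delta> / n * real n + C / K) + M K n + cmod ((\<Sum>k=1..K. T k) - S)"
      using \<delta> C EQ[OF n] by (intro add_mono mult_left_mono order_refl) auto
    also have "\<dots> = exp 2 * ((2 + C / real n) * \<delta> + C\<^sup>2 / real n) + (\<delta> + C / real K) + M K n + cmod ((\<Sum>k=1..K. T k) - S)"
      using n by simp
    finally show ?thesis .
  qed
  have "(\<lambda>n. hexp p n (\<lambda>h. cmod (P n h - exp (- S)))) \<longlonglongrightarrow> 0"
    unfolding tendsto_iff
  proof (intro allI impI)
    fix e :: real assume e: "e > 0"
    \<comment> \<open>Quarters of \<open>e\<close>: \<open>\<delta>\<close> comes first,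
      \<open>C\<close> depends on it, \<open>K\<close> is chosen after \<open>C\<close>, and
      \<open>n\<close> last. The terms that carry \<open>\<delta>\<close> alone are
      \<open>2 * exp 2 * \<delta>\<close> and \<open>\<delta>\<close>.\<close>
    define \<delta> where "\<delta> = e / (4 * (2 * exp 2 + 1))"
    have \<delta>: "\<delta> > 0" "2 * exp 2 * \<delta> + \<delta> = e / 4"
      using e by (auto simp: \<delta>_def add_pos_pos field_simps add_nonneg_eq_0_iff)
    obtain C where C: "C \<ge> 0" "\<forall>\<^sub>F n in sequentially. \<forall>d::int.
           real n * cmod (1 - W n d) \<le> \<delta> * (real_of_int d)\<^sup>2 + C"
      using qb[OF \<delta>(1)] by blast
    have "(\<lambda>K. cmod ((\<Sum>k=1..K. T k) - S)) \<longlonglongrightarrow> cmod (S - S)"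
    proof (intro tendsto_norm tendsto_diff tendsto_const)
      have "(\<lambda>K. \<Sum>k<Suc K. T k) \<longlonglongrightarrow> S"
        unfolding S_def using summable_LIMSEQ[OF sT] by (rule LIMSEQ_Suc)
      moreover have "(\<Sum>k<Suc K. T k) = (\<Sum>k=1..K. T k)" for K
        by (rule sum.mono_neutral_right) (auto simp: T_def Suc_le_eq)
      ultimately show "(\<lambda>K. \<Sum>k=1..K. T k) \<longlonglongrightarrow> S" by simp
    qed
    then have "\<forall>\<^sub>F K in sequentially. cmod ((\<Sum>k=1..K. T k) - S) < e / 4"
      using e by (intro order_tendstoD(2)) auto
    moreover have "(\<lambda>K. C / real K) \<longlonglongrightarrow> 0" by real_asymp
    then have "\<forall>\<^sub>F K in sequentially. C / real K < e / 4"
      using e by (intro order_tendstoD(2)) auto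
    ultimately have "\<forall>\<^sub>F K in sequentially. K \<ge> 1 \<and> cmod ((\<Sum>k=1..K. T k) - S) < e / 4 \<and> C / real K < e / 4"
      using eventually_ge_at_top[of 1] by eventually_elim simp
    from eventually_happens'[OF sequentially_bot this] obtain K where
      K: "K \<ge> 1" "cmod ((\<Sum>k=1..K. T k) - S) < e / 4" "C / real K < e / 4" by blast
    have "(\<lambda>n. exp 2 * (C / real n * \<delta> + C\<^sup>2 / real n)) \<longlonglongrightarrow> 0" by real_asymp
    from tendsto_add[OF this M0[of K]]
    have "\<forall>\<^sub>F n in sequentially. exp 2 * (C / real n * \<delta> + C\<^sup>2 / real n) + M K n < e / 4"
      using e by (intro order_tendstoD(2)) auto
    then show "\<forall>\<^sub>F n in sequentially. dist (hexp p n (\<lambda>h. cmod (P n h - exp (- S)))) 0 < e"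
      using C(2) eventually_ge_at_top[of 1]
    proof eventually_elim
      case (elim n)
      have "hexp p n (\<lambda>h. cmod (P n h - exp (- S)))
        \<le> exp 2 * ((2 + C / real n) * \<delta> + C\<^sup>2 / real n) + (\<delta> + C / real K) + M K n + cmod ((\<Sum>k=1..K. T k) - S)"
        by (rule bound[OF \<delta>(1) C(1) elim(3) K(1) elim(2)])
      also have "\<dots> = (2 * exp 2 * \<delta> + \<delta>) + (exp 2 * (C / real n * \<delta> + C\<^sup>2 / real n) + M K n)
          + C / real K + cmod ((\<Sum>k=1..K. T k) - S)"
        by (simp add: algebra_simps)
      also have "\<dots> < e / 4 + e / 4 + e / 4 + e / 4"
        unfolding \<delta>(2) by (intro add_strict_mono add_le_less_mono elim(1) K) simp
      finally show ?case using hexp_nonneg[OF p, of n "\<lambda>h. cmod (P n h - exp (- S))"] by simp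
    qed
  qed
  then have "(\<lambda>n. measure_pmf.expectation (history_pmf p n) (P n) - exp (- S)) \<longlonglongrightarrow> 0"
  proof (rule Lim_null_comparison[OF always_eventually, rotated])
    show "\<forall>n. norm (measure_pmf.expectation (history_pmf p n) (P n) - exp (- S))
        \<le> hexp p n (\<lambda>h. cmod (P n h - exp (- S)))"
    proof
      fix n
      have "measure_pmf.expectation (history_pmf p n) (P n) - exp (- S)
          = measure_pmf.expectation (history_pmf p n) (\<lambda>h. P n h - exp (- S))"
        using p by (subst Bochner_Integration.integral_diff) auto
      then show "norm (measure_pmf.expectation (history_pmf p n) (P n) - exp (- S))
        \<le> hexp p n (\<lambda>h. cmod (P n h - exp (- S)))"
        by (simp only: integral_norm_bound)
    qed
  qed
  then show "(\<lambda>n. measure_pmf.expectation (history_pmf p n)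
             (\<lambda>h. \<Prod>j=1..n. W n (int (even_count h n j) - int (odd_count h n j))))
          \<longlonglongrightarrow> exp (- suminf T)"
    unfolding P_def[abs_def] dl_def S_def by (simp add: LIM_zero_iff)
qed

subsection \<open>Homogeneity and a quadratic bound\<close>

text \<open>With \<open>r = c powr \<alpha>\<close> and \<open>m n\<close> the integer part of
  \<open>r * n\<close>, the ratio \<open>a (m n) / a n\<close> tends to \<open>c\<close>. Hence
  \<open>\<Psi> (c * \<theta> / a (m n))\<close> is also \<open>\<Psi>\<close> at an argument over
  \<open>a n\<close> that tends to \<open>\<theta>\<close>, while the prefactor changes from
  \<open>n\<close> to about \<open>r * n\<close>.\<close>

lemma regularly_varying_limit_homogeneous:
  fixes \<Psi> \<phi> :: "real \<Rightarrow> complex" and a :: "nat \<Rightarrow> real"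
  assumes lim: "\<And>s s0. s \<longlonglongrightarrow> s0 \<Longrightarrow> (\<lambda>n. of_nat n * (1 - \<Psi> (s n / a n))) \<longlonglongrightarrow> \<phi> s0"
    and pos: "\<And>n. n \<ge> 1 \<Longrightarrow> a n > 0"
    and rv: "regularly_varying a (1 / \<alpha>)" and \<alpha>: "\<alpha> > 0" and c: "c > 0"
  shows "\<phi> (c * \<theta>) = of_real (c powr \<alpha>) * \<phi> \<theta>"
proof -
  define r where "r = c powr \<alpha>"
  have r: "r > 0" using c by (simp add: r_def)
  define m where "m n = nat \<lfloor>r * real n\<rfloor>" for n
  have mlim: "filterlim m at_top sequentially"
    unfolding m_def using r by real_asymp
  have mr: "(\<lambda>n. real (m n) / real n) \<longlonglongrightarrow> r"
    unfolding m_def using r by real_asymp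
  have 1: "(\<lambda>n. of_nat (m n) * (1 - \<Psi> (c * \<theta> / a (m n)))) \<longlonglongrightarrow> \<phi> (c * \<theta>)"
    using filterlim_compose[OF lim[OF tendsto_const] mlim] .
  have "(\<lambda>n. a (m n) / a n) \<longlonglongrightarrow> r powr (1 / \<alpha>)"
    using rv r by (simp add: regularly_varying_def m_def)
  also have "r powr (1 / \<alpha>) = c"
    using c \<alpha> by (simp add: r_def powr_powr)
  finally have "(\<lambda>n. c * \<theta> / (a (m n) / a n)) \<longlonglongrightarrow> c * \<theta> / c"
    by (intro tendsto_intros) (use c in auto)
  then have "(\<lambda>n. c * \<theta> / (a (m n) / a n)) \<longlonglongrightarrow> \<theta>" using c by simp
  from lim[OF this] have "(\<lambda>n. of_real (real (m n) / real n) *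
      (of_nat n * (1 - \<Psi> (c * \<theta> / (a (m n) / a n) / a n)))) \<longlonglongrightarrow> of_real r * \<phi> \<theta>"
    by (intro tendsto_mult tendsto_of_real mr)
  moreover have "\<forall>\<^sub>F n in sequentially. of_real (real (m n) / real n) *
      (of_nat n * (1 - \<Psi> (c * \<theta> / (a (m n) / a n) / a n)))
      = of_nat (m n) * (1 - \<Psi> (c * \<theta> / a (m n)))"
    using eventually_ge_at_top[of 1]
  proof eventually_elim
    case (elim n)
    then have "a n \<noteq> 0" using pos[of n] by simp
    then show ?case using elim by simp
  qed
  ultimately have "(\<lambda>n. of_nat (m n) * (1 - \<Psi> (c * \<theta> / a (m n)))) \<longlonglongrightarrow> of_real r * \<phi> \<theta>"
    by (rule Lim_transform_eventually)
  from LIMSEQ_unique[OF 1 this] show ?thesis by (simp add: r_def)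
qed

section \<open>Quadratic growth of one minus a characteristic function\<close>

lemma norm_iexp_minus_one_sq: "(cmod (iexp u - 1))\<^sup>2 = 2 * (1 - cos u)"
proof -
  have "(cmod (iexp u - 1))\<^sup>2 = (cos u - 1)\<^sup>2 + (sin u)\<^sup>2"
    by (simp add: cmod_power2 Re_exp Im_exp)
  also have "\<dots> = (sin u)\<^sup>2 + (cos u)\<^sup>2 + 1 - 2 * cos u" by (simp add: power2_eq_square algebra_simps)
  finally show ?thesis by simp
qed

lemma norm_iexp_mult_minus_one_le: "cmod (iexp (real q * u) - 1) \<le> real q * cmod (iexp u - 1)"
proof (induction q)
  case (Suc q)
  have "iexp (real (Suc q) * u) - 1 = iexp u * (iexp (real q * u) - 1) + (iexp u - 1)"
    by (simp add: algebra_simps exp_add)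
  also have "cmod \<dots> \<le> cmod (iexp u * (iexp (real q * u) - 1)) + cmod (iexp u - 1)"
    by (rule norm_triangle_ineq)
  also have "\<dots> = cmod (iexp (real q * u) - 1) + cmod (iexp u - 1)"
    by (simp only: norm_mult norm_exp_i_times)
  finally show ?case using Suc by (simp add: algebra_simps)
qed simp

context real_distribution
begin

lemma integrable_iexp_mult [simp]: "integrable M (\<lambda>x. iexp (t * x))"
  by (rule integrable_iexp) auto

lemma integrable_cos_mult [simp]: "integrable M (\<lambda>x. cos (t * x))"
  by (rule integrable_const_bound[where B=1]) auto

lemma Re_char: "Re (char M t) = (\<integral>x. cos (t * x) \<partial>M)"
  unfolding char_def using integral_Re[OF integrable_iexp_mult[of t]] by (simp add: Re_exp)

lemma char_minus: "char M (- t) = cnj (char M t)"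
proof -
  have "cnj (char M t) = (\<integral>x. cnj (iexp (t * x)) \<partial>M)"
    unfolding char_def by (rule Bochner_Integration.integral_cnj[symmetric])
  also have "\<dots> = char M (- t)"
    unfolding char_def by (intro Bochner_Integration.integral_cong) (simp_all add: exp_cnj)
  finally show ?thesis ..
qed

lemma one_minus_char_add:
  "1 - char M (x + y) = (1 - char M x) + (1 - char M y)
     - (\<integral>u. (iexp (x * u) - 1) * (iexp (y * u) - 1) \<partial>M)"
proof -
  have "(\<integral>u. (iexp (x * u) - 1) * (iexp (y * u) - 1) \<partial>M)
      = (\<integral>u. iexp ((x + y) * u) - iexp (x * u) - iexp (y * u) + 1 \<partial>M)"
    by (rule Bochner_Integration.integral_cong) (simp_all add: algebra_simps exp_add)
  also have "\<dots> = char M (x + y) - char M x - char M y + 1"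
    unfolding char_def using integrable_iexp_mult[of x] integrable_iexp_mult[of y]
      integrable_iexp_mult[of "x + y"] prob_space by simp
  finally show ?thesis by simp
qed

text \<open>The correlation term of \<open>one_minus_char_add\<close> is split by
  \<open>2AB \<le> A\<^sup>2 + B\<^sup>2\<close> pointwise; the squares integrate to real parts of
  \<open>1 - char M\<close>, so no moment of the law is involved.\<close>

lemma norm_one_minus_char_add_le:
  "cmod (1 - char M (x + y)) \<le> 2 * cmod (1 - char M x) + 2 * cmod (1 - char M y)"
proof -
  have "cmod (\<integral>u. (iexp (x * u) - 1) * (iexp (y * u) - 1) \<partial>M)
      \<le> (\<integral>u. (1 - cos (x * u)) + (1 - cos (y * u)) \<partial>M)"
  proof (rule Bochner_Integration.integral_norm_bound_integral)
    show "integrable M (\<lambda>u. (iexp (x * u) - 1) * (iexp (y * u) - 1))"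
    proof (rule integrable_const_bound[where B=4])
      have "cmod ((iexp (x * u) - 1) * (iexp (y * u) - 1)) \<le> 2 * 2" for u
        unfolding norm_mult
        by (intro mult_mono order.trans[OF norm_triangle_ineq4]) (simp_all only: norm_exp_i_times norm_one, auto)
      then show "AE u in M. cmod ((iexp (x * u) - 1) * (iexp (y * u) - 1)) \<le> 4" by simp
    qed simp
    fix u
    define A B where "A = cmod (iexp (x * u) - 1)" and "B = cmod (iexp (y * u) - 1)"
    have "2 * (A * B) \<le> A\<^sup>2 + B\<^sup>2"
      using sum_squares_bound[of A B] by (simp only: mult.assoc)
    moreover have "A\<^sup>2 = 2 * (1 - cos (x * u))" "B\<^sup>2 = 2 * (1 - cos (y * u))"
      unfolding A_def B_def by (rule norm_iexp_minus_one_sq)+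
    ultimately have "A * B \<le> (1 - cos (x * u)) + (1 - cos (y * u))" by argo
    then show "cmod ((iexp (x * u) - 1) * (iexp (y * u) - 1)) \<le> (1 - cos (x * u)) + (1 - cos (y * u))"
      by (simp only: norm_mult A_def B_def)
  qed simp
  also have "\<dots> = Re (1 - char M x) + Re (1 - char M y)"
    using prob_space by (simp add: Re_char)
  also have "\<dots> \<le> cmod (1 - char M x) + cmod (1 - char M y)"
    by (intro add_mono complex_Re_le_cmod)
  finally show ?thesis
    unfolding one_minus_char_add[of x y]
    using norm_triangle_ineq4[of "(1 - char M x) + (1 - char M y)"]
      norm_triangle_ineq[of "1 - char M x" "1 - char M y"]
    by (smt (verit))
qed

text \<open>Here the correlation of \<open>q * t\<close> with \<open>t\<close> is at most
  \<open>2 * q\<close> times \<open>cmod (1 - char M t)\<close>, exactly the cross term of the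
  square of \<open>q + 1\<close>. Iterating \<open>norm_one_minus_char_add_le\<close> would instead
  double the constant at each step.\<close>

lemma norm_one_minus_char_mult_le:
  "cmod (1 - char M (real q * t)) \<le> (real q)\<^sup>2 * cmod (1 - char M t)"
proof (induction q)
  case (Suc q)
  have "cmod (\<integral>u. (iexp (real q * t * u) - 1) * (iexp (t * u) - 1) \<partial>M)
      \<le> (\<integral>u. real q * (2 * (1 - cos (t * u))) \<partial>M)"
  proof (rule Bochner_Integration.integral_norm_bound_integral)
    show "integrable M (\<lambda>u. (iexp (real q * t * u) - 1) * (iexp (t * u) - 1))"
    proof (rule integrable_const_bound[where B=4])
      have "cmod ((iexp (real q * t * u) - 1) * (iexp (t * u) - 1)) \<le> 2 * 2" for u
        unfolding norm_mult
        by (intro mult_mono order.trans[OF norm_triangle_ineq4]) (simp_all only: norm_exp_i_times norm_one, auto)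
      then show "AE u in M. cmod ((iexp (real q * t * u) - 1) * (iexp (t * u) - 1)) \<le> 4" by simp
    qed simp
    fix u
    have "cmod (iexp (real q * t * u) - 1) \<le> real q * cmod (iexp (t * u) - 1)"
      using norm_iexp_mult_minus_one_le[of q "t * u"] by (simp only: mult.assoc)
    then have "cmod (iexp (real q * t * u) - 1) * cmod (iexp (t * u) - 1)
        \<le> real q * cmod (iexp (t * u) - 1) * cmod (iexp (t * u) - 1)"
      by (rule mult_right_mono) simp
    then show "cmod ((iexp (real q * t * u) - 1) * (iexp (t * u) - 1)) \<le> real q * (2 * (1 - cos (t * u)))"
      unfolding norm_iexp_minus_one_sq[symmetric] norm_mult power2_eq_square by (simp only: mult.assoc)
  qed simp
  also have "\<dots> = real q * (2 * Re (1 - char M t))"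
    using prob_space by (simp add: Re_char)
  also have "\<dots> \<le> real q * (2 * cmod (1 - char M t))"
    by (intro mult_left_mono complex_Re_le_cmod) auto
  finally have "cmod (1 - char M (real q * t + t))
      \<le> cmod (1 - char M (real q * t)) + cmod (1 - char M t) + real q * (2 * cmod (1 - char M t))"
    unfolding one_minus_char_add[of "real q * t" t]
    using norm_triangle_ineq4[of "(1 - char M (real q * t)) + (1 - char M t)"]
      norm_triangle_ineq[of "1 - char M (real q * t)" "1 - char M t"]
    by (smt (verit))
  also have "\<dots> \<le> (real q)\<^sup>2 * cmod (1 - char M t) + cmod (1 - char M t) + real q * (2 * cmod (1 - char M t))"
    using Suc by simp
  finally show ?case by (simp add: algebra_simps power2_eq_square)
qed (simp add: char_zero)

lemma norm_one_minus_char_abs: "cmod (1 - char M \<bar>t\<bar>) = cmod (1 - char M t)"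
proof -
  have "1 - char M (- t) = cnj (1 - char M t)" by (simp add: char_minus)
  then have "cmod (1 - char M (- t)) = cmod (1 - char M t)" by (simp only: complex_mod_cnj)
  then show ?thesis by (simp add: abs_if)
qed

text \<open>Writing \<open>d = R q + r\<close> gains the factor \<open>R powr (\<alpha> - 2)\<close> over the crude quadratic bound.\<close>

lemma one_minus_char_quadratic_bound:
  fixes \<phi> :: "real \<Rightarrow> complex" and a :: "nat \<Rightarrow> real"
  assumes lim: "\<And>t. (\<lambda>n. of_nat n * (1 - char M (t / a n))) \<longlonglongrightarrow> \<phi> t"
    and hom: "\<And>c. c > 0 \<Longrightarrow> \<phi> (c * \<theta>) = of_real (c powr \<alpha>) * \<phi> \<theta>"
    and \<alpha>: "\<alpha> < 2" and \<delta>: "\<delta> > 0"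
  shows "\<exists>C\<ge>0. \<forall>\<^sub>F n in sequentially. \<forall>d::int.
           real n * cmod (1 - char M (real_of_int d * \<theta> / a n)) \<le> \<delta> * (real_of_int d)\<^sup>2 + C"
proof -
  \<comment> \<open>\<open>R\<close> is fixed so large that multiples of \<open>R * \<theta>\<close>
    cost at most \<open>\<delta>\<close> times the square; this is where \<open>\<alpha> < 2\<close>
    enters. The remainder, smaller than \<open>R\<close>, goes into \<open>C\<close>.\<close>
  have "(\<lambda>R. 2 * (real R powr (\<alpha> - 2) * cmod (\<phi> \<theta>) + 1 / real R ^ 2)) \<longlonglongrightarrow> 2 * (0 * cmod (\<phi> \<theta>) + 0)"
    using \<alpha> by (intro tendsto_intros tendsto_neg_powr filterlim_real_sequentially)
      (auto intro!: tendsto_divide_0[OF tendsto_const] filterlim_pow_at_top filterlim_real_sequentially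
        filterlim_at_top_imp_at_infinity)
  then have "\<forall>\<^sub>F R in sequentially. 2 * (real R powr (\<alpha> - 2) * cmod (\<phi> \<theta>) + 1 / real R ^ 2) < \<delta>"
    using \<delta> by (intro order_tendstoD(2)) auto
  from eventually_happens'[OF sequentially_bot eventually_conj[OF eventually_ge_at_top[of 1] this]]
  obtain R :: nat where R: "R \<ge> 1" "2 * (real R powr (\<alpha> - 2) * cmod (\<phi> \<theta>) + 1 / real R ^ 2) < \<delta>"
    by blast
  define \<rho> where "\<rho> t = cmod (1 - char M t)" for t
  define C where "C = 2 * (real R)\<^sup>2 * (cmod (\<phi> \<theta>) + 1)"
  have ev: "\<forall>\<^sub>F n in sequentially. real n * \<rho> (t / a n) \<le> cmod (\<phi> t) + 1" for t
  proof -
    have "(\<lambda>n. cmod (of_nat n * (1 - char M (t / a n)))) \<longlonglongrightarrow> cmod (\<phi> t)"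
      by (intro tendsto_norm lim)
    then have "\<forall>\<^sub>F n in sequentially. cmod (of_nat n * (1 - char M (t / a n))) < cmod (\<phi> t) + 1"
      by (rule order_tendstoD) simp
    then show ?thesis by eventually_elim (simp add: norm_mult \<rho>_def)
  qed
  have "C \<ge> 0" by (simp add: C_def)
  moreover have "\<forall>\<^sub>F n in sequentially. \<forall>d::int. real n * \<rho> (real_of_int d * \<theta> / a n) \<le> \<delta> * (real_of_int d)\<^sup>2 + C"
    \<comment> \<open>Convergence is invoked at the two arguments \<open>\<theta>\<close> and
      \<open>R * \<theta>\<close> alone, so one threshold for \<open>n\<close> serves every
      \<open>d\<close>.\<close>
    using ev[of \<theta>] ev[of "real R * \<theta>"]
  proof eventually_elim
    case (elim n)
    show ?case
    proof
      fix d :: int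
      define D where "D = nat \<bar>d\<bar>"
      define q r where "q = D div R" and "r = D mod R"
      define t where "t = \<theta> / a n"
      have D: "real D = real q * real R + real r"
        unfolding q_def r_def by (metis div_mult_mod_eq of_nat_add of_nat_mult)
      have dD: "real D = \<bar>real_of_int d\<bar>" by (simp add: D_def)
      have r: "r < R" using R by (simp add: r_def)
      have "\<rho> (real_of_int d * t) = \<rho> (real D * t)"
        unfolding dD \<rho>_def by (metis abs_mult norm_one_minus_char_abs abs_abs)
      also have "\<dots> = \<rho> (real q * (real R * t) + real r * t)"
        by (simp add: D algebra_simps)
      also have "\<dots> \<le> 2 * \<rho> (real q * (real R * t)) + 2 * \<rho> (real r * t)"
        unfolding \<rho>_def by (rule norm_one_minus_char_add_le)
      also have "\<dots> \<le> 2 * ((real q)\<^sup>2 * \<rho> (real R * t)) + 2 * ((real r)\<^sup>2 * \<rho> t)"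
        unfolding \<rho>_def by (intro add_mono mult_left_mono norm_one_minus_char_mult_le) auto
      finally have "real n * \<rho> (real_of_int d * t) \<le> real n * (2 * ((real q)\<^sup>2 * \<rho> (real R * t)) + 2 * ((real r)\<^sup>2 * \<rho> t))"
        by (rule mult_left_mono) simp
      also have "\<dots> = 2 * (real q)\<^sup>2 * (real n * \<rho> (real R * t)) + 2 * (real r)\<^sup>2 * (real n * \<rho> t)"
        by (simp add: algebra_simps)
      also have "\<dots> \<le> 2 * (real q)\<^sup>2 * (cmod (\<phi> (real R * \<theta>)) + 1) + 2 * (real R)\<^sup>2 * (cmod (\<phi> \<theta>) + 1)"
        using elim r by (intro add_mono mult_mono mult_left_mono power_mono)
          (auto simp: t_def \<rho>_def)
      finally have "real n * \<rho> (real_of_int d * t) \<le> 2 * (real q)\<^sup>2 * (cmod (\<phi> (real R * \<theta>)) + 1) + C"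
        by (simp add: C_def)
      moreover have "2 * (real q)\<^sup>2 * (cmod (\<phi> (real R * \<theta>)) + 1) \<le> \<delta> * (real_of_int d)\<^sup>2"
      proof -
        have "real q * real R \<le> real D" using D by simp
        then have "(real q * real R)\<^sup>2 \<le> (real D)\<^sup>2" by (intro power_mono) auto
        then have "(real q * real R)\<^sup>2 \<le> (real_of_int d)\<^sup>2" unfolding dD by simp
        moreover have "2 * (cmod (\<phi> (real R * \<theta>)) + 1) \<le> \<delta> * (real R)\<^sup>2"
        proof -
          have "2 * (cmod (\<phi> (real R * \<theta>)) + 1) = 2 * (real R powr \<alpha> * cmod (\<phi> \<theta>) + 1)"
            using R by (simp add: hom norm_mult)
          also have "\<dots> = 2 * (real R powr (\<alpha> - 2) * cmod (\<phi> \<theta>) + 1 / real R ^ 2) * (real R)\<^sup>2"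
            using R by (simp add: powr_diff field_simps)
          also have "\<dots> \<le> \<delta> * (real R)\<^sup>2" using R by (intro mult_right_mono) auto
          finally show ?thesis .
        qed
        ultimately have "(real q)\<^sup>2 * (2 * (cmod (\<phi> (real R * \<theta>)) + 1)) \<le> (real q)\<^sup>2 * (\<delta> * (real R)\<^sup>2)"
          and "\<delta> * (real q * real R)\<^sup>2 \<le> \<delta> * (real_of_int d)\<^sup>2"
          using \<delta> by (auto intro!: mult_left_mono)
        then show ?thesis by (simp add: power_mult_distrib algebra_simps)
      qed
      ultimately show "real n * \<rho> (real_of_int d * \<theta> / a n) \<le> \<delta> * (real_of_int d)\<^sup>2 + C" by (simp add: t_def)
    qed
  qed
  ultimately show ?thesis unfolding \<rho>_def by auto
qed

end

subsection \<open>Characteristic function of the walk\<close>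

locale counterbalanced =
  fixes M :: "'a measure" and \<mu> :: "real measure" and p :: real
    and X :: "nat \<Rightarrow> 'a \<Rightarrow> real" and \<epsilon> :: "nat \<Rightarrow> 'a \<Rightarrow> bool" and v :: "nat \<Rightarrow> 'a \<Rightarrow> nat"
  assumes model: "counterbalanced_model M \<mu> p X \<epsilon> v"
    and p: "0 < p" "p < 1"
begin

sublocale prob_space M using model by (simp add: counterbalanced_model_def)

lemma measurable_X [measurable]: "n \<ge> 1 \<Longrightarrow> X n \<in> borel_measurable M"
  and distr_X: "n \<ge> 1 \<Longrightarrow> distr M borel (X n) = \<mu>"
  and \<epsilon>_1: "\<omega> \<in> space M \<Longrightarrow> \<epsilon> 1 \<omega>"
  and measurable_\<epsilon>': "n \<ge> 2 \<Longrightarrow> \<epsilon> n \<in> measurable M (count_space UNIV)"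
  and distr_\<epsilon>: "n \<ge> 2 \<Longrightarrow> distr M (count_space UNIV) (\<epsilon> n) = measure_pmf (bernoulli_pmf p)"
  and measurable_v [measurable]: "n \<ge> 2 \<Longrightarrow> v n \<in> measurable M (count_space UNIV)"
  and distr_v: "n \<ge> 2 \<Longrightarrow> distr M (count_space UNIV) (v n) = measure_pmf (pmf_of_set {1..n - 1})"
  and indep: "indep_vars (\<lambda>_. borel) (merged_family X \<epsilon> v) ({1..} <+> ({2..} <+> {2..}))"
  using model by (simp_all add: counterbalanced_model_def)

lemma measurable_\<epsilon> [measurable]: "n \<ge> 1 \<Longrightarrow> \<epsilon> n \<in> measurable M (count_space UNIV)"
proof (cases "n = 1")
  case True
  then show ?thesis using \<epsilon>_1 by (subst measurable_cong[where g = "\<lambda>_. True"]) auto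
qed (use measurable_\<epsilon>' in auto)

sublocale \<mu>: real_distribution \<mu>
proof -
  have "real_distribution (distr M borel (X 1))" by (rule real_distribution_distr) (rule measurable_X, simp)
  then show "real_distribution \<mu>" by (subst (asm) distr_X) simp_all
qed

text \<open>Joint independence in the form in which it is applied: an exponential in the innovations
  times indicators of a history. Flags and parents start at index \<open>2\<close>, as in the
  model.\<close>

lemma integral_prod_family:
  fixes f :: "nat \<Rightarrow> real \<Rightarrow> complex" and g k :: "nat \<Rightarrow> real \<Rightarrow> complex"
  assumes fin: "finite J" "finite I" and sub: "J \<subseteq> {1..}" "I \<subseteq> {2..}"
    and meas: "\<And>j. f j \<in> borel_measurable borel" "\<And>i. g i \<in> borel_measurable borel" "\<And>i. k i \<in> borel_measurable borel"
    and bd: "\<And>j x. cmod (f j x) \<le> 1" "\<And>i x. cmod (g i x) \<le> 1" "\<And>i x. cmod (k i x) \<le> 1"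
  shows "(\<integral>\<omega>. (\<Prod>j\<in>J. f j (X j \<omega>)) * ((\<Prod>i\<in>I. g i (of_bool (\<epsilon> i \<omega>))) * (\<Prod>i\<in>I. k i (real (v i \<omega>)))) \<partial>M)
    = (\<Prod>j\<in>J. \<integral>\<omega>. f j (X j \<omega>) \<partial>M) * ((\<Prod>i\<in>I. \<integral>\<omega>. g i (of_bool (\<epsilon> i \<omega>)) \<partial>M) * (\<Prod>i\<in>I. \<integral>\<omega>. k i (real (v i \<omega>)) \<partial>M))"
proof -
  define Y where "Y i = (case i of Inl j \<Rightarrow> f j | Inr (Inl i) \<Rightarrow> g i | Inr (Inr i) \<Rightarrow> k i)" for i
  define S where "S = J <+> (I <+> I)"
  have iv: "indep_vars (\<lambda>_. borel) (\<lambda>i \<omega>. Y i (merged_family X \<epsilon> v i \<omega>)) S"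
  proof (rule indep_vars_compose2[where M' = "\<lambda>_. borel" and X = "merged_family X \<epsilon> v" and Y = Y])
    show "indep_vars (\<lambda>_. borel) (merged_family X \<epsilon> v) S"
      using sub unfolding S_def by (intro indep_vars_subset[OF indep]) blast
    show "Y i \<in> borel_measurable borel" for i
      using meas by (auto simp: Y_def split: sum.split)
  qed
  have "(\<integral>\<omega>. (\<Prod>i\<in>S. Y i (merged_family X \<epsilon> v i \<omega>)) \<partial>M) = (\<Prod>i\<in>S. \<integral>\<omega>. Y i (merged_family X \<epsilon> v i \<omega>) \<partial>M)"
  proof (rule indep_vars_lebesgue_integral[OF _ iv])
    show "finite S" using fin by (simp add: S_def)
    fix i assume "i \<in> S"
    then have "(\<lambda>\<omega>. Y i (merged_family X \<epsilon> v i \<omega>)) \<in> borel_measurable M"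
      using iv by (auto simp: indep_vars_def)
    then show "integrable M (\<lambda>\<omega>. Y i (merged_family X \<epsilon> v i \<omega>))"
      by (rule integrable_const_bound[where B = 1, rotated])
        (use bd in \<open>auto simp: Y_def split: sum.split\<close>)
  qed
  then show ?thesis
    using fin by (simp add: S_def prod.Plus Y_def merged_family_def)
qed

lemma char_sum_X: "char (distr M borel (\<lambda>\<omega>. (\<Sum>j=1..n. X j \<omega>) / c)) t = char \<mu> (t / c) ^ n"
proof -
  have [measurable]: "(\<lambda>\<omega>. \<Sum>j=1..n. X j \<omega>) \<in> borel_measurable M"
    by (intro borel_measurable_sum) auto
  have "char (distr M borel (\<lambda>\<omega>. (\<Sum>j=1..n. X j \<omega>) / c)) t = (\<integral>\<omega>. iexp (t * ((\<Sum>j=1..n. X j \<omega>) / c)) \<partial>M)"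
    unfolding char_def by (subst integral_distr) auto
  also have "\<dots> = (\<integral>\<omega>. (\<Prod>j=1..n. iexp (t / c * X j \<omega>)) \<partial>M)"
  proof (rule Bochner_Integration.integral_cong[OF refl])
    fix \<omega>
    have "t * ((\<Sum>j=1..n. X j \<omega>) / c) = (\<Sum>j=1..n. t / c * X j \<omega>)"
      by (simp add: sum_distrib_left sum_divide_distrib)
    then show "iexp (t * ((\<Sum>j=1..n. X j \<omega>) / c)) = (\<Prod>j=1..n. iexp (t / c * X j \<omega>))"
      by (simp only: of_real_sum sum_distrib_left exp_sum finite_atLeastAtMost)
  qed
  also have "\<dots> = (\<Prod>j=1..n. \<integral>\<omega>. iexp (t / c * X j \<omega>) \<partial>M)"
    using integral_prod_family[of "{1..n}" "{}" "\<lambda>_ x. iexp (t / c * x)" "\<lambda>_ _. 1" "\<lambda>_ _. 1"]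
    by (simp del: of_real_mult of_real_divide)
  also have "\<dots> = (\<Prod>j=1..n. char \<mu> (t / c))"
  proof (rule prod.cong[OF refl])
    fix j assume "j \<in> {1..n}"
    then show "(\<integral>\<omega>. iexp (t / c * X j \<omega>) \<partial>M) = char \<mu> (t / c)"
      unfolding char_def using distr_X[of j, symmetric] by (simp add: integral_distr)
  qed
  finally show ?thesis by simp
qed

text \<open>Outside \<open>{2..n}\<close> the default of \<open>history_pmf\<close> is stored, so
  that \<open>hist\<close> almost surely lies in the support of that law; at step \<open>1\<close>
  it agrees with the sure innovation.\<close>

definition hist :: "nat \<Rightarrow> 'a \<Rightarrow> nat \<Rightarrow> bool \<times> nat" where
  "hist n \<omega> i = (if i \<in> {2..n} then (\<epsilon> i \<omega>, v i \<omega>) else (True, 0))"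

abbreviation walk :: "nat \<Rightarrow> 'a \<Rightarrow> real" where
  "walk n \<omega> \<equiv> counterbalanced_walk (\<lambda>j. X j \<omega>) (\<lambda>j. \<epsilon> j \<omega>) (\<lambda>j. v j \<omega>) n"

lemma AE_hist: "AE \<omega> in M. hist n \<omega> \<in> set_pmf (history_pmf p n)"
proof -
  have "AE \<omega> in M. v i \<omega> \<in> {1..i - 1}" if i: "i \<in> {2..n}" for i
  proof -
    have "AE x in distr M (count_space UNIV) (v i). x \<in> {1..i - 1}"
      using i by (subst distr_v) (auto simp: AE_measure_pmf_iff)
    then show ?thesis using i by (subst (asm) AE_distr_iff) auto
  qed
  then have "AE \<omega> in M. \<forall>i\<in>{2..n}. v i \<omega> \<in> {1..i - 1}" by (intro AE_finite_allI) auto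
  then show ?thesis
    by eventually_elim (auto simp: set_history_pmf[OF p] PiE_dflt_def hist_def)
qed

lemma walk_hist:
  assumes "\<omega> \<in> space M" "hist n \<omega> \<in> set_pmf (history_pmf p n)"
  shows "walk n \<omega> = (\<Sum>j=1..n. (real (even_count (hist n \<omega>) n j) - real (odd_count (hist n \<omega>) n j)) * X j \<omega>)"
proof -
  have "walk n \<omega> = counterbalanced_walk (\<lambda>j. X j \<omega>) (\<lambda>k. fst (hist n \<omega> k)) (\<lambda>k. snd (hist n \<omega> k)) n"
    unfolding counterbalanced_walk_def
  proof (intro sum.cong[OF refl] counterbalanced_step_cong)
    fix j i assume j: "j \<in> {1..n}" "i \<in> {1..j}"
    show "\<epsilon> i \<omega> = fst (hist n \<omega> i)"
      using j \<epsilon>_1[OF assms(1)] by (cases "i = 1") (auto simp: hist_def)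
    show "v i \<omega> = snd (hist n \<omega> i)" if "\<not> \<epsilon> i \<omega>"
      using j \<epsilon>_1[OF assms(1)] that by (cases "i = 1") (auto simp: hist_def)
  qed auto
  then show ?thesis
    using counterbalanced_walk_conv_counts[OF valid_history_pmf[OF p assms(2)]] by simp
qed

section \<open>Measurability of the walk\<close>

lemma measurable_innovations:
  "(\<lambda>\<omega>. real (innovations (\<lambda>j. \<epsilon> j \<omega>) n)) \<in> borel_measurable M"
proof (induction n)
  case (Suc n)
  have "(\<lambda>\<omega>. real (innovations (\<lambda>j. \<epsilon> j \<omega>) n) + of_bool (\<epsilon> (Suc n) \<omega>)) \<in> borel_measurable M"
    unfolding of_bool_def using Suc by (intro borel_measurable_add measurable_If) auto
  then show ?case by (simp add: innovations_Suc)
qed (simp add: innovations_def)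

text \<open>A step evaluates the innovations and earlier steps at random indices. Each takes
  finitely many values, so the step is rewritten as a finite sum over them.\<close>

lemma measurable_step:
  "n \<ge> 1 \<Longrightarrow> (\<lambda>\<omega>. counterbalanced_step (\<lambda>j. X j \<omega>) (\<lambda>j. \<epsilon> j \<omega>) (\<lambda>j. v j \<omega>) n) \<in> borel_measurable M"
proof (induction n rule: less_induct)
  case (less n)
  define st where "st m \<omega> = counterbalanced_step (\<lambda>j. X j \<omega>) (\<lambda>j. \<epsilon> j \<omega>) (\<lambda>j. v j \<omega>) m" for m \<omega>
  have IH: "st m \<in> borel_measurable M" if "1 \<le> m" "m < n" for m
    using less.IH[OF that(2,1)] unfolding st_def .
  have [measurable]: "(\<lambda>\<omega>. real (innovations (\<lambda>j. \<epsilon> j \<omega>) n)) \<in> borel_measurable M"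
    by (rule measurable_innovations)
  have "{\<omega> \<in> space M. innovations (\<lambda>j. \<epsilon> j \<omega>) n = k} \<in> sets M" for k
  proof -
    have "{\<omega> \<in> space M. real (innovations (\<lambda>j. \<epsilon> j \<omega>) n) = real k} \<in> sets M" by measurable
    then show ?thesis by simp
  qed
  then have A: "(\<lambda>\<omega>. \<Sum>k=1..n. if real (innovations (\<lambda>j. \<epsilon> j \<omega>) n) = real k then X k \<omega> else 0) \<in> borel_measurable M"
    by (intro borel_measurable_sum measurable_If) auto
  have B: "(\<lambda>\<omega>. \<Sum>m=1..<n. if v n \<omega> = m then - st m \<omega> else 0) \<in> borel_measurable M"
    using IH by (intro borel_measurable_sum measurable_If) auto
  have "(\<lambda>\<omega>. if \<epsilon> n \<omega> then \<Sum>k=1..n. if real (innovations (\<lambda>j. \<epsilon> j \<omega>) n) = real k then X k \<omega> else 0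
      else \<Sum>m=1..<n. if v n \<omega> = m then - st m \<omega> else 0) \<in> borel_measurable M"
    using less.prems A B by (intro measurable_If) auto
  moreover have "st n \<omega> = (if \<epsilon> n \<omega> then \<Sum>k=1..n. if real (innovations (\<lambda>j. \<epsilon> j \<omega>) n) = real k then X k \<omega> else 0
      else \<Sum>m=1..<n. if v n \<omega> = m then - st m \<omega> else 0)" if "\<omega> \<in> space M" for \<omega>
  proof -
    have "1 \<le> innovations (\<lambda>j. \<epsilon> j \<omega>) n" "innovations (\<lambda>j. \<epsilon> j \<omega>) n \<le> n"
      using innovations_pos[of "\<lambda>j. \<epsilon> j \<omega>" n] innovations_le \<epsilon>_1[OF that] less.prems by auto
    then show ?thesis unfolding st_def by (subst counterbalanced_step.simps) auto
  qed
  ultimately have "st n \<in> borel_measurable M" by (simp cong: measurable_cong)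
  then show ?case unfolding st_def .
qed

lemma measurable_walk [measurable]: "walk n \<in> borel_measurable M"
  unfolding counterbalanced_walk_def by (intro borel_measurable_sum measurable_step) auto

text \<open>Conditionally on the history, the walk is a linear combination of the innovations.\<close>

lemma char_walk:
  "char (distr M borel (\<lambda>\<omega>. walk n \<omega> / c)) t = measure_pmf.expectation (history_pmf p n)
     (\<lambda>h. \<Prod>j=1..n. char \<mu> (real_of_int (int (even_count h n j) - int (odd_count h n j)) * t / c))"
proof -
  define H where "H = set_pmf (history_pmf p n)"
  have finH: "finite H" unfolding H_def by (rule finite_set_history_pmf[OF p])
  define s where "s h j = real_of_int (int (even_count h n j) - int (odd_count h n j)) * t / c" for h j
  \<comment> \<open>The contribution of the event \<open>hist n \<omega> = h\<close>, written as one
    product over the merged family so that it factorises. Its mean is the probability of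
    \<open>h\<close> times a product of characteristic functions.\<close>
  define T where "T h \<omega> = (\<Prod>j=1..n. iexp (s h j * X j \<omega>)) *
      ((\<Prod>i=2..n. indicator {of_bool (fst (h i)) :: real} (of_bool (\<epsilon> i \<omega>))) *
       (\<Prod>i=2..n. indicator {real (snd (h i))} (real (v i \<omega>))))" for h \<omega>
  have ET: "(\<integral>\<omega>. T h \<omega> \<partial>M) = pmf (history_pmf p n) h *\<^sub>R (\<Prod>j=1..n. char \<mu> (s h j))"
    and iT: "integrable M (T h)" if h: "h \<in> H" for h
  proof -
    have E: "(\<integral>\<omega>. (indicator {of_bool (fst (h i)) :: real} (of_bool (\<epsilon> i \<omega>)) :: complex) \<partial>M)
        = of_real (pmf (bernoulli_pmf p) (fst (h i)))" if "i \<in> {2..n}" for i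
    proof -
      have "(\<integral>\<omega>. (indicator {of_bool (fst (h i)) :: real} (of_bool (\<epsilon> i \<omega>)) :: complex) \<partial>M)
          = (\<integral>\<omega>. of_real (indicator {fst (h i)} (\<epsilon> i \<omega>)) \<partial>M)"
        by (intro Bochner_Integration.integral_cong) (auto simp: indicator_def)
      also have "\<dots> = of_real (\<integral>\<omega>. indicator {fst (h i)} (\<epsilon> i \<omega>) \<partial>M)"
        by (rule integral_complex_of_real)
      also have "(\<integral>\<omega>. (indicator {fst (h i)} (\<epsilon> i \<omega>) :: real) \<partial>M)
          = (\<integral>b. indicator {fst (h i)} b \<partial>distr M (count_space UNIV) (\<epsilon> i))"
        using that by (subst integral_distr) auto
      also have "\<dots> = pmf (bernoulli_pmf p) (fst (h i))"
        using that by (subst distr_\<epsilon>) (auto simp: measure_pmf_single)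
      finally show ?thesis .
    qed
    have V: "(\<integral>\<omega>. (indicator {real (snd (h i))} (real (v i \<omega>)) :: complex) \<partial>M)
        = of_real (pmf (pmf_of_set {1..i - 1}) (snd (h i)))" if "i \<in> {2..n}" for i
    proof -
      have "(\<integral>\<omega>. (indicator {real (snd (h i))} (real (v i \<omega>)) :: complex) \<partial>M)
          = (\<integral>\<omega>. of_real (indicator {snd (h i)} (v i \<omega>)) \<partial>M)"
        by (intro Bochner_Integration.integral_cong) (auto simp: indicator_def)
      also have "\<dots> = of_real (\<integral>\<omega>. indicator {snd (h i)} (v i \<omega>) \<partial>M)"
        by (rule integral_complex_of_real)
      also have "(\<integral>\<omega>. (indicator {snd (h i)} (v i \<omega>) :: real) \<partial>M)
          = (\<integral>b. indicator {snd (h i)} b \<partial>distr M (count_space UNIV) (v i))"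
        using that by (subst integral_distr) auto
      also have "\<dots> = pmf (pmf_of_set {1..i - 1}) (snd (h i))"
        using that by (subst distr_v) (auto simp: measure_pmf_single)
      finally show ?thesis .
    qed
    have Xj: "(\<integral>\<omega>. iexp (s h j * X j \<omega>) \<partial>M) = char \<mu> (s h j)" if "j \<in> {1..n}" for j
      unfolding char_def using distr_X[of j, symmetric] that by (simp add: integral_distr)
    have "(\<integral>\<omega>. T h \<omega> \<partial>M) = (\<Prod>j=1..n. \<integral>\<omega>. iexp (s h j * X j \<omega>) \<partial>M) *
      ((\<Prod>i=2..n. \<integral>\<omega>. indicator {of_bool (fst (h i)) :: real} (of_bool (\<epsilon> i \<omega>)) \<partial>M) *
       (\<Prod>i=2..n. \<integral>\<omega>. indicator {real (snd (h i))} (real (v i \<omega>)) \<partial>M))"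
      unfolding T_def
      by (rule integral_prod_family[of "{1..n}" "{2..n}" "\<lambda>j x. iexp (s h j * x)"
            "\<lambda>i. indicator {of_bool (fst (h i))}" "\<lambda>i. indicator {real (snd (h i))}"])
         (auto simp: indicator_def simp del: of_real_mult)
    also have "\<dots> = (\<Prod>j=1..n. char \<mu> (s h j)) *
      ((\<Prod>i=2..n. of_real (pmf (bernoulli_pmf p) (fst (h i)))) *
       (\<Prod>i=2..n. of_real (pmf (pmf_of_set {1..i - 1}) (snd (h i)))))"
      by (intro arg_cong2[where f = times] prod.cong refl Xj E V)
    also have "\<dots> = (\<Prod>j=1..n. char \<mu> (s h j)) *
       of_real (\<Prod>i=2..n. pmf (bernoulli_pmf p) (fst (h i)) * pmf (pmf_of_set {1..i - 1}) (snd (h i)))"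
      by (simp add: prod.distrib)
    also have "(\<Prod>i=2..n. pmf (bernoulli_pmf p) (fst (h i)) * pmf (pmf_of_set {1..i - 1}) (snd (h i)))
        = pmf (history_pmf p n) h"
    proof -
      have "h x = (True, 0)" if "x \<notin> {2..n}" for x
        using h that by (auto simp: H_def set_history_pmf[OF p] PiE_dflt_def)
      then show ?thesis
        unfolding history_pmf_def by (subst pmf_Pi') (auto intro!: prod.cong simp: pmf_pair[symmetric])
    qed
    finally show "(\<integral>\<omega>. T h \<omega> \<partial>M) = pmf (history_pmf p n) h *\<^sub>R (\<Prod>j=1..n. char \<mu> (s h j))"
      by (simp add: scaleR_conv_of_real)
    show "integrable M (T h)"
    proof (rule integrable_const_bound[where B = 1])
      have "cmod (T h \<omega>) \<le> 1 * (1 * 1)" for \<omega>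
        unfolding T_def norm_mult prod_norm[symmetric]
        by (intro mult_mono prod_le_1 mult_nonneg_nonneg prod_nonneg) (auto simp: indicator_def simp del: of_real_mult)
      then show "AE \<omega> in M. cmod (T h \<omega>) \<le> 1" by simp
      have "(\<lambda>\<omega>. indicator {of_bool (fst (h i)) :: real} (of_bool (\<epsilon> i \<omega>)) :: complex) \<in> borel_measurable M" if "i \<in> {2..n}" for i
      proof -
        have "(\<lambda>\<omega>. if \<epsilon> i \<omega> = fst (h i) then 1 else 0 :: complex) \<in> borel_measurable M"
          using that by (intro measurable_If) auto
        also have "(\<lambda>\<omega>. if \<epsilon> i \<omega> = fst (h i) then 1 else 0 :: complex)
            = (\<lambda>\<omega>. indicator {of_bool (fst (h i)) :: real} (of_bool (\<epsilon> i \<omega>)))"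
          by (auto simp: indicator_def fun_eq_iff)
        finally show ?thesis .
      qed
      moreover have "(\<lambda>\<omega>. indicator {real (snd (h i))} (real (v i \<omega>)) :: complex) \<in> borel_measurable M" if "i \<in> {2..n}" for i
      proof -
        have "(\<lambda>\<omega>. if v i \<omega> = snd (h i) then 1 else 0 :: complex) \<in> borel_measurable M"
          using that by (intro measurable_If) auto
        also have "(\<lambda>\<omega>. if v i \<omega> = snd (h i) then 1 else 0 :: complex)
            = (\<lambda>\<omega>. indicator {real (snd (h i))} (real (v i \<omega>)))"
          by (auto simp: indicator_def fun_eq_iff)
        finally show ?thesis .
      qed
      moreover have "(\<lambda>\<omega>. iexp (s h j * X j \<omega>)) \<in> borel_measurable M" if "j \<in> {1..n}" for j
        using that by simp
      ultimately show "T h \<in> borel_measurable M"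
        unfolding T_def by (intro borel_measurable_times borel_measurable_prod)
    qed
  qed
  have "char (distr M borel (\<lambda>\<omega>. walk n \<omega> / c)) t = (\<integral>\<omega>. iexp (t * (walk n \<omega> / c)) \<partial>M)"
    unfolding char_def by (subst integral_distr) auto
  also have "\<dots> = (\<integral>\<omega>. (\<Sum>h\<in>H. T h \<omega>) \<partial>M)"
  proof (rule integral_cong_AE)
    show "(\<lambda>\<omega>. iexp (t * (walk n \<omega> / c))) \<in> borel_measurable M" by simp
    show "(\<lambda>\<omega>. \<Sum>h\<in>H. T h \<omega>) \<in> borel_measurable M"
      using iT by (intro borel_measurable_sum) auto
    show "AE \<omega> in M. iexp (t * (walk n \<omega> / c)) = (\<Sum>h\<in>H. T h \<omega>)"
      using AE_hist[of n] AE_space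
    proof eventually_elim
      case (elim \<omega>)
      then have hH: "hist n \<omega> \<in> H" by (simp add: H_def)
      have T: "T h \<omega> = (if h = hist n \<omega> then \<Prod>j=1..n. iexp (s h j * X j \<omega>) else 0)" if "h \<in> H" for h
      proof (cases "h = hist n \<omega>")
        case True
        have "(\<Prod>i=2..n. indicator {of_bool (fst (h i)) :: real} (of_bool (\<epsilon> i \<omega>)) :: complex) = 1"
          "(\<Prod>i=2..n. indicator {real (snd (h i))} (real (v i \<omega>)) :: complex) = 1"
          using True by (auto simp: hist_def intro!: prod.neutral)
        then show ?thesis using True by (simp add: T_def)
      next
        case False
        then obtain i where i: "h i \<noteq> hist n \<omega> i" by auto
        then have i2: "i \<in> {2..n}"
          using that by (auto simp: H_def set_history_pmf[OF p] PiE_dflt_def hist_def split: if_splits)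
        then have "fst (h i) \<noteq> \<epsilon> i \<omega> \<or> snd (h i) \<noteq> v i \<omega>" using i by (auto simp: hist_def prod_eq_iff)
        then have "(\<Prod>i=2..n. indicator {of_bool (fst (h i)) :: real} (of_bool (\<epsilon> i \<omega>)) :: complex) = 0
          \<or> (\<Prod>i=2..n. indicator {real (snd (h i))} (real (v i \<omega>)) :: complex) = 0"
          using i2 by (auto simp: indicator_def intro!: bexI[of _ i])
        then show ?thesis using False by (auto simp: T_def)
      qed
      have "(\<Sum>h\<in>H. T h \<omega>) = (\<Prod>j=1..n. iexp (s (hist n \<omega>) j * X j \<omega>))"
        using T finH hH by simp
      also have "\<dots> = iexp (\<Sum>j=1..n. s (hist n \<omega>) j * X j \<omega>)"
        by (simp only: of_real_sum sum_distrib_left exp_sum finite_atLeastAtMost)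
      also have "(\<Sum>j=1..n. s (hist n \<omega>) j * X j \<omega>) = t * (walk n \<omega> / c)"
        unfolding walk_hist[OF elim(2,1)] s_def
        by (simp add: sum_distrib_left sum_divide_distrib mult_ac)
      finally show ?case ..
    qed
  qed
  also have "\<dots> = (\<Sum>h\<in>H. pmf (history_pmf p n) h *\<^sub>R (\<Prod>j=1..n. char \<mu> (s h j)))"
    using iT by (simp add: ET)
  also have "\<dots> = measure_pmf.expectation (history_pmf p n) (\<lambda>h. \<Prod>j=1..n. char \<mu> (s h j))"
    using finH by (intro integral_measure_pmf[symmetric]) (auto simp: H_def)
  finally show ?thesis by (simp only: s_def)
qed

end

subsection \<open>Stable limits\<close>

lemma char_scaled_add_pair:
  fixes A B :: real
  assumes "real_distribution \<nu>"
  defines "D \<equiv> distr (\<nu> \<Otimes>\<^sub>M \<nu>) borel (\<lambda>z. A * fst z + B * snd z)"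
  shows "real_distribution D" "char D t = char \<nu> (A * t) * char \<nu> (B * t)"
proof -
  interpret \<nu>: real_distribution \<nu> by fact
  interpret P: pair_prob_space \<nu> \<nu> ..
  show "real_distribution D"
    unfolding D_def by (rule P.real_distribution_distr) measurable
  have int: "integrable (\<nu> \<Otimes>\<^sub>M \<nu>) (\<lambda>(x, y). iexp (A * t * x) * iexp (B * t * y))"
    by (rule P.integrable_const_bound[where B = 1])
       (auto simp: norm_mult case_prod_unfold simp del: of_real_mult)
  have "char D t = (\<integral>z. iexp (t * (A * fst z + B * snd z)) \<partial>(\<nu> \<Otimes>\<^sub>M \<nu>))"
    unfolding char_def D_def by (subst integral_distr) auto
  also have "\<dots> = (\<integral>(x, y). iexp (A * t * x) * iexp (B * t * y) \<partial>(\<nu> \<Otimes>\<^sub>M \<nu>))"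
    by (intro Bochner_Integration.integral_cong refl)
       (auto simp: exp_add[symmetric] algebra_simps)
  also have "\<dots> = (\<integral>x. (\<integral>y. iexp (A * t * x) * iexp (B * t * y) \<partial>\<nu>) \<partial>\<nu>)"
    using P.integral_fst[OF int] by simp
  also have "\<dots> = char \<nu> (A * t) * char \<nu> (B * t)"
    unfolding char_def by (simp del: of_real_mult)
  finally show "char D t = char \<nu> (A * t) * char \<nu> (B * t)" .
qed

lemma char_return: "char (return borel c) t = iexp (t * c)"
  unfolding char_def by (subst integral_return) auto

lemma real_distribution_return: "real_distribution (return borel (c::real))"
  by (intro real_distribution.intro real_distribution_axioms.intro prob_space_return) auto

text \<open>Two independent copies of a variable with unimodular characteristic function coincide
  almost surely.\<close>

lemma norm_char_eq_1_imp_return: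
  assumes "real_distribution \<nu>" and norm: "\<And>t. cmod (char \<nu> t) = 1"
  shows "\<exists>c. \<nu> = return borel c"
proof -
  interpret \<nu>: real_distribution \<nu> by fact
  interpret P: pair_prob_space \<nu> \<nu> ..
  define D where "D = distr (\<nu> \<Otimes>\<^sub>M \<nu>) borel (\<lambda>z. 1 * fst z + (- 1) * snd z :: real)"
  note D = char_scaled_add_pair[OF assms(1), of 1 "- 1", folded D_def]
  have "char D t = char (return borel 0) t" for t
  proof -
    have "char D t = char \<nu> t * cnj (char \<nu> t)"
      using D(2)[of t] \<nu>.char_minus[of t] by simp
    also have "\<dots> = 1" by (simp add: complex_norm_square[symmetric] norm)
    finally show ?thesis by (simp add: char_return)
  qed
  then have "D = return borel 0"
    by (intro Levy_uniqueness D(1) real_distribution_return) auto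
  then have "AE z in D. z = 0" by (simp only:) (subst AE_return, auto)
  then have "AE z in \<nu> \<Otimes>\<^sub>M \<nu>. fst z = snd z"
    unfolding D_def by (subst (asm) AE_distr_iff) auto
  \<comment> \<open>For almost every \<open>x\<close>, almost every \<open>y\<close> equals
    \<open>x\<close>; any one such \<open>x\<close> is the atom.\<close>
  from P.AE_pair[OF this] have "AE x in \<nu>. AE y in \<nu>. x = y" by simp
  then obtain x0 where x0: "AE y in \<nu>. x0 = y"
    using eventually_happens'[OF \<nu>.ae_filter_bot] by blast
  have "char \<nu> t = char (return borel x0) t" for t
  proof -
    have "char \<nu> t = (\<integral>y. iexp (t * x0) \<partial>\<nu>)"
      unfolding char_def using x0 by (intro integral_cong_AE) auto
    also have "\<dots> = iexp (t * x0)" using \<nu>.prob_space by (simp del: of_real_mult)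
    finally show ?thesis by (simp only: char_return)
  qed
  then have "\<nu> = return borel x0"
    by (intro Levy_uniqueness assms(1) real_distribution_return) auto
  then show ?thesis ..
qed

text \<open>The \<open>n\<close>-fold power of the characteristic function is
  \<open>exp (- n * \<phi> t)\<close>, and homogeneity moves \<open>n\<close> into the argument as
  \<open>n powr (1 / \<alpha>)\<close>. The law is strictly stable, with shift
  \<open>b = 0\<close>.\<close>

lemma stable_lawI:
  assumes \<alpha>: "0 < \<alpha>" "\<alpha> \<le> 2" and \<nu>: "real_distribution \<nu>"
    and nd: "\<And>c. \<nu> \<noteq> return borel c"
    and char: "\<And>t. char \<nu> t = exp (- \<phi> t)"
    and hom: "\<And>c t. c > 0 \<Longrightarrow> \<phi> (c * t) = of_real (c powr \<alpha>) * \<phi> t"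
  shows "stable_law \<alpha> \<nu>"
  unfolding stable_law_def
proof (intro conjI allI impI)
  interpret \<nu>: real_distribution \<nu> by fact
  fix n :: nat assume n: "n \<ge> 1"
  interpret PP: product_prob_space "\<lambda>_::nat. \<nu>" by unfold_locales
  interpret PM: prob_space "PiM {..<n} (\<lambda>_. \<nu>)" by (rule prob_space_PiM) (rule \<nu>.prob_space_axioms)
  define c where "c = real n powr (1 / \<alpha>)"
  have c: "c > 0" "c powr \<alpha> = real n" using n \<alpha> by (auto simp: c_def powr_powr)
  have [measurable]: "(\<lambda>x. \<Sum>i<n. x i) \<in> borel_measurable (PiM {..<n} (\<lambda>_. \<nu>))"
    by (intro borel_measurable_sum) measurable
  have "distr (PiM {..<n} (\<lambda>_. \<nu>)) borel (\<lambda>x. \<Sum>i<n. x i) = distr \<nu> borel (\<lambda>x. c * x + 0)"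
  proof (rule Levy_uniqueness)
    show "real_distribution (distr (PiM {..<n} (\<lambda>_. \<nu>)) borel (\<lambda>x. \<Sum>i<n. x i))"
      by (rule PM.real_distribution_distr) measurable
    show "real_distribution (distr \<nu> borel (\<lambda>x. c * x + 0))"
      by (rule \<nu>.real_distribution_distr) measurable
    show "char (distr (PiM {..<n} (\<lambda>_. \<nu>)) borel (\<lambda>x. \<Sum>i<n. x i)) = char (distr \<nu> borel (\<lambda>x. c * x + 0))"
    proof
      fix t
      have "char (distr (PiM {..<n} (\<lambda>_. \<nu>)) borel (\<lambda>x. \<Sum>i<n. x i)) t
          = (\<integral>x. iexp (t * (\<Sum>i<n. x i)) \<partial>PiM {..<n} (\<lambda>_. \<nu>))"
        unfolding char_def by (subst integral_distr) auto
      also have "\<dots> = (\<integral>x. (\<Prod>i<n. iexp (t * x i)) \<partial>PiM {..<n} (\<lambda>_. \<nu>))"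
        by (simp only: of_real_sum sum_distrib_left exp_sum finite_lessThan)
      also have "\<dots> = (\<Prod>i<n. \<integral>x. iexp (t * x) \<partial>\<nu>)"
        by (rule PP.product_integral_prod) (simp_all del: of_real_mult)
      also have "\<dots> = char \<nu> t ^ n" by (simp add: char_def)
      also have "\<dots> = exp (- \<phi> (c * t))"
        unfolding char hom[OF c(1)] c(2) by (simp flip: exp_of_nat_mult)
      also have "\<dots> = char (distr \<nu> borel (\<lambda>x. c * x + 0)) t"
        unfolding char[symmetric] unfolding char_def
        by (subst integral_distr) (auto intro!: Bochner_Integration.integral_cong simp: mult_ac)
      finally show "char (distr (PiM {..<n} (\<lambda>_. \<nu>)) borel (\<lambda>x. \<Sum>i<n. x i)) t
          = char (distr \<nu> borel (\<lambda>x. c * x + 0)) t" .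
    qed
  qed
  then show "\<exists>b. distr (PiM {..<n} (\<lambda>_. \<nu>)) borel (\<lambda>x. \<Sum>i<n. x i)
      = distr \<nu> borel (\<lambda>x. real n powr (1 / \<alpha>) * x + b)"
    unfolding c_def by blast
qed (use \<alpha> \<nu> nd in auto)

lemma cluster_density_conv_counterbalanced_term:
  fixes \<phi> :: "real \<Rightarrow> complex"
  assumes "0 < p" "p < 1"
  shows "(\<Sum>l<k. of_real (cluster_density p (k - l) l) * \<phi> (real_of_int (int k - 2 * int l) * \<theta>))
           = of_real (p / (1 - p)) * counterbalanced_term p \<phi> \<theta> k"
  unfolding counterbalanced_term_def sum_distrib_left
  by (intro sum.cong) (auto simp: cluster_density_def)

text \<open>Grouping the terms of the series by the sign of \<open>k - 2l\<close> turns a homogeneous exponent into a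
  combination of \<open>\<phi> \<theta>\<close> and \<open>\<phi> (- \<theta>)\<close>.\<close>

lemma counterbalanced_exponent_homogeneous:
  fixes \<phi> :: "real \<Rightarrow> complex"
  assumes p: "0 < p" "p < 1" and \<alpha>: "0 < \<alpha>" "\<alpha> < 2" and \<phi>0: "\<phi> 0 = 0"
    and hom: "\<And>c t. c > 0 \<Longrightarrow> \<phi> (c * t) = of_real (c powr \<alpha>) * \<phi> t"
  obtains P N where "P > 0" "N \<ge> 0"
    "\<And>\<theta>. counterbalanced_exponent p \<phi> \<theta> = of_real P * \<phi> \<theta> + of_real N * \<phi> (- \<theta>)"
proof -
  define d where "d k l = real_of_int (int k - 2 * int l)" for k l
  define P' where "P' k = (\<Sum>l<k. cluster_density p (k - l) l * (of_bool (d k l > 0) * \<bar>d k l\<bar> powr \<alpha>))" for k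
  define N' where "N' k = (\<Sum>l<k. cluster_density p (k - l) l * (of_bool (d k l < 0) * \<bar>d k l\<bar> powr \<alpha>))" for k
  note c0 = cluster_density_nonneg[OF p]
  \<comment> \<open>The imbalance is an integer, so it vanishes or has modulus at least
    \<open>1\<close>, and the power \<open>\<alpha> < 2\<close> is dominated by the square.\<close>
  have le: "\<bar>d k l\<bar> powr \<alpha> \<le> (d k l)\<^sup>2" for k l
  proof (cases "d k l = 0")
    case False
    then have "int k - 2 * int l \<noteq> 0" unfolding d_def by simp
    then have "1 \<le> \<bar>int k - 2 * int l\<bar>" by linarith
    then have "1 \<le> \<bar>d k l\<bar>" unfolding d_def by linarith
    then have "\<bar>d k l\<bar> powr \<alpha> \<le> \<bar>d k l\<bar> powr 2" using \<alpha> by (intro powr_mono) auto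
    then show ?thesis using False by (simp add: powr_numeral)
  qed simp
  have pl: "of_bool Q * \<bar>d k l\<bar> powr \<alpha> \<le> (d k l)\<^sup>2" for Q k l
    using le[of k l] by (cases Q) simp_all
  note sq = summable_cluster_density_squares[OF p, folded d_def]
  have sP: "summable P'" and P0: "P' k \<ge> 0" for k
  proof -
    show nn: "P' k \<ge> 0" for k unfolding P'_def by (intro sum_nonneg mult_nonneg_nonneg c0) auto
    show "summable P'"
    proof (rule summable_comparison_test'[OF sq])
      show "norm (P' k) \<le> (\<Sum>l<k. cluster_density p (k - l) l * (d k l)\<^sup>2)" for k
        unfolding real_norm_def abs_of_nonneg[OF nn] unfolding P'_def
        by (intro sum_mono mult_left_mono c0 pl)
    qed
  qed
  have sN: "summable N'" and N0: "N' k \<ge> 0" for k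
  proof -
    show nn: "N' k \<ge> 0" for k unfolding N'_def by (intro sum_nonneg mult_nonneg_nonneg c0) auto
    show "summable N'"
    proof (rule summable_comparison_test'[OF sq])
      show "norm (N' k) \<le> (\<Sum>l<k. cluster_density p (k - l) l * (d k l)\<^sup>2)" for k
        unfolding real_norm_def abs_of_nonneg[OF nn] unfolding N'_def
        by (intro sum_mono mult_left_mono c0 pl)
    qed
  qed
  \<comment> \<open>Isolated innovations, of type \<open>(1, 0)\<close>, have positive density. The
    resulting \<open>P > 0\<close> is what keeps the limit law from degenerating.\<close>
  have "0 < P' 1"
  proof -
    have "0 < pochhammer (1 + 1 / (1 - p)) 1" using p by (intro pochhammer_pos) (auto intro: add_pos_pos)
    then have "cluster_density p 1 0 > 0"
      using p unfolding cluster_density_def by (auto simp: eulerian_def intro!: mult_pos_pos divide_pos_pos)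
    then show ?thesis by (simp add: P'_def d_def)
  qed
  then have "suminf P' > 0" using P0 by (intro suminf_pos2[OF sP, of 1]) auto
  moreover have "suminf N' \<ge> 0" using N0 by (intro suminf_nonneg sN)
  moreover have "counterbalanced_exponent p \<phi> \<theta> = of_real (suminf P') * \<phi> \<theta> + of_real (suminf N') * \<phi> (- \<theta>)" for \<theta>
  proof -
    have t: "of_real (p / (1 - p)) * counterbalanced_term p \<phi> \<theta> k = of_real (P' k) * \<phi> \<theta> + of_real (N' k) * \<phi> (- \<theta>)" for k
    proof -
      have h: "\<phi> (d k l * \<theta>) = of_real (of_bool (d k l > 0) * \<bar>d k l\<bar> powr \<alpha>) * \<phi> \<theta>
          + of_real (of_bool (d k l < 0) * \<bar>d k l\<bar> powr \<alpha>) * \<phi> (- \<theta>)" for l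
        using hom[of "d k l" \<theta>] hom[of "- d k l" "- \<theta>"] \<phi>0
        by (cases "d k l > 0"; cases "d k l = 0") auto
      show ?thesis
        unfolding cluster_density_conv_counterbalanced_term[OF p, symmetric] d_def[symmetric] h
          P'_def N'_def of_real_sum sum_distrib_right sum.distrib[symmetric]
        by (intro sum.cong refl) (simp add: distrib_left mult.assoc)
    qed
    have "(\<lambda>k. of_real (P' k) * \<phi> \<theta> + of_real (N' k) * \<phi> (- \<theta>)) sums
        (of_real (suminf P') * \<phi> \<theta> + of_real (suminf N') * \<phi> (- \<theta>))"
      by (intro sums_add sums_mult2 sums_of_real summable_sums sP sN)
    then have s: "(\<lambda>k. of_real (p / (1 - p)) * counterbalanced_term p \<phi> \<theta> k) sums
        (of_real (suminf P') * \<phi> \<theta> + of_real (suminf N') * \<phi> (- \<theta>))"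
      unfolding t .
    have ne: "of_real (p / (1 - p)) \<noteq> (0 :: complex)" using p by simp
    then have "summable (counterbalanced_term p \<phi> \<theta>)"
      using sums_summable[OF s] by (simp only: summable_cmult_iff) simp
    from suminf_mult[OF this] sums_unique[OF s] show ?thesis
      unfolding counterbalanced_exponent_def by metis
  qed
  ultimately show ?thesis using that by blast
qed

text \<open>Summability is part of the conclusion because \<open>counterbalanced_exponent\<close> is
  defined through \<open>suminf\<close>, which represents the series only if it converges.\<close>

theorem theorem5p1:
  fixes M :: "'a measure" and \<mu> \<nu> :: "real measure" and p \<alpha> :: real
    and X :: "nat \<Rightarrow> 'a \<Rightarrow> real" and \<epsilon> :: "nat \<Rightarrow> 'a \<Rightarrow> bool" and v :: "nat \<Rightarrow> 'a \<Rightarrow> nat"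
    and a :: "nat \<Rightarrow> real" and \<phi> :: "real \<Rightarrow> complex"
  assumes "0 < \<alpha>" and "\<alpha> < 2"
    and "0 < p" and "p < 1"
    and "counterbalanced_model M \<mu> p X \<epsilon> v"
    and "\<And>n. n \<ge> 1 \<Longrightarrow> a n > 0"
    and "regularly_varying a (1 / \<alpha>)"
    and "stable_law \<alpha> \<nu>" and "characteristic_exponent \<nu> \<phi>"
    and "weak_conv_m (\<lambda>n. distr M borel (\<lambda>\<omega>. (\<Sum>j=1..n. X j \<omega>) / a n)) \<nu>"
  shows "(\<forall>\<theta>. summable (counterbalanced_term p \<phi> \<theta>)) \<and>
    (\<exists>\<nu>'. stable_law \<alpha> \<nu>' \<and>
       characteristic_exponent \<nu>' (counterbalanced_exponent p \<phi>) \<and>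
       weak_conv_m
         (\<lambda>n. distr M borel
            (\<lambda>\<omega>. counterbalanced_walk (\<lambda>j. X j \<omega>) (\<lambda>j. \<epsilon> j \<omega>) (\<lambda>j. v j \<omega>) n / a n)) \<nu>')"
proof -
  note \<alpha> = assms(1,2) and p = assms(3,4) and pos = assms(6) and rv = assms(7)
  interpret cb: counterbalanced M \<mu> p X \<epsilon> v
    using assms(5) p by unfold_locales
  have \<nu>: "real_distribution \<nu>" and nd: "\<And>c. \<nu> \<noteq> return borel c"
    using assms(8) by (auto simp: stable_law_def)
  interpret \<nu>: real_distribution \<nu> by (rule \<nu>)
  have \<phi>: "continuous_on UNIV \<phi>" "\<phi> 0 = 0" "\<And>t. char \<nu> t = exp (- \<phi> t)"
    using assms(9) by (auto simp: characteristic_exponent_def)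
  have rd: "real_distribution (distr M borel (\<lambda>\<omega>. (\<Sum>j=1..n. X j \<omega>) / a n))" for n
    by (rule cb.real_distribution_distr, intro borel_measurable_divide borel_measurable_sum) auto
  have unif: "uniform_limit {-S..S} (\<lambda>n t. char \<mu> (t / a n) ^ n) (\<lambda>t. exp (- \<phi> t)) sequentially" for S
    using weak_conv_imp_char_uniform_limit[OF rd \<nu> assms(10), of S]
    unfolding cb.char_sum_X \<phi>(3)[symmetric] by (simp add: cb.char_sum_X fun_eq_iff cong: uniform_limit_cong)
  have c\<mu>: "continuous_on UNIV (char \<mu>)"
    by (simp add: continuous_on_eq_continuous_at cb.\<mu>.isCont_char)
  note lim = domain_of_attraction_exponent_tendsto[OF c\<mu> cb.\<mu>.char_zero \<phi>(1,2) unif]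
  have hom: "\<phi> (c * t) = of_real (c powr \<alpha>) * \<phi> t" if "c > 0" for c t
    using regularly_varying_limit_homogeneous[OF lim pos rv \<alpha>(1) that] .
  have main: "summable (counterbalanced_term p \<phi> \<theta>)"
    "(\<lambda>n. char (distr M borel (\<lambda>\<omega>. cb.walk n \<omega> / a n)) \<theta>) \<longlonglongrightarrow> exp (- counterbalanced_exponent p \<phi> \<theta>)" for \<theta>
  proof -
    define W where "W n d = char \<mu> (real_of_int d * \<theta> / a n)" for n and d :: int
    define \<Phi> where "\<Phi> d = \<phi> (real_of_int d * \<theta>)" for d :: int
    have limW: "(\<lambda>n. of_nat n * (1 - W n d)) \<longlonglongrightarrow> \<Phi> d" for d
      unfolding W_def \<Phi>_def by (rule lim) (rule tendsto_const)
    have qb: "\<exists>C\<ge>0. \<forall>\<^sub>F n in sequentially. \<forall>d::int.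
           real n * cmod (1 - W n d) \<le> \<delta> * (real_of_int d)\<^sup>2 + C" if "\<delta> > 0" for \<delta>
      unfolding W_def
      by (rule cb.\<mu>.one_minus_char_quadratic_bound[where \<phi> = \<phi> and \<alpha> = \<alpha>])
         (use lim[OF tendsto_const] hom \<alpha> that in auto)
    have W1: "cmod (W n d) \<le> 1" "W n 0 = 1" for n d
      unfolding W_def by (simp_all add: cb.\<mu>.cmod_char_le_1 cb.\<mu>.char_zero)
    note * = cluster_product_tendsto[OF p W1 limW qb,
        unfolded \<Phi>_def cluster_density_conv_counterbalanced_term[OF p]]
    have ne: "of_real (p / (1 - p)) \<noteq> (0 :: complex)" using p by simp
    show s: "summable (counterbalanced_term p \<phi> \<theta>)"
      using *(1) ne by (simp only: summable_cmult_iff) simp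
    have "(\<Sum>k. of_real (p / (1 - p)) * counterbalanced_term p \<phi> \<theta> k) = counterbalanced_exponent p \<phi> \<theta>"
      unfolding counterbalanced_exponent_def by (rule suminf_mult[OF s])
    with *(2) show "(\<lambda>n. char (distr M borel (\<lambda>\<omega>. cb.walk n \<omega> / a n)) \<theta>) \<longlonglongrightarrow> exp (- counterbalanced_exponent p \<phi> \<theta>)"
      unfolding cb.char_walk W_def by simp
  qed
  obtain P N where PN: "P > 0" "N \<ge> 0"
    and exponent: "\<And>\<theta>. counterbalanced_exponent p \<phi> \<theta> = of_real P * \<phi> \<theta> + of_real N * \<phi> (- \<theta>)"
    using counterbalanced_exponent_homogeneous[OF p \<alpha> \<phi>(2) hom] by blast
  \<comment> \<open>For independent copies \<open>Z\<close> and \<open>Z'\<close> with law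
    \<open>\<nu>\<close>, the variable \<open>A * Z - B * Z'\<close> has exponent
    \<open>\<phi> (A * t) + \<phi> (- B * t)\<close>, and homogeneity with these scales turns it
    into \<open>P * \<phi> t + N * \<phi> (- t)\<close>.\<close>
  define A B where "A = P powr (1 / \<alpha>)" and "B = N powr (1 / \<alpha>)"
  define \<nu>' where "\<nu>' = distr (\<nu> \<Otimes>\<^sub>M \<nu>) borel (\<lambda>z. A * fst z + (- B) * snd z)"
  note \<nu>' = char_scaled_add_pair[OF \<nu>, of A "- B", folded \<nu>'_def]
  have char': "char \<nu>' t = exp (- counterbalanced_exponent p \<phi> t)" for t
  proof -
    have "A > 0" "A powr \<alpha> = P" using PN \<alpha> by (auto simp: A_def powr_powr)
    then have "\<phi> (A * t) = of_real P * \<phi> t" using hom[of A t] by simp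
    moreover have "\<phi> (- B * t) = of_real N * \<phi> (- t)"
    proof (cases "N = 0")
      case False
      then have "B > 0" "B powr \<alpha> = N" using PN \<alpha> by (auto simp: B_def powr_powr)
      then show ?thesis using hom[of B "- t"] by simp
    qed (simp add: B_def \<phi>(2))
    ultimately show ?thesis unfolding \<nu>'(2) \<phi>(3) exponent by (simp flip: exp_add)
  qed
  \<comment> \<open>Nonnegative real parts cannot cancel between \<open>\<phi> t\<close> and
    \<open>\<phi> (- t)\<close>; hence a point mass as limit would force the characteristic function
    of \<open>\<nu>\<close> to be unimodular.\<close>
  have Re\<phi>: "Re (\<phi> t) \<ge> 0" for t
    using \<nu>.cmod_char_le_1[of t] unfolding \<phi>(3) by simp
  have nd': "\<nu>' \<noteq> return borel c" for c
  proof
    assume eq: "\<nu>' = return borel c"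
    have "cmod (char \<nu> t) = 1" for t
    proof -
      have "cmod (char \<nu>' t) = 1" unfolding eq char_return by (rule norm_exp_i_times)
      then have "Re (counterbalanced_exponent p \<phi> t) = 0" unfolding char' by simp
      then have "P * Re (\<phi> t) + N * Re (\<phi> (- t)) = 0" unfolding exponent by simp
      moreover have "P * Re (\<phi> t) \<ge> 0" "N * Re (\<phi> (- t)) \<ge> 0" using PN Re\<phi> by simp_all
      ultimately have "P * Re (\<phi> t) = 0" by linarith
      then show ?thesis using PN unfolding \<phi>(3) by simp
    qed
    then show False using norm_char_eq_1_imp_return[OF \<nu>] nd by blast
  qed
  have hom': "counterbalanced_exponent p \<phi> (c * t) = of_real (c powr \<alpha>) * counterbalanced_exponent p \<phi> t"
    if "c > 0" for c t
    unfolding exponent using hom[OF that, of t] hom[OF that, of "- t"] by (simp add: algebra_simps)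
  have "stable_law \<alpha> \<nu>'"
    using \<alpha> by (intro stable_lawI[OF _ _ \<nu>'(1) nd' char' hom']) auto
  moreover have "characteristic_exponent \<nu>' (counterbalanced_exponent p \<phi>)"
  proof -
    have "continuous_on UNIV (counterbalanced_exponent p \<phi>)"
      unfolding exponent[abs_def]
      by (intro continuous_intros \<phi>(1) continuous_on_compose2[OF \<phi>(1)]) auto
    then show ?thesis using char' exponent[of 0] \<phi>(2) by (simp add: characteristic_exponent_def)
  qed
  moreover have "weak_conv_m (\<lambda>n. distr M borel (\<lambda>\<omega>. cb.walk n \<omega> / a n)) \<nu>'"
  proof (rule levy_continuity)
    show "real_distribution (distr M borel (\<lambda>\<omega>. cb.walk n \<omega> / a n))" for n
      by (rule cb.real_distribution_distr) simp
    show "(\<lambda>n. char (distr M borel (\<lambda>\<omega>. cb.walk n \<omega> / a n)) t) \<longlonglongrightarrow> char \<nu>' t" for t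
      unfolding char' by (rule main(2))
  qed (rule \<nu>'(1))
  ultimately show ?thesis using main(1) by blast
qed

end
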